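(* Let $0<k<3/2$, $Q(f)=f^{1+1/k}$ for $f\ge0$, and $M>0$. Then the minimizer of $\mathcal H_C$ over $\mathcal F_M$ is unique up to shifts in $x$: if $f_0,f_1\in\mathcal F_M$ both satisfy $\mathcal H_C(f_0)=\mathcal H_C(f_1)=\inf_{\mathcal F_M}\mathcal H_C$, then there is $a\in\mathbb R^3$ with $f_1(x,v)=f_0(x+a,v)$ for a.e. $(x,v)$.
   Context: For measurable $f=f(x,v)\ge0$ on $\mathbb R^3\times\mathbb R^3$: $\rho_f(x)=\int f(x,v)\,dv$, $U_f=-\rho_f*\frac1{|\cdot|}$, $E_{kin}(f)=\frac12\iint|v|^2f\,dv\,dx$, $E_{pot}(f)=-\frac1{8\pi}\int|\nabla U_f|^2dx$, $\mathcal C(f)=\iint Q(f(x,v))\,dv\,dx$, $\mathcal P(f)=\mathcal C(f)+E_{kin}(f)$, $\mathcal H_C(f)=\mathcal P(f)+E_{pot}(f)$. For $M>0$, $\mathcal F_M=\{f\in L^1(\mathbb R^6): f\ge0,\ \iint f\,dv\,dx=M,\ \mathcal P(f)<\infty\}$. *)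

theory Defs
  imports "HOL-Analysis.Analysis"
begin

text \<open>Phase-space densities f = f(x,v) on R^3 x R^3 are functions on the product
  type real^3 \<times> real^3; lborel on this type is Lebesgue measure on R^6.\<close>

type_synonym phase = "(real^3) \<times> (real^3)"

definition Qk :: "real \<Rightarrow> real \<Rightarrow> real" where
  "Qk k s = s powr (1 + 1 / k)"

definition rho :: "(phase \<Rightarrow> real) \<Rightarrow> real^3 \<Rightarrow> real" where
  "rho f x = (\<integral> v. f (x, v) \<partial>lborel)"

definition Upot :: "(phase \<Rightarrow> real) \<Rightarrow> real^3 \<Rightarrow> real" where
  "Upot f x = - (\<integral> y. rho f y / norm (x - y) \<partial>lborel)"

definition gradU :: "(phase \<Rightarrow> real) \<Rightarrow> real^3 \<Rightarrow> real^3" where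
  "gradU f x = (\<integral> y. (rho f y / norm (x - y) ^ 3) *\<^sub>R (x - y) \<partial>lborel)"

definition Ekin :: "(phase \<Rightarrow> real) \<Rightarrow> real" where
  "Ekin f = (1/2) * (\<integral> z. (norm (snd z))\<^sup>2 * f z \<partial>lborel)"

definition Epot :: "(phase \<Rightarrow> real) \<Rightarrow> real" where
  "Epot f = - (1 / (8 * pi)) * (\<integral> x. (norm (gradU f x))\<^sup>2 \<partial>lborel)"

definition Cas :: "real \<Rightarrow> (phase \<Rightarrow> real) \<Rightarrow> real" where
  "Cas k f = (\<integral> z. Qk k (f z) \<partial>lborel)"

definition Pfun :: "real \<Rightarrow> (phase \<Rightarrow> real) \<Rightarrow> real" where
  "Pfun k f = Cas k f + Ekin f"

definition P_finite :: "real \<Rightarrow> (phase \<Rightarrow> real) \<Rightarrow> bool" where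
  "P_finite k f \<longleftrightarrow>
     (\<integral>\<^sup>+ z. ennreal (Qk k (f z) + (1/2) * (norm (snd z))\<^sup>2 * f z) \<partial>lborel) < \<infinity>"

definition HC :: "real \<Rightarrow> (phase \<Rightarrow> real) \<Rightarrow> real" where
  "HC k f = Pfun k f + Epot f"

definition FM :: "real \<Rightarrow> real \<Rightarrow> (phase \<Rightarrow> real) set" where
  "FM k M = {f. integrable lborel f \<and> (\<forall>z. 0 \<le> f z) \<and>
                (\<integral> z. f z \<partial>lborel) = M \<and> P_finite k f}"

end

theory Submission
  imports Defs
begin

text \<open>
  For a given spatial density \<open>\<rho>\<close> the functional \<open>C + E\<^sub>k\<^sub>i\<^sub>n\<close> has a unique minimizer in
  velocity space, with value a constant times the integral of \<open>\<rho>\<^sup>q\<close>, where \<open>q = 1 + 1/(k + 3/2) > 4/3\<close>;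
  and \<open>E\<^sub>p\<^sub>o\<^sub>t\<close> is a negative multiple of the Coulomb energy of \<open>\<rho>\<close>. So it suffices to treat the reduced
  functional \<open>J\<close> of \<open>\<rho>\<close>.

  \<^item> Polarizing \<open>\<rho>\<close> with respect to a plane preserves mass and the \<open>\<rho>\<^sup>q\<close>-term and increases the Coulomb
    energy, strictly unless \<open>\<rho>\<close> dominates its mirror image on one side of the plane. A minimizer is
    therefore symmetric about every plane that bisects its mass, and hence spherically symmetric about
    some point.
  \<^item> Scaling shows that \<open>J \<sigma> \<ge> J \<rho> (\<mu>/M)\<^sup>\<zeta>\<close> for every \<open>\<sigma>\<close> of arbitrary mass \<open>\<mu>\<close>. Free variations of this
    inequality give the Euler-Lagrange equation with an explicit multiplier \<open>E = - \<zeta> J \<rho> / M > 0\<close>, the same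
    for all minimizers.
  \<^item> By Newton's theorem the potential of a spherically symmetric minimizer equals \<open>M/r\<close> for all
    \<open>r \<ge> R\<close>, where \<open>R\<close> depends only on \<open>E\<close> and \<open>M\<close>. Integrating inward from \<open>R\<close>, where the
    Euler-Lagrange equation is Lipschitz away from the centre, determines \<open>\<rho>\<close>.
\<close>

text \<open>The obstacle is the Lagrange multiplier: two minimizers of the same mass could a priori
  solve the Euler-Lagrange equation with different multipliers, and then uniqueness for the radial
  equation would compare nothing. The scaling law settles this: the infimum of \<open>J\<close> is a
  fixed power of the mass, and its derivative in the mass fixes the multiplier in terms of the
  minimal value.

  The hypothesis k < 3/2, that is q > 4/3, makes the Coulomb energy subordinate to the rho^q term.
  This keeps \<open>J\<close> bounded below and makes its minimum negative, hence E > 0.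

  The centre comes from three planes only. Bisecting planes orthogonal to the coordinate axes meet
  in a point a, their reflections compose to x -> 2a - x, and a density invariant under this map is
  bisected by every plane through a.

  The radial equation is solved from outside because the exterior potential is known exactly, while
  the central value is not. It is used as an integral equation, so integrable densities suffice, and
  agreement at positive radii is enough since the centre is a null set.\<close>

abbreviation leb3 :: "(real^3) measure" where "leb3 \<equiv> lborel"

section \<open>Measure-preserving maps, axial coordinates and Newton's shell theorem\<close>

definition leb_preserving :: "('a::euclidean_space \<Rightarrow> 'a) \<Rightarrow> bool" where
  "leb_preserving T \<longleftrightarrow> T \<in> borel_measurable borel \<and> distr lborel borel T = lborel"

lemma leb_preserving_measurable: "leb_preserving T \<Longrightarrow> T \<in> borel_measurable borel"
  by (simp add: leb_preserving_def)

lemma leb_preserving_nn_integral: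
  assumes "leb_preserving T" "F \<in> borel_measurable borel"
  shows "(\<integral>\<^sup>+x. F (T x) \<partial>lborel) = (\<integral>\<^sup>+x. F x \<partial>lborel)"
  using assms nn_integral_distr[of T lborel borel F] by (simp add: leb_preserving_def)

lemma leb_preserving_integral:
  fixes F :: "'a::euclidean_space \<Rightarrow> 'b::{banach, second_countable_topology}"
  assumes "leb_preserving T" "F \<in> borel_measurable borel"
  shows "(\<integral>x. F (T x) \<partial>lborel) = (\<integral>x. F x \<partial>lborel)"
  using assms integral_distr[of T lborel borel F] by (simp add: leb_preserving_def)

lemma leb_preserving_integrable:
  fixes F :: "'a::euclidean_space \<Rightarrow> 'b::{banach, second_countable_topology}"
  assumes "leb_preserving T" "F \<in> borel_measurable borel"
  shows "integrable lborel (\<lambda>x. F (T x)) \<longleftrightarrow> integrable lborel F"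
  using assms integrable_distr_eq[of T lborel borel F] by (simp add: leb_preserving_def)

lemma leb_preserving_AE:
  assumes "leb_preserving T" "AE x in lborel. P x"
  shows "AE x in lborel. P (T x)"
proof -
  have T: "distr lborel borel T = lborel" "T \<in> lborel \<rightarrow>\<^sub>M borel"
    using assms(1) by (simp_all add: leb_preserving_def)
  have "AE x in distr lborel borel T. P x" using assms(2) unfolding T(1) .
  with T(2) show ?thesis by (intro AE_distrD[of T lborel borel P])
qed

lemma leb_preserving_comp:
  assumes "leb_preserving S" "leb_preserving T"
  shows "leb_preserving (\<lambda>x. S (T x))"
proof -
  have [measurable]: "S \<in> borel_measurable borel" "T \<in> borel_measurable borel"
    using assms by (auto simp: leb_preserving_def)
  have "distr lborel borel (\<lambda>x. S (T x)) = distr (distr lborel borel T) borel S"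
    by (subst distr_distr) (auto simp: comp_def)
  then show ?thesis using assms by (simp add: leb_preserving_def)
qed

lemma leb_preserving_plus: "leb_preserving (\<lambda>x. c + x)"
  using lborel_distr_plus[of c] by (simp add: leb_preserving_def)

lemma leb_preserving_uminus: "leb_preserving (\<lambda>x::'a::euclidean_space. - x)"
proof -
  have "lborel = distr lborel borel (\<lambda>x::'a. - x)"
    using lborel_affine[of "-1" "0::'a"] by (simp add: density_1)
  then show ?thesis by (simp add: leb_preserving_def)
qed

lemma leb_preserving_minus: "leb_preserving (\<lambda>x. c - x)"
  using leb_preserving_comp[OF leb_preserving_plus[of c] leb_preserving_uminus] by simp

lemma leb_preserving_orthogonal:
  fixes f :: "real^3 \<Rightarrow> real^3"
  assumes "orthogonal_transformation f"
  shows "leb_preserving f"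
proof -
  have lin: "linear f" using assms by (simp add: orthogonal_transformation_linear)
  have [measurable]: "f \<in> borel_measurable borel"
    by (intro borel_measurable_continuous_onI linear_continuous_on) (simp add: lin linear_linear)
  have bij: "bij f" using assms by (simp add: orthogonal_transformation_bij)
  have "lborel = distr lborel borel f"
  proof (rule lborel_eqI)
    fix l u :: "real^3" assume le: "\<And>b. b \<in> Basis \<Longrightarrow> l \<bullet> b \<le> u \<bullet> b"
    have eq: "f -` box l u = inv f ` box l u" using bij by (metis bij_vimage_eq_inv_image)
    have o: "orthogonal_transformation (inv f)"
      using assms by (rule orthogonal_transformation_inv)
    have m: "inv f ` box l u \<in> lmeasurable"
      by (rule measurable_orthogonal_image[OF o]) simp
    have b: "inv f ` box l u \<in> sets borel"
      unfolding eq[symmetric] using measurable_sets[of f borel borel "box l u"] by simp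
    have "emeasure lborel (inv f ` box l u) = emeasure lebesgue (inv f ` box l u)"
      using b by simp
    also have "\<dots> = ennreal (measure lebesgue (inv f ` box l u))"
      using m by (intro emeasure_eq_measure2)
    also have "\<dots> = ennreal (measure lebesgue (box l u))"
      by (simp add: measure_orthogonal_image[OF o])
    also have "\<dots> = ennreal (\<Prod>b\<in>Basis. (u - l) \<bullet> b)"
      using le by (simp add: measure_lborel_box_eq)
    finally show "emeasure (distr lborel borel f) (box l u) = ennreal (\<Prod>b\<in>Basis. (u - l) \<bullet> b)"
      by (simp add: emeasure_distr eq)
  qed simp
  then show ?thesis by (simp add: leb_preserving_def)
qed

lemma nn_integral_lborel_scale:
  fixes F :: "'a::euclidean_space \<Rightarrow> ennreal"
  assumes [measurable]: "F \<in> borel_measurable borel" and "c > 0"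
  shows "(\<integral>\<^sup>+x. F (c *\<^sub>R x) \<partial>lborel) = ennreal (1 / c ^ DIM('a)) * (\<integral>\<^sup>+x. F x \<partial>lborel)"
proof -
  have "(\<integral>\<^sup>+x. F x \<partial>lborel) = (\<integral>\<^sup>+x. F x \<partial>density (distr lborel borel (\<lambda>x::'a. 0 + c *\<^sub>R x)) (\<lambda>_. \<bar>c\<bar>^DIM('a)))"
    using assms(2) by (subst lborel_affine[of c "0::'a", symmetric]) auto
  also have "\<dots> = ennreal (c^DIM('a)) * (\<integral>\<^sup>+x. F (c *\<^sub>R x) \<partial>lborel)"
    using assms(2) by (simp add: nn_integral_density nn_integral_distr nn_integral_cmult)
  finally show ?thesis
    using assms(2) by (simp add: mult.assoc[symmetric] ennreal_mult[symmetric])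
qed

lemma integral_lborel_scale:
  fixes F :: "'a::euclidean_space \<Rightarrow> real"
  assumes [measurable]: "F \<in> borel_measurable borel" and "c > 0"
  shows "(\<integral>x. F (c *\<^sub>R x) \<partial>lborel) = (\<integral>x. F x \<partial>lborel) / c ^ DIM('a)"
proof -
  have "(\<integral>x. F x \<partial>lborel) = (\<integral>x. F x \<partial>density (distr lborel borel (\<lambda>x::'a. 0 + c *\<^sub>R x)) (\<lambda>_. ennreal (\<bar>c\<bar>^DIM('a))))"
    using assms(2) by (subst lborel_affine[of c "0::'a", symmetric]) auto
  also have "\<dots> = c^DIM('a) * (\<integral>x. F (c *\<^sub>R x) \<partial>lborel)"
    using assms(2) by (subst integral_density) (auto simp: integral_distr)
  finally show ?thesis using assms(2) by simp
qed

lemma integrable_lborel_scale: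
  fixes F :: "'a::euclidean_space \<Rightarrow> real"
  assumes [measurable]: "integrable lborel F" and "c > 0"
  shows "integrable lborel (\<lambda>x. F (c *\<^sub>R x))"
proof -
  have [measurable]: "F \<in> borel_measurable borel" using assms(1) by auto
  have "integrable (density (distr lborel borel (\<lambda>x::'a. 0 + c *\<^sub>R x)) (\<lambda>_. ennreal (\<bar>c\<bar>^DIM('a)))) F"
    using assms by (subst lborel_affine[of c "0::'a", symmetric]) auto
  then show ?thesis using assms(2) by (simp add: integrable_density integrable_distr_eq)
qed

section \<open>Axial coordinates on R^3\<close>

definition vec3 :: "real \<times> real \<times> real \<Rightarrow> real^3" where
  "vec3 w = vector [fst w, fst (snd w), snd (snd w)]"

lemma vec3_nth [simp]: "vec3 w $ 1 = fst w" "vec3 w $ 2 = fst (snd w)" "vec3 w $ 3 = snd (snd w)"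
  by (simp_all add: vec3_def)

lemma vec3_measurable [measurable]: "vec3 \<in> borel_measurable borel"
proof -
  have "linear vec3"
    by (rule linearI) (auto simp: vec_eq_iff forall_3)
  then show ?thesis
    by (intro borel_measurable_continuous_onI linear_continuous_on) (simp add: linear_linear)
qed

lemma distr_vec3: "distr lborel borel vec3 = lborel"
proof (rule lborel_eqI[symmetric])
  fix l u :: "real^3" assume le: "\<And>b. b \<in> Basis \<Longrightarrow> l \<bullet> b \<le> u \<bullet> b"
  have le': "l $ i \<le> u $ i" for i using le[of "axis i 1"] by (auto simp: Basis_vec_def inner_axis)
  have eq: "vec3 -` box l u = box (l$1) (u$1) \<times> (box (l$2) (u$2) \<times> box (l$3) (u$3))"
    by (auto simp: mem_box_cart forall_3)
  have "emeasure (distr lborel borel vec3) (box l u)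
    = emeasure (lborel \<Otimes>\<^sub>M (lborel \<Otimes>\<^sub>M lborel)) (box (l$1) (u$1) \<times> (box (l$2) (u$2) \<times> box (l$3) (u$3)))"
    by (simp add: emeasure_distr eq lborel_prod)
  also have "\<dots> = ennreal (u$1 - l$1) * (ennreal (u$2 - l$2) * ennreal (u$3 - l$3))"
    using le' by (subst lborel_prod, subst lborel.emeasure_pair_measure_Times)
       (auto simp: lborel.emeasure_pair_measure_Times lborel_prod[symmetric])
  also have "\<dots> = ennreal (\<Prod>b\<in>Basis. (u - l) \<bullet> b)"
  proof -
    have "(\<Prod>b\<in>Basis. (u - l) \<bullet> b) = (\<Prod>i\<in>UNIV. (u - l) $ i)"
      unfolding Basis_vec_def
      by (simp add: prod.UNION_disjoint axis_eq_axis inner_axis)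
    also have "\<dots> = (u$1 - l$1) * ((u$2 - l$2) * (u$3 - l$3))"
      unfolding UNIV_3 by simp
    finally show ?thesis using le'[of 1] le'[of 2] le'[of 3]
      by (simp only: ennreal_mult[symmetric] diff_ge_0_iff_ge mult_nonneg_nonneg)
  qed
  finally show "emeasure (distr lborel borel vec3) (box l u) = ennreal (\<Prod>b\<in>Basis. (u - l) \<bullet> b)" .
qed simp

lemma nn_integral_vec3:
  assumes [measurable]: "F \<in> borel_measurable borel"
  shows "(\<integral>\<^sup>+y. F y \<partial>lborel) = (\<integral>\<^sup>+u. (\<integral>\<^sup>+z. F (vec3 (u, z)) \<partial>lborel) \<partial>lborel)"
proof -
  have "(\<integral>\<^sup>+y. F y \<partial>lborel) = (\<integral>\<^sup>+y. F y \<partial>distr lborel borel vec3)" by (simp add: distr_vec3)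
  also have "\<dots> = (\<integral>\<^sup>+w. F (vec3 w) \<partial>lborel)" by (intro nn_integral_distr) auto
  also have "\<dots> = (\<integral>\<^sup>+w. F (vec3 w) \<partial>(lborel \<Otimes>\<^sub>M lborel))" by (simp add: lborel_prod)
  also have "\<dots> = (\<integral>\<^sup>+u. (\<integral>\<^sup>+z. F (vec3 (u, z)) \<partial>lborel) \<partial>lborel)"
    by (intro lborel.nn_integral_fst[symmetric]) (simp add: lborel_prod)
  finally show ?thesis .
qed

text \<open>A disc of squared radius a has area pi * a, linear in a, so the squared radius of a
  plane point is distributed with constant density pi on the half-line. Half-lines generate the
  Borel sets and give finite mass.\<close>

lemma distr_norm_sq_plane:
  "distr lborel borel (\<lambda>z::real \<times> real. (norm z)\<^sup>2) = density lborel (\<lambda>t. ennreal pi * indicator {0..} t)"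
  (is "?M = ?N")
proof (rule measure_eqI_generator_eq)
  let ?E = "range (\<lambda>a::real. {..a})"
  show "Int_stable ?E" by (auto simp: Int_stable_def)
  show "?E \<subseteq> Pow UNIV" "sets ?M = sigma_sets UNIV ?E" "sets ?N = sigma_sets UNIV ?E"
    by (auto simp: borel_eq_atMost)
  show "range (\<lambda>i::nat. {..real i}) \<subseteq> ?E" "(\<Union>i::nat. {..real i}) = UNIV"
    by (auto intro: real_arch_simple)
  have M: "emeasure ?M {..a} = ennreal (pi * max 0 a)" for a
  proof (cases "a \<ge> 0")
    case True
    have eq: "(\<lambda>z::real\<times>real. (norm z)\<^sup>2) -` {..a} = cball 0 (sqrt a)"
      using True by (auto simp: real_le_rsqrt real_le_lsqrt sqrt_ge_absD)
    show ?thesis using True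
      by (simp add: emeasure_distr eq emeasure_cball unit_ball_vol_2)
  next
    case False
    have eq: "(\<lambda>z::real\<times>real. (norm z)\<^sup>2) -` {..a} = {}"
      using False by auto (meson dual_order.trans zero_le_power2)
    show ?thesis using False by (simp add: emeasure_distr eq)
  qed
  have N: "emeasure ?N {..a} = ennreal (pi * max 0 a)" for a
  proof -
    have "emeasure ?N {..a} = (\<integral>\<^sup>+t. ennreal pi * indicator {0..a} t \<partial>lborel)"
      by (simp add: emeasure_density) (intro nn_integral_cong, auto split: split_indicator)
    also have "\<dots> = ennreal pi * emeasure lborel {0..a}" by (simp add: nn_integral_cmult_indicator)
    also have "\<dots> = ennreal (pi * max 0 a)" by (auto simp: ennreal_mult max_def)
    finally show ?thesis .
  qed
  show "emeasure ?M X = emeasure ?N X" if "X \<in> ?E" for X using that by (auto simp: M N simp del: emeasure_density)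
  show "emeasure ?M {..real i} \<noteq> \<infinity>" for i by (simp add: M)
qed

lemma borel_fst_snd_compose [measurable (raw)]:
  fixes f :: "'c \<Rightarrow> 'a::second_countable_topology \<times> 'b::second_countable_topology"
  assumes "f \<in> borel_measurable M"
  shows "(\<lambda>x. fst (f x)) \<in> borel_measurable M" "(\<lambda>x. snd (f x)) \<in> borel_measurable M"
  using assms by (auto simp: borel_prod[symmetric])

text \<open>These coordinates replace spherical ones: u is the first coordinate and v the squared
  norm. For fixed u, v - u^2 is the squared radius in the orthogonal plane, so the measure is pi du
  dv on the region u^2 <= v, with constant Jacobian.\<close>

lemma nn_integral_axial:
  assumes [measurable]: "G \<in> borel_measurable (borel :: (real \<times> real) measure)"
  shows "(\<integral>\<^sup>+y. G (y $ 1, (norm y)\<^sup>2) \<partial>leb3)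
    = (\<integral>\<^sup>+v. ennreal pi * (\<integral>\<^sup>+u. G (u, v) * indicator {u. u\<^sup>2 \<le> v} u \<partial>lborel) \<partial>(lborel::real measure))"
proof -
  have [measurable]: "(\<lambda>y::real^3. y $ 1) \<in> borel_measurable borel"
    using borel_measurable_inner[of "\<lambda>y. y" borel "\<lambda>_. axis 1 1 :: real^3"] by (simp add: inner_axis)
  have nm: "(norm (vec3 (u, z)))\<^sup>2 = u\<^sup>2 + (norm z)\<^sup>2" for u z
    by (cases z) (simp only: power2_norm_eq_inner, simp add: inner_vec_def sum_3 power2_eq_square)
  have m1: "(\<lambda>y::real^3. G (y $ 1, (norm y)\<^sup>2)) \<in> borel_measurable borel"
    by measurable
  have m2: "(\<lambda>t. G (u, u\<^sup>2 + t)) \<in> borel_measurable borel" for u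
    by measurable
  have "(\<integral>\<^sup>+y. G (y $ 1, (norm y)\<^sup>2) \<partial>leb3)
     = (\<integral>\<^sup>+u. (\<integral>\<^sup>+z. G (u, u\<^sup>2 + (norm z)\<^sup>2) \<partial>(lborel :: (real\<times>real) measure)) \<partial>lborel)"
    by (subst nn_integral_vec3[OF m1]) (auto simp: nm)
  also have "\<dots> = (\<integral>\<^sup>+u. (\<integral>\<^sup>+t. G (u, u\<^sup>2 + t) \<partial>distr lborel borel (\<lambda>z::real \<times> real. (norm z)\<^sup>2)) \<partial>lborel)"
    by (intro nn_integral_cong, rule nn_integral_distr[symmetric]) (auto simp: m2)
  also have "\<dots> = (\<integral>\<^sup>+u. (\<integral>\<^sup>+t. ennreal pi * indicator {0..} t * G (u, u\<^sup>2 + t) \<partial>lborel) \<partial>lborel)"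
    unfolding distr_norm_sq_plane by (intro nn_integral_cong, rule nn_integral_density) (auto simp: m2)
  also have "\<dots> = (\<integral>\<^sup>+u. (\<integral>\<^sup>+v. ennreal pi * indicator {0..} (v - u\<^sup>2) * G (u, v) \<partial>lborel) \<partial>lborel)"
  proof (rule nn_integral_cong)
    fix u :: real
    have "(\<lambda>v. ennreal pi * indicator {0..} (v - u\<^sup>2) * G (u, v)) \<in> borel_measurable borel"
      by measurable
    from leb_preserving_nn_integral[OF leb_preserving_plus[of "u\<^sup>2"] this]
    show "(\<integral>\<^sup>+t. ennreal pi * indicator {0..} t * G (u, u\<^sup>2 + t) \<partial>lborel)
        = (\<integral>\<^sup>+v. ennreal pi * indicator {0..} (v - u\<^sup>2) * G (u, v) \<partial>lborel)"
      by simp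
  qed
  also have "\<dots> = (\<integral>\<^sup>+v. (\<integral>\<^sup>+u. ennreal pi * indicator {0..} (v - u\<^sup>2) * G (u, v) \<partial>lborel) \<partial>lborel)"
  proof (rule lborel_pair.Fubini'[symmetric])
    show "(\<lambda>(u, v). ennreal pi * indicator {0..} (v - u\<^sup>2) * G (u, v)) \<in> borel_measurable (lborel \<Otimes>\<^sub>M lborel)"
      by (simp add: lborel_prod split_beta') measurable
  qed
  also have "\<dots> = (\<integral>\<^sup>+v. ennreal pi * (\<integral>\<^sup>+u. G (u, v) * indicator {u. u\<^sup>2 \<le> v} u \<partial>lborel) \<partial>lborel)"
  proof (rule nn_integral_cong)
    fix v :: real
    have "(\<integral>\<^sup>+u. ennreal pi * indicator {0..} (v - u\<^sup>2) * G (u, v) \<partial>lborel)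
      = (\<integral>\<^sup>+u. ennreal pi * (G (u, v) * indicator {u. u\<^sup>2 \<le> v} u) \<partial>lborel)"
      by (intro nn_integral_cong) (auto split: split_indicator)
    also have "\<dots> = ennreal pi * (\<integral>\<^sup>+u. G (u, v) * indicator {u. u\<^sup>2 \<le> v} u \<partial>lborel)"
      by (rule nn_integral_cmult) measurable
    finally show "(\<integral>\<^sup>+u. ennreal pi * indicator {0..} (v - u\<^sup>2) * G (u, v) \<partial>lborel)
      = ennreal pi * (\<integral>\<^sup>+u. G (u, v) * indicator {u. u\<^sup>2 \<le> v} u \<partial>lborel)" .
  qed
  finally show ?thesis .
qed

section \<open>Radial integrals and Newton's theorem\<close>

lemma square_le_interval: "{u::real. u\<^sup>2 \<le> v} = (if v \<ge> 0 then {- sqrt v..sqrt v} else {})"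
proof (cases "v \<ge> 0")
  case True
  have "{u::real. u\<^sup>2 \<le> v} = {u. \<bar>u\<bar> \<le> sqrt v}"
    by (rule Collect_cong) (metis real_sqrt_abs real_sqrt_le_iff)
  moreover have "{u::real. \<bar>u\<bar> \<le> c} = {- c..c}" for c by auto
  ultimately show ?thesis using True by (simp only: if_True)
next
  case False
  have "\<not> u\<^sup>2 \<le> v" for u :: real using False zero_le_power2[of u] by linarith
  then show ?thesis using False by (simp only: if_False Collect_empty_eq) blast
qed

text \<open>The chord u^2 <= v has length 2 * sqrt v. Under v = r^2 the weight 2 * pi * sqrt v dv is
  the familiar 4 * pi * r^2 dr.\<close>

lemma nn_integral_radial:
  assumes [measurable]: "\<sigma> \<in> borel_measurable borel"
  shows "(\<integral>\<^sup>+y. \<sigma> (norm y) \<partial>leb3)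
    = (\<integral>\<^sup>+v. ennreal (2 * pi * sqrt v) * \<sigma> (sqrt v) * indicator {0..} v \<partial>lborel)"
proof -
  have m: "(\<lambda>w::real\<times>real. \<sigma> (sqrt (snd w))) \<in> borel_measurable borel" by measurable
  have "(\<integral>\<^sup>+y. \<sigma> (norm y) \<partial>leb3)
    = (\<integral>\<^sup>+y. (\<lambda>w. \<sigma> (sqrt (snd w))) (y $ 1, (norm y)\<^sup>2) \<partial>leb3)"
    by simp
  also have "\<dots> = (\<integral>\<^sup>+v. ennreal pi * (\<integral>\<^sup>+u. \<sigma> (sqrt v) * indicator {u. u\<^sup>2 \<le> v} u \<partial>lborel) \<partial>(lborel::real measure))"
    using m by (subst nn_integral_axial) auto
  also have "\<dots> = (\<integral>\<^sup>+v. ennreal (2 * pi * sqrt v) * \<sigma> (sqrt v) * indicator {0..} v \<partial>lborel)"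
  proof (rule nn_integral_cong)
    fix v :: real
    have "(\<integral>\<^sup>+u. \<sigma> (sqrt v) * indicator {u. u\<^sup>2 \<le> v} u \<partial>lborel)
      = \<sigma> (sqrt v) * emeasure lborel {u. u\<^sup>2 \<le> v}"
      by (rule nn_integral_cmult_indicator) measurable
    then show "ennreal pi * (\<integral>\<^sup>+u. \<sigma> (sqrt v) * indicator {u. u\<^sup>2 \<le> v} u \<partial>lborel)
       = ennreal (2 * pi * sqrt v) * \<sigma> (sqrt v) * indicator {0..} v"
      unfolding square_le_interval by (auto simp: ennreal_mult mult_ac)
  qed
  finally show ?thesis .
qed

text \<open>The squared distance from a point with coordinates u, v to the axis point at a is v - 2
  * a * u + a^2. It is affine in u, so the reciprocal distance has an elementary primitive.
  Excluding v = a^2 keeps the sphere away from the axis point, where the integrand is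
  singular.\<close>

lemma newton_axis_integral:
  assumes "a > 0" "v \<ge> 0" "v \<noteq> a\<^sup>2"
  shows "(\<integral>\<^sup>+u. ennreal (1 / sqrt (v - 2 * a * u + a\<^sup>2)) * indicator {u. u\<^sup>2 \<le> v} u \<partial>lborel)
    = ennreal (2 * sqrt v * min (1 / a) (1 / sqrt v))"
proof -
  define F where "F u = - (1 / a) * sqrt (v - 2 * a * u + a\<^sup>2)" for u
  have I: "{u. u\<^sup>2 \<le> v} = {- sqrt v..sqrt v}"
    using assms by (simp add: square_le_interval)
  have pos: "v - 2 * a * u + a\<^sup>2 > 0" if "u \<in> {- sqrt v..sqrt v}" for u
  proof -
    have "a * u \<le> a * sqrt v" using that assms by (intro mult_left_mono) auto
    moreover have "(sqrt v - a)\<^sup>2 > 0" using assms by auto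
    moreover have "(sqrt v - a)\<^sup>2 = v - 2 * (a * sqrt v) + a\<^sup>2"
      using assms by (simp add: power2_diff)
    ultimately show ?thesis by linarith
  qed
  have "(\<integral>\<^sup>+u. ennreal (1 / sqrt (v - 2 * a * u + a\<^sup>2)) * indicator {- sqrt v..sqrt v} u \<partial>lborel)
    = ennreal (F (sqrt v) - F (- sqrt v))"
  proof (rule nn_integral_FTC_Icc)
    show "DERIV F u :> 1 / sqrt (v - 2 * a * u + a\<^sup>2)" if "u \<in> {- sqrt v..sqrt v}" for u
      unfolding F_def using pos[OF that] assms
      by (auto intro!: derivative_eq_intros simp: field_simps)
    show "0 \<le> 1 / sqrt (v - 2 * a * u + a\<^sup>2)" if "u \<in> {- sqrt v..sqrt v}" for u
      using pos[OF that] by simp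
  qed (use assms in auto)
  moreover have "F (sqrt v) = - (1 / a) * \<bar>sqrt v - a\<bar>" "F (- sqrt v) = - (1 / a) * (sqrt v + a)"
  proof -
    have "v - 2 * a * sqrt v + a\<^sup>2 = (sqrt v - a)\<^sup>2" "v - 2 * a * (- sqrt v) + a\<^sup>2 = (sqrt v + a)\<^sup>2"
      using assms by (simp_all add: power2_diff power2_sum)
    then show "F (sqrt v) = - (1 / a) * \<bar>sqrt v - a\<bar>" "F (- sqrt v) = - (1 / a) * (sqrt v + a)"
      unfolding F_def using assms by simp_all
  qed
  moreover have "- (1 / a) * \<bar>sqrt v - a\<bar> - - (1 / a) * (sqrt v + a) = 2 * sqrt v * min (1 / a) (1 / sqrt v)"
  proof (cases "sqrt v \<le> a")
    case True
    then show ?thesis using assms by (cases "v = 0") (auto simp: min_def field_simps)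
  next
    case False
    then show ?thesis using assms by (auto simp: min_def field_simps)
  qed
  ultimately show ?thesis unfolding I by metis
qed

lemma newton_axis:
  assumes [measurable]: "\<sigma> \<in> borel_measurable borel" and a: "a > 0"
  shows "(\<integral>\<^sup>+y. \<sigma> (norm y) * ennreal (1 / norm (a *\<^sub>R axis 1 1 - y)) \<partial>leb3)
    = (\<integral>\<^sup>+y. \<sigma> (norm y) * ennreal (min (1 / a) (1 / norm y)) \<partial>leb3)"
proof -
  define G where "G w = \<sigma> (sqrt (snd w)) * ennreal (1 / sqrt (snd w - 2 * a * fst w + a\<^sup>2))" for w :: "real \<times> real"
  have Gm: "G \<in> borel_measurable borel" unfolding G_def by measurable
  have nm: "norm (a *\<^sub>R axis 1 1 - y) = sqrt ((norm y)\<^sup>2 - 2 * a * y $ 1 + a\<^sup>2)" for y :: "real^3"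
    unfolding norm_eq_sqrt_inner[of "a *\<^sub>R axis 1 1 - y"] power2_norm_eq_inner
    by (simp add: inner_diff_left inner_diff_right inner_axis inner_commute[of "axis 1 1"] inner_axis_axis power2_eq_square algebra_simps)
  have "(\<integral>\<^sup>+y. \<sigma> (norm y) * ennreal (1 / norm (a *\<^sub>R axis 1 1 - y)) \<partial>leb3)
    = (\<integral>\<^sup>+y. G (y $ 1, (norm y)\<^sup>2) \<partial>leb3)"
    by (simp add: G_def nm)
  also have "\<dots> = (\<integral>\<^sup>+v. ennreal pi * (\<integral>\<^sup>+u. G (u, v) * indicator {u. u\<^sup>2 \<le> v} u \<partial>lborel) \<partial>(lborel::real measure))"
    by (rule nn_integral_axial[OF Gm])
  also have "\<dots> = (\<integral>\<^sup>+v. ennreal (2 * pi * sqrt v) * (\<sigma> (sqrt v) * ennreal (min (1 / a) (1 / sqrt v))) * indicator {0..} v \<partial>lborel)"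
  proof (rule nn_integral_cong_AE)
    have "AE v in lborel. v \<noteq> a\<^sup>2" by (rule AE_lborel_singleton)
    then show "AE v in lborel. ennreal pi * (\<integral>\<^sup>+u. G (u, v) * indicator {u. u\<^sup>2 \<le> v} u \<partial>lborel)
      = ennreal (2 * pi * sqrt v) * (\<sigma> (sqrt v) * ennreal (min (1 / a) (1 / sqrt v))) * indicator {0..} v"
    proof eventually_elim
      case (elim v)
      show ?case
      proof (cases "v \<ge> 0")
        case True
        have "(\<integral>\<^sup>+u. G (u, v) * indicator {u. u\<^sup>2 \<le> v} u \<partial>lborel)
          = (\<integral>\<^sup>+u. \<sigma> (sqrt v) * (ennreal (1 / sqrt (v - 2 * a * u + a\<^sup>2)) * indicator {u. u\<^sup>2 \<le> v} u) \<partial>lborel)"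
          by (simp add: G_def mult.assoc)
        also have "\<dots> = \<sigma> (sqrt v) * ennreal (2 * sqrt v * min (1 / a) (1 / sqrt v))"
          unfolding newton_axis_integral[OF a True elim, symmetric] by (rule nn_integral_cmult) measurable
        finally show ?thesis using True a by (simp add: ennreal_mult mult_ac)
      next
        case False
        then show ?thesis unfolding square_le_interval by simp
      qed
    qed
  qed
  also have "\<dots> = (\<integral>\<^sup>+y. \<sigma> (norm y) * ennreal (min (1 / a) (1 / norm y)) \<partial>leb3)"
    by (rule nn_integral_radial[symmetric]) measurable
  finally show ?thesis .
qed

text \<open>A rotation moves x to the first axis; it fixes Lebesgue measure and all norms, so
  \<open>newton_axis\<close> applies.\<close>

lemma newton_shell:
  fixes x :: "real^3"
  assumes [measurable]: "\<sigma> \<in> borel_measurable borel" and x: "x \<noteq> 0"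
  shows "(\<integral>\<^sup>+y. \<sigma> (norm y) * ennreal (1 / norm (x - y)) \<partial>lborel)
    = (\<integral>\<^sup>+y. \<sigma> (norm y) * ennreal (min (1 / norm x) (1 / norm y)) \<partial>leb3)"
proof -
  obtain f :: "real^3 \<Rightarrow> real^3" where f: "orthogonal_transformation f" "f (norm x *\<^sub>R axis 1 1) = x"
    using orthogonal_transformation_exists[of "norm x *\<^sub>R axis 1 1" x] by auto
  have lin: "linear f" using f orthogonal_transformation_linear by blast
  have "(\<integral>\<^sup>+y. \<sigma> (norm y) * ennreal (1 / norm (x - y)) \<partial>lborel)
    = (\<integral>\<^sup>+y. \<sigma> (norm (f y)) * ennreal (1 / norm (x - f y)) \<partial>lborel)"
    by (rule leb_preserving_nn_integral[OF leb_preserving_orthogonal[OF f(1)], symmetric]) measurable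
  also have "\<dots> = (\<integral>\<^sup>+y. \<sigma> (norm y) * ennreal (1 / norm (norm x *\<^sub>R axis 1 1 - y)) \<partial>leb3)"
  proof (rule nn_integral_cong)
    fix y
    have "x - f y = f (norm x *\<^sub>R axis 1 1 - y)" using f(2) lin by (simp add: linear_diff)
    then show "\<sigma> (norm (f y)) * ennreal (1 / norm (x - f y)) = \<sigma> (norm y) * ennreal (1 / norm (norm x *\<^sub>R axis 1 1 - y))"
      using f(1) by (simp add: orthogonal_transformation_norm)
  qed
  also have "\<dots> = (\<integral>\<^sup>+y. \<sigma> (norm y) * ennreal (min (1 / norm x) (1 / norm y)) \<partial>leb3)"
    using x by (intro newton_axis) auto
  finally show ?thesis .
qed

section \<open>Optimal velocity profiles\<close>

lemma powr_gt_tangent: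
  fixes p s t :: real
  assumes "p > 1" "t > 0" "s \<ge> 0" "s \<noteq> t"
  shows "t powr p + p * t powr (p - 1) * (s - t) < s powr p"
proof (cases "s = 0")
  case True
  have "t powr (p - 1) * t = t powr p" using assms powr_mult_base[of t "p - 1"] by (simp add: mult.commute)
  then have "t powr p + p * t powr (p - 1) * (s - t) = (1 - p) * t powr p"
    using True by (simp add: algebra_simps)
  also have "\<dots> < 0" using assms by (simp add: mult_neg_pos)
  finally show ?thesis using True by simp
next
  case False
  then have s: "s > 0" using assms by simp
  have D: "DERIV (\<lambda>x. x powr p) x :> p * x powr (p - 1)" if "x > 0" for x
    using that by (auto intro!: derivative_eq_intros)
  consider "s < t" | "t < s" using assms by linarith
  then show ?thesis
  proof cases
    case 1
    obtain z where z: "s < z" "z < t" "t powr p - s powr p = (t - s) * (p * z powr (p - 1))"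
      using MVT2[OF 1, of "\<lambda>x. x powr p" "\<lambda>x. p * x powr (p - 1)"] D s by (metis less_le_trans)
    have "z powr (p - 1) < t powr (p - 1)" using z s assms by (intro powr_less_mono2) auto
    then have "(t - s) * (p * z powr (p - 1)) < (t - s) * (p * t powr (p - 1))"
      using 1 assms by (intro mult_strict_left_mono) auto
    then show ?thesis using z by (simp add: algebra_simps)
  next
    case 2
    obtain z where z: "t < z" "z < s" "s powr p - t powr p = (s - t) * (p * z powr (p - 1))"
      using MVT2[OF 2, of "\<lambda>x. x powr p" "\<lambda>x. p * x powr (p - 1)"] D assms by (metis less_le_trans)
    have "t powr (p - 1) < z powr (p - 1)" using z assms by (intro powr_less_mono2) auto
    then have "(s - t) * (p * t powr (p - 1)) < (s - t) * (p * z powr (p - 1))"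
      using 2 assms by (intro mult_strict_left_mono) auto
    then show ?thesis using z by (simp add: algebra_simps)
  qed
qed

lemma powr_ge_tangent:
  fixes p s t :: real
  assumes "p > 1" "t \<ge> 0" "s \<ge> 0"
  shows "t powr p + p * t powr (p - 1) * (s - t) \<le> s powr p"
  using powr_gt_tangent[of p t s] assms by (cases "t = 0"; cases "s = t") auto

lemma AE_eq_of_nn_integral_eq:
  fixes A B :: "'a \<Rightarrow> real"
  assumes [measurable]: "A \<in> borel_measurable M" "B \<in> borel_measurable M"
    and le: "\<And>z. 0 \<le> B z" "\<And>z. B z \<le> A z"
    and eq: "(\<integral>\<^sup>+z. ennreal (A z) \<partial>M) = (\<integral>\<^sup>+z. ennreal (B z) \<partial>M)"
    and fin: "(\<integral>\<^sup>+z. ennreal (A z) \<partial>M) < \<infinity>"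
  shows "AE z in M. A z = B z"
proof -
  have A0: "0 \<le> A z" for z using le[of z] by linarith
  have iA: "integrable M A" using fin A0 by (intro integrableI_nonneg) auto
  have iB: "integrable M B" using fin eq le by (intro integrableI_nonneg) auto
  have "ennreal (\<integral>z. A z \<partial>M) = ennreal (\<integral>z. B z \<partial>M)"
    using eq nn_integral_eq_integral[OF iA] nn_integral_eq_integral[OF iB] A0 le by simp
  then have "(\<integral>z. A z \<partial>M) = (\<integral>z. B z \<partial>M)"
    using A0 le by (subst (asm) ennreal_inj) (auto intro!: integral_nonneg)
  then have "(\<integral>z. A z - B z \<partial>M) = 0" using iA iB by simp
  then have "AE z in M. A z - B z = 0"
    using iA iB le by (subst (asm) integral_nonneg_eq_0_iff_AE) auto
  then show ?thesis by simp
qed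

section \<open>Polytropic exponents and the optimal velocity distribution\<close>

locale polytrope =
  fixes k :: real
  assumes k_pos: "0 < k" and k_less: "k < 3/2"
begin

definition p :: real where "p = 1 + 1 / k"
text \<open>The polytropic index; the added 3/2 is half the velocity dimension. The bound k < 3/2 is
  n < 3, equivalently q > 4/3.\<close>

definition n :: real where "n = k + 3/2"
definition q :: real where "q = 1 + 1 / n"

lemma p_gt_1: "p > 1" using k_pos by (simp add: p_def)
lemma n_gt: "n > 3/2" using k_pos by (simp add: n_def)
lemma n_less: "n < 3" using k_less by (simp add: n_def)
lemma q_gt: "q > 4/3" using n_gt n_less by (simp add: q_def field_simps)
lemma q_less: "q < 2" using n_gt by (simp add: q_def field_simps)

text \<open>The point where s^p - b * s is minimal over s >= 0. Stationarity reads p * s^(p - 1) =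
  b, and 1 / (p - 1) = k; for b <= 0 the minimum sits at s = 0.\<close>

definition cap :: "real \<Rightarrow> real" where "cap b = (max 0 b / p) powr k"

lemma cap_nonneg [simp]: "cap b \<ge> 0" by (simp add: cap_def)

lemma cap_measurable [measurable]: "cap \<in> borel_measurable borel"
  unfolding cap_def by measurable

lemma cap_mono: "a \<le> b \<Longrightarrow> cap a \<le> cap b"
  unfolding cap_def using p_gt_1 k_pos by (intro powr_mono2 divide_right_mono) auto

lemma cap_min_strict:
  assumes "s \<ge> 0" "s \<noteq> cap b"
  shows "cap b powr p - b * cap b < s powr p - b * s"
proof (cases "b > 0")
  case True
  have pos: "cap b > 0" using True p_gt_1 by (simp add: cap_def)
  have "cap b powr (p - 1) = b / p"
    using True p_gt_1 k_pos by (simp add: cap_def powr_powr p_def)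
  then have "p * cap b powr (p - 1) = b" using p_gt_1 by simp
  with powr_gt_tangent[OF p_gt_1 pos assms] show ?thesis by (simp add: algebra_simps)
next
  case False
  then have 0: "cap b = 0" using k_pos by (simp add: cap_def max_def)
  then have "s > 0" using assms by simp
  moreover have "b * s \<le> 0" using False \<open>s > 0\<close> by (simp add: mult_nonpos_nonneg)
  moreover have "s powr p > 0" using \<open>s > 0\<close> by simp
  ultimately have "0 < s powr p - b * s" by linarith
  then show ?thesis using 0 by simp
qed

lemma cap_min: "s \<ge> 0 \<Longrightarrow> cap b powr p - b * cap b \<le> s powr p - b * s"
  using cap_min_strict[of s b] by (cases "s = cap b") auto

lemma cap_scale: "l \<ge> 0 \<Longrightarrow> cap (l * b) = l powr k * cap b"
proof -
  assume l: "l \<ge> 0"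
  have "max 0 (l * b) = l * max 0 b" using l by (auto simp: max_def mult_le_0_iff zero_le_mult_iff)
  then have "max 0 (l * b) / p = l * (max 0 b / p)" by simp
  then show ?thesis unfolding cap_def using l p_gt_1 by (simp only: powr_mult)
qed

text \<open>The minimizer of \<open>edens s v - l * s\<close> over s >= 0 at each velocity v; l is
  the multiplier for a prescribed integral over velocities.\<close>

definition vprof :: "real \<Rightarrow> real^3 \<Rightarrow> real" where
  "vprof l v = cap (l - (norm v)\<^sup>2 / 2)"

definition edens :: "real \<Rightarrow> real^3 \<Rightarrow> real" where
  "edens s v = s powr p + 1/2 * (norm v)\<^sup>2 * s"

lemma edens_nonneg: "s \<ge> 0 \<Longrightarrow> edens s v \<ge> 0" by (simp add: edens_def)

lemma vprof_nonneg [simp]: "vprof l v \<ge> 0" by (simp add: vprof_def)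

lemma vprof_measurable [measurable]:
  assumes [measurable]: "f \<in> borel_measurable M" "g \<in> borel_measurable M"
  shows "(\<lambda>x. vprof (f x) (g x)) \<in> borel_measurable M"
  unfolding vprof_def by measurable

lemma edens_measurable [measurable]:
  assumes [measurable]: "f \<in> borel_measurable M" "g \<in> borel_measurable M"
  shows "(\<lambda>x. edens (f x) (g x)) \<in> borel_measurable M"
  unfolding edens_def by measurable

lemma edens_min:
  assumes "s \<ge> 0"
  shows "edens (vprof l v) v + l * s \<le> edens s v + l * vprof l v"
  using cap_min[OF assms, of "l - (norm v)\<^sup>2 / 2"] unfolding edens_def vprof_def
  by (simp add: algebra_simps)

lemma edens_min_strict:
  assumes "s \<ge> 0" "s \<noteq> vprof l v"
  shows "edens (vprof l v) v + l * s < edens s v + l * vprof l v"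
  using cap_min_strict[of s "l - (norm v)\<^sup>2 / 2"] assms unfolding edens_def vprof_def
  by (simp add: algebra_simps)

lemma vprof_scale: "l \<ge> 0 \<Longrightarrow> vprof l (sqrt l *\<^sub>R u) = l powr k * vprof 1 u"
  unfolding vprof_def by (subst cap_scale[symmetric]) (auto simp: power_mult_distrib algebra_simps)

lemma edens_scale: "l \<ge> 0 \<Longrightarrow> edens (vprof l (sqrt l *\<^sub>R u)) (sqrt l *\<^sub>R u) = l powr (k + 1) * edens (vprof 1 u) u"
proof -
  assume l: "l \<ge> 0"
  have "k * p = k + 1" using k_pos by (simp add: p_def algebra_simps)
  then have 1: "vprof l (sqrt l *\<^sub>R u) powr p = l powr (k + 1) * vprof 1 u powr p"
    using l by (simp add: vprof_scale powr_mult powr_powr)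
  have 2: "l powr (k + 1) = l * l powr k" using l k_pos powr_mult_base[of l k] by (simp add: add.commute)
  then have 3: "l powr (1 + k) = l * l powr k" by (simp add: add.commute)
  show ?thesis unfolding edens_def 1 using l
    by (simp add: vprof_scale 2 3 power_mult_distrib algebra_simps)
qed

text \<open>Mass and energy of the profile with multiplier 1. Both integrals are finite, since this
  profile is bounded and vanishes beyond speed 2, so \<open>enn2real\<close> loses nothing.\<close>

definition c1 :: real where "c1 = enn2real (\<integral>\<^sup>+v. ennreal (vprof 1 v) \<partial>lborel)"
definition c2 :: real where "c2 = enn2real (\<integral>\<^sup>+v. ennreal (edens (vprof 1 v) v) \<partial>lborel)"

lemma vprof1_zero: "norm v > 2 \<Longrightarrow> vprof 1 v = 0"
proof -
  assume "norm v > 2"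
  then have "(norm v)\<^sup>2 \<ge> 2 * 2" unfolding power2_eq_square by (intro mult_mono) auto
  then show ?thesis using k_pos unfolding vprof_def cap_def by (simp add: max_def)
qed

lemma vprof1_integrals:
  "(\<integral>\<^sup>+v. ennreal (vprof 1 v) \<partial>lborel) = ennreal c1"
  "(\<integral>\<^sup>+v. ennreal (edens (vprof 1 v) v) \<partial>lborel) = ennreal c2"
proof -
  have le1: "vprof 1 v \<le> cap 1" for v unfolding vprof_def by (intro cap_mono) auto
  have fin: "(\<integral>\<^sup>+v. ennreal (C * indicator (cball 0 2) v) \<partial>leb3) < \<infinity>" if "C \<ge> 0" for C :: real
  proof -
    have "(\<integral>\<^sup>+v. ennreal (C * indicator (cball 0 2) v) \<partial>leb3)
       = (\<integral>\<^sup>+v. ennreal C * indicator (cball 0 2) v \<partial>leb3)"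
      by (intro nn_integral_cong) (auto split: split_indicator)
    also have "\<dots> = ennreal C * emeasure lborel (cball (0::real^3) 2)"
      by (intro nn_integral_cmult_indicator) auto
    also have "\<dots> < \<infinity>" by (simp add: ennreal_mult_less_top emeasure_cball)
    finally show ?thesis .
  qed
  have "(\<integral>\<^sup>+v. ennreal (vprof 1 v) \<partial>lborel) \<le> (\<integral>\<^sup>+v. ennreal (cap 1 * indicator (cball 0 2) v) \<partial>leb3)"
    using le1 vprof1_zero by (intro nn_integral_mono ennreal_leI) (auto split: split_indicator)
  also have "\<dots> < \<infinity>" by (rule fin) simp
  finally show "(\<integral>\<^sup>+v. ennreal (vprof 1 v) \<partial>lborel) = ennreal c1" by (simp add: c1_def)
  have le2: "edens (vprof 1 v) v \<le> (cap 1 powr p + 2 * cap 1) * indicator (cball 0 2) v" for v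
  proof (cases "norm v \<le> 2")
    case True
    have "vprof 1 v powr p \<le> cap 1 powr p" using le1 p_gt_1 by (intro powr_mono2) auto
    moreover have "1/2 * (norm v)\<^sup>2 * vprof 1 v \<le> 1/2 * 2\<^sup>2 * cap 1"
      using True le1 by (intro mult_mono power_mono) auto
    ultimately show ?thesis using True unfolding edens_def by simp
  next
    case False
    then show ?thesis using vprof1_zero[of v] by (simp add: edens_def)
  qed
  have "(\<integral>\<^sup>+v. ennreal (edens (vprof 1 v) v) \<partial>lborel)
     \<le> (\<integral>\<^sup>+v. ennreal ((cap 1 powr p + 2 * cap 1) * indicator (cball 0 2) v) \<partial>leb3)"
    by (intro nn_integral_mono ennreal_leI le2)
  also have "\<dots> < \<infinity>" by (rule fin) simp
  finally show "(\<integral>\<^sup>+v. ennreal (edens (vprof 1 v) v) \<partial>lborel) = ennreal c2" by (simp add: c2_def)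
qed

lemma vprof1_pos: "norm v < 1 \<Longrightarrow> vprof 1 v > 0"
proof -
  assume "norm v < 1"
  then have "(norm v)\<^sup>2 \<le> 1" by (simp add: power_le_one)
  then show ?thesis using p_gt_1 unfolding vprof_def cap_def by (simp add: max_def)
qed

lemma nn_integral_pos_ball:
  fixes F :: "real^3 \<Rightarrow> real"
  assumes [measurable]: "F \<in> borel_measurable borel" and "\<And>v. norm v < 1 \<Longrightarrow> F v > 0"
    and eq: "(\<integral>\<^sup>+v. ennreal (F v) \<partial>lborel) = ennreal c"
  shows "c > 0"
proof (rule ccontr)
  assume "\<not> c > 0"
  then have "(\<integral>\<^sup>+v. ennreal (F v) \<partial>lborel) = 0" using eq by (simp add: ennreal_neg)
  then have "AE v in lborel. ennreal (F v) = 0" by (subst (asm) nn_integral_0_iff_AE) auto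
  then have "AE v in lborel. v \<notin> ball (0::real^3) 1"
  proof eventually_elim
    case (elim v)
    then show ?case using assms(2)[of v] by (auto simp: ennreal_eq_0_iff)
  qed
  then have "emeasure lborel (ball (0::real^3) 1) = 0"
    by (subst (asm) AE_iff_measurable[of "ball 0 1"]) auto
  then show False by (simp add: emeasure_ball unit_ball_vol_3)
qed

lemma c1_pos: "c1 > 0"
  using vprof1_integrals(1) by (rule nn_integral_pos_ball[rotated 2]) (auto simp: vprof1_pos)

lemma c2_pos: "c2 > 0"
proof (rule nn_integral_pos_ball[OF _ _ vprof1_integrals(2)])
  fix v :: "real^3" assume "norm v < 1"
  then have "vprof 1 v powr p > 0" using vprof1_pos[of v] by simp
  then show "0 < edens (vprof 1 v) v" unfolding edens_def
    by (intro add_pos_nonneg) auto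
qed measurable

lemma nn_integral_vscale:
  fixes F :: "real^3 \<Rightarrow> real"
  assumes [measurable]: "F \<in> borel_measurable borel" and l: "l > 0"
  shows "(\<integral>\<^sup>+v. ennreal (F v) \<partial>lborel) = ennreal (l powr (3/2)) * (\<integral>\<^sup>+u. ennreal (F (sqrt l *\<^sub>R u)) \<partial>lborel)"
proof -
  have "(sqrt l) ^ 3 = l powr (3/2)"
    using l by (simp add: powr_half_sqrt[symmetric] powr_powr powr_realpow[symmetric])
  then have "(\<integral>\<^sup>+u. ennreal (F (sqrt l *\<^sub>R u)) \<partial>lborel) = ennreal (1 / l powr (3/2)) * (\<integral>\<^sup>+v. ennreal (F v) \<partial>lborel)"
    using nn_integral_lborel_scale[of "\<lambda>v. ennreal (F v)" "sqrt l"] l by simp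
  then show ?thesis using l by (simp add: mult.assoc[symmetric] ennreal_mult[symmetric])
qed

text \<open>Substituting v = sqrt l * u gives l^k from the amplitude and l^(3/2) from the volume
  element. The energy density carries one further factor l, hence the exponent n + 1 in
  \<open>nn_integral_edens_vprof\<close>.\<close>

lemma nn_integral_vprof:
  assumes "l \<ge> 0"
  shows "(\<integral>\<^sup>+v. ennreal (vprof l v) \<partial>lborel) = ennreal (c1 * l powr n)"
proof (cases "l = 0")
  case True
  have "vprof 0 v = 0" for v using k_pos unfolding vprof_def cap_def by (simp add: max_def)
  then show ?thesis using True by simp
next
  case False
  then have l: "l > 0" using assms by simp
  have "(\<integral>\<^sup>+v. ennreal (vprof l v) \<partial>lborel)
    = ennreal (l powr (3/2)) * (\<integral>\<^sup>+u. ennreal (l powr k) * ennreal (vprof 1 u) \<partial>lborel)"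
    using l by (subst nn_integral_vscale[OF _ l]) (auto simp: vprof_scale ennreal_mult)
  also have "\<dots> = ennreal (l powr (3/2)) * (ennreal (l powr k) * ennreal c1)"
    by (subst nn_integral_cmult) (auto simp: vprof1_integrals)
  also have "\<dots> = ennreal (c1 * l powr n)"
    using l c1_pos by (simp add: ennreal_mult[symmetric] n_def powr_add mult_ac)
  finally show ?thesis .
qed

lemma nn_integral_edens_vprof:
  assumes "l \<ge> 0"
  shows "(\<integral>\<^sup>+v. ennreal (edens (vprof l v) v) \<partial>lborel) = ennreal (c2 * l powr (n + 1))"
proof (cases "l = 0")
  case True
  have "vprof 0 v = 0" for v using k_pos unfolding vprof_def cap_def by (simp add: max_def)
  then show ?thesis using True by (simp add: edens_def)
next
  case False
  then have l: "l > 0" using assms by simp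
  have "(\<integral>\<^sup>+v. ennreal (edens (vprof l v) v) \<partial>lborel)
    = ennreal (l powr (3/2)) * (\<integral>\<^sup>+u. ennreal (l powr (k + 1)) * ennreal (edens (vprof 1 u) u) \<partial>lborel)"
    using l by (subst nn_integral_vscale[OF _ l]) (auto simp: edens_scale ennreal_mult edens_nonneg)
  also have "\<dots> = ennreal (l powr (3/2)) * (ennreal (l powr (k + 1)) * ennreal c2)"
    by (subst nn_integral_cmult) (auto simp: vprof1_integrals)
  also have "\<dots> = ennreal (c2 * l powr (n + 1))"
  proof -
    have "l powr (n + 1) = l powr (3/2) * l powr (k + 1)"
      unfolding n_def powr_add[symmetric] by (simp add: algebra_simps)
    then show ?thesis using l c2_pos by (simp add: ennreal_mult[symmetric] mult_ac)
  qed
  finally show ?thesis .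
qed

text \<open>The multiplier for which the optimal profile has velocity integral r, from c1 * l^n = r.
  The minimal energy c2 * l^(n + 1) then becomes \<open>c3 * r powr q\<close>, because (n + 1) / n =
  q.\<close>

definition lam :: "real \<Rightarrow> real" where "lam r = (r / c1) powr (1 / n)"
definition c3 :: real where "c3 = c2 / c1 powr q"

lemma c3_pos: "c3 > 0" using c1_pos c2_pos by (simp add: c3_def)

lemma lam_nonneg [simp]: "lam r \<ge> 0" by (simp add: lam_def)

lemma lam_measurable [measurable]: "lam \<in> borel_measurable borel" unfolding lam_def by measurable

lemma lam_powr: "r \<ge> 0 \<Longrightarrow> c1 * lam r powr n = r"
  using c1_pos n_gt by (simp add: lam_def powr_powr)

lemma lam_powr': "r \<ge> 0 \<Longrightarrow> c2 * lam r powr (n + 1) = c3 * r powr q"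
proof -
  have "1 / n * (n + 1) = q" using n_gt by (simp add: q_def field_simps)
  then show "r \<ge> 0 \<Longrightarrow> ?thesis" using c1_pos by (simp add: lam_def powr_powr c3_def powr_divide)
qed

lemma lam_mult: "r \<ge> 0 \<Longrightarrow> lam r * r = c1 powr (- (1 / n)) * r powr q"
proof -
  assume r: "r \<ge> 0"
  have "r powr (1 / n) * r = r powr q" using r powr_mult_base[of r "1/n"] by (simp add: q_def mult.commute)
  then show ?thesis using r c1_pos by (simp add: lam_def powr_divide powr_minus field_simps)
qed

text \<open>Integrate the pointwise bound \<open>edens_min\<close> with the multiplier
  \<open>lam r\<close>. As g and the optimal profile have the same velocity integral r, the
  multiplier terms are the same finite number and cancel.\<close>

lemma kinetic_slice:
  fixes g :: "real^3 \<Rightarrow> real"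
  assumes [measurable]: "g \<in> borel_measurable borel" and g: "\<And>v. g v \<ge> 0"
    and r: "(\<integral>\<^sup>+v. ennreal (g v) \<partial>lborel) = ennreal r" "r \<ge> 0"
  shows "ennreal (c3 * r powr q) \<le> (\<integral>\<^sup>+v. ennreal (edens (g v) v) \<partial>lborel)"
proof -
  define l where "l = lam r"
  have l: "l \<ge> 0" by (simp add: l_def)
  have "ennreal (c3 * r powr q) + ennreal (l * r)
     = (\<integral>\<^sup>+v. ennreal (edens (vprof l v) v) \<partial>lborel) + (\<integral>\<^sup>+v. ennreal l * ennreal (g v) \<partial>lborel)"
    using r l by (simp add: nn_integral_cmult nn_integral_edens_vprof ennreal_mult lam_powr' l_def)
  also have "\<dots> = (\<integral>\<^sup>+v. ennreal (edens (vprof l v) v + l * g v) \<partial>lborel)"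
    using g l by (subst nn_integral_add[symmetric]) (auto simp: ennreal_mult edens_nonneg)
  also have "\<dots> \<le> (\<integral>\<^sup>+v. ennreal (edens (g v) v + l * vprof l v) \<partial>lborel)"
    by (intro nn_integral_mono ennreal_leI edens_min g)
  also have "\<dots> = (\<integral>\<^sup>+v. ennreal (edens (g v) v) \<partial>lborel) + (\<integral>\<^sup>+v. ennreal l * ennreal (vprof l v) \<partial>lborel)"
    using g l by (subst nn_integral_add[symmetric]) (auto simp: ennreal_mult edens_nonneg)
  also have "\<dots> = (\<integral>\<^sup>+v. ennreal (edens (g v) v) \<partial>lborel) + ennreal (l * r)"
    using r l by (simp add: nn_integral_cmult nn_integral_vprof ennreal_mult lam_powr l_def)
  finally show ?thesis by (simp add: ennreal_add_left_cancel_le add.commute[of _ "ennreal (l * r)"])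
qed

end

section \<open>Reduction from phase space to spatial densities\<close>

lemma nn_integral_phase:
  fixes F :: "('a::euclidean_space \<times> 'b::euclidean_space) \<Rightarrow> ennreal"
  assumes [measurable]: "F \<in> borel_measurable borel"
  shows "(\<integral>\<^sup>+z. F z \<partial>lborel) = (\<integral>\<^sup>+x. (\<integral>\<^sup>+v. F (x, v) \<partial>lborel) \<partial>lborel)"
proof -
  have "(\<integral>\<^sup>+z. F z \<partial>lborel) = (\<integral>\<^sup>+z. F z \<partial>(lborel \<Otimes>\<^sub>M lborel))" by (simp add: lborel_prod)
  also have "\<dots> = (\<integral>\<^sup>+x. (\<integral>\<^sup>+v. F (x, v) \<partial>lborel) \<partial>lborel)"
    by (intro lborel.nn_integral_fst[symmetric]) (simp add: lborel_prod)
  finally show ?thesis .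
qed

text \<open>The last claim holds only almost everywhere: at points where the velocity slice is not
  integrable, the Bochner integral in \<open>rho\<close> has the value 0.\<close>

lemma rho_facts:
  assumes f: "integrable lborel f" "\<And>z. 0 \<le> f z"
  shows "rho f \<in> borel_measurable borel" "\<And>x. 0 \<le> rho f x" "integrable lborel (rho f)"
    "(\<integral>x. rho f x \<partial>lborel) = (\<integral>z. f z \<partial>lborel)"
    "AE x in lborel. (\<integral>\<^sup>+v. ennreal (f (x, v)) \<partial>lborel) = ennreal (rho f x)"
proof -
  have i: "integrable (lborel \<Otimes>\<^sub>M lborel) f" using f by (simp add: lborel_prod)
  have r: "rho f = (\<lambda>x. \<integral>v. f (x, v) \<partial>lborel)" by (simp add: rho_def fun_eq_iff)
  show i1: "integrable lborel (rho f)" unfolding r by (rule lborel_pair.integrable_fst'[OF i])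
  then show "rho f \<in> borel_measurable borel" by auto
  show nn: "0 \<le> rho f x" for x unfolding r using f by (intro Bochner_Integration.integral_nonneg) auto
  show "(\<integral>x. rho f x \<partial>lborel) = (\<integral>z. f z \<partial>lborel)"
    unfolding r using lborel_pair.integral_fst'[OF i] by (simp add: lborel_prod)
  have "AE x in lborel. integrable lborel (\<lambda>v. f (x, v))"
    by (rule lborel_pair.AE_integrable_fst'[OF i])
  then show "AE x in lborel. (\<integral>\<^sup>+v. ennreal (f (x, v)) \<partial>lborel) = ennreal (rho f x)"
    by eventually_elim (use f in \<open>auto simp: r nn_integral_eq_integral\<close>)
qed

context polytrope
begin

definition dens :: "(real^3 \<Rightarrow> real) \<Rightarrow> bool" where
  "dens \<rho> \<longleftrightarrow> \<rho> \<in> borel_measurable borel \<and> (\<forall>x. 0 \<le> \<rho> x) \<and> integrable lborel \<rho>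
     \<and> integrable lborel (\<lambda>x. \<rho> x powr q)"

definition profile :: "(real^3 \<Rightarrow> real) \<Rightarrow> phase \<Rightarrow> real" where
  "profile \<rho> z = vprof (lam (\<rho> (fst z))) (snd z)"

lemma edens_Qk: "Qk k s + (1/2) * (norm v)\<^sup>2 * s = edens s v"
  by (simp add: Qk_def edens_def p_def)

text \<open>\<open>Pfun\<close> adds two Bochner integrals, each of which would silently be 0 if it
  diverged. Both integrands are nonnegative, so finiteness of the combined integral makes each
  converge and the sum genuine.\<close>

lemma Pfun_nn:
  assumes [measurable]: "f \<in> borel_measurable borel" and f: "\<And>z. 0 \<le> f z"
    and fin: "(\<integral>\<^sup>+z. ennreal (edens (f z) (snd z)) \<partial>lborel) < \<infinity>"
  shows "(\<integral>\<^sup>+z. ennreal (edens (f z) (snd z)) \<partial>lborel) = ennreal (Pfun k f)" "0 \<le> Pfun k f"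
proof -
  have i: "integrable lborel (\<lambda>z. edens (f z) (snd z))"
    using fin f by (intro integrableI_nonneg) (auto simp: edens_nonneg)
  have i1: "integrable lborel (\<lambda>z. Qk k (f z))"
    by (rule Bochner_Integration.integrable_bound[OF i])
       (use f in \<open>auto simp: edens_Qk[symmetric] Qk_def\<close>)
  have i2: "integrable lborel (\<lambda>z. (norm (snd z))\<^sup>2 * f z)"
  proof -
    have "integrable lborel (\<lambda>z. 2 * (edens (f z) (snd z) - Qk k (f z)))"
      using i i1 by auto
    then show ?thesis by (simp add: edens_Qk[symmetric])
  qed
  have eq: "Pfun k f = (\<integral>z. edens (f z) (snd z) \<partial>lborel)"
  proof -
    have "(\<integral>z. edens (f z) (snd z) \<partial>lborel) = (\<integral>z. Qk k (f z) + (1/2) * ((norm (snd z))\<^sup>2 * f z) \<partial>lborel)"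
      by (simp add: edens_Qk[symmetric] mult.assoc)
    also have "\<dots> = Pfun k f" unfolding Pfun_def Cas_def Ekin_def using i1 i2 by simp
    finally show ?thesis by simp
  qed
  show "(\<integral>\<^sup>+z. ennreal (edens (f z) (snd z)) \<partial>lborel) = ennreal (Pfun k f)"
    unfolding eq using i f by (intro nn_integral_eq_integral) (auto simp: edens_nonneg)
  show "0 \<le> Pfun k f" unfolding eq using f by (intro Bochner_Integration.integral_nonneg) (auto simp: edens_nonneg)
qed

lemma P_finite_edens: "P_finite k f \<longleftrightarrow> (\<integral>\<^sup>+z. ennreal (edens (f z) (snd z)) \<partial>lborel) < \<infinity>"
  unfolding P_finite_def edens_Qk ..

lemma FM_dens:
  assumes f: "f \<in> FM k M"
  shows "dens (rho f)" "(\<integral>x. rho f x \<partial>lborel) = M" "c3 * (\<integral>x. rho f x powr q \<partial>lborel) \<le> Pfun k f"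
proof -
  have fi: "integrable lborel f" and f0: "\<And>z. 0 \<le> f z" and fM: "(\<integral>z. f z \<partial>lborel) = M"
    and fP: "P_finite k f" using f by (auto simp: FM_def)
  have [measurable]: "f \<in> borel_measurable borel" using fi by auto
  note r = rho_facts[OF fi f0]
  have [measurable]: "rho f \<in> borel_measurable borel" by (rule r)
  note P = Pfun_nn[OF _ f0 fP[unfolded P_finite_edens]]
  have "(\<integral>\<^sup>+x. ennreal (c3 * rho f x powr q) \<partial>lborel)
     \<le> (\<integral>\<^sup>+x. (\<integral>\<^sup>+v. ennreal (edens (f (x, v)) v) \<partial>lborel) \<partial>lborel)"
  proof (rule nn_integral_mono_AE)
    show "AE x in lborel. ennreal (c3 * rho f x powr q) \<le> (\<integral>\<^sup>+v. ennreal (edens (f (x, v)) v) \<partial>lborel)"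
      using r(5)
    proof eventually_elim
      case (elim x)
      show ?case
        by (rule kinetic_slice[OF _ f0 elim]) (use r(2) in auto)
    qed
  qed
  also have "\<dots> = (\<integral>\<^sup>+z. ennreal (edens (f z) (snd z)) \<partial>lborel)"
    by (subst nn_integral_phase) auto
  also have "\<dots> = ennreal (Pfun k f)" by (rule P) measurable
  finally have le: "(\<integral>\<^sup>+x. ennreal (c3 * rho f x powr q) \<partial>lborel) \<le> ennreal (Pfun k f)" .
  have i: "integrable lborel (\<lambda>x. c3 * rho f x powr q)"
    using le c3_pos by (intro integrableI_nonneg) (auto intro: le_less_trans)
  then have i': "integrable lborel (\<lambda>x. rho f x powr q)" using c3_pos by simp
  show "dens (rho f)" unfolding dens_def using r i' by auto
  show "(\<integral>x. rho f x \<partial>lborel) = M" using r fM by simp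
  have "ennreal (c3 * (\<integral>x. rho f x powr q \<partial>lborel)) \<le> ennreal (Pfun k f)"
    using le nn_integral_eq_integral[OF i] c3_pos by simp
  then show "c3 * (\<integral>x. rho f x powr q \<partial>lborel) \<le> Pfun k f"
    using P(2) by (subst (asm) ennreal_le_iff) auto
qed

lemma profile_nonneg [simp]: "0 \<le> profile \<rho> z" by (simp add: profile_def)

lemma profile_measurable [measurable]:
  assumes [measurable]: "\<rho> \<in> borel_measurable borel"
  shows "profile \<rho> \<in> borel_measurable borel"
  unfolding profile_def by measurable

lemma profile_slice:
  assumes "\<rho> x \<ge> 0"
  shows "(\<integral>\<^sup>+v. ennreal (profile \<rho> (x, v)) \<partial>lborel) = ennreal (\<rho> x)"
    "(\<integral>\<^sup>+v. ennreal (edens (profile \<rho> (x, v)) v) \<partial>lborel) = ennreal (c3 * \<rho> x powr q)"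
  using assms by (simp_all add: profile_def nn_integral_vprof nn_integral_edens_vprof lam_powr lam_powr')

text \<open>The lower bound in \<open>FM_dens\<close> is attained for every admissible spatial
  density, so minimizing over f reduces to minimizing over rho.\<close>

lemma profile_FM:
  assumes d: "dens \<rho>" and M: "(\<integral>x. \<rho> x \<partial>lborel) = M"
  shows "profile \<rho> \<in> FM k M" "rho (profile \<rho>) = \<rho>" "Pfun k (profile \<rho>) = c3 * (\<integral>x. \<rho> x powr q \<partial>lborel)"
proof -
  have [measurable]: "\<rho> \<in> borel_measurable borel" and r0: "\<And>x. 0 \<le> \<rho> x"
    and i: "integrable lborel \<rho>" "integrable lborel (\<lambda>x. \<rho> x powr q)"
    using d by (auto simp: dens_def)
  have A: "(\<integral>\<^sup>+z. ennreal (profile \<rho> z) \<partial>lborel) = ennreal M"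
    using r0 nn_integral_eq_integral[OF i(1)] M
    by (subst nn_integral_phase) (auto simp: profile_slice)
  have B: "(\<integral>\<^sup>+z. ennreal (edens (profile \<rho> z) (snd z)) \<partial>lborel) = ennreal (c3 * (\<integral>x. \<rho> x powr q \<partial>lborel))"
    using r0 nn_integral_eq_integral[of lborel "\<lambda>x. c3 * \<rho> x powr q"] i c3_pos
    by (subst nn_integral_phase) (auto simp: profile_slice)
  have M0: "M \<ge> 0" using M r0 by (auto intro: Bochner_Integration.integral_nonneg)
  have "has_bochner_integral lborel (profile \<rho>) M"
    using A M0 by (intro has_bochner_integral_nn_integral) auto
  then have ii: "integrable lborel (profile \<rho>)" "(\<integral>z. profile \<rho> z \<partial>lborel) = M"
    by (auto simp: has_bochner_integral_iff)
  have fin: "(\<integral>\<^sup>+z. ennreal (edens (profile \<rho> z) (snd z)) \<partial>lborel) < \<infinity>" unfolding B by simp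
  show "profile \<rho> \<in> FM k M" unfolding FM_def P_finite_edens using ii fin by auto
  show "rho (profile \<rho>) = \<rho>"
  proof
    fix x
    have "has_bochner_integral lborel (\<lambda>v. profile \<rho> (x, v)) (\<rho> x)"
      using r0 by (intro has_bochner_integral_nn_integral) (auto simp: profile_slice)
    then show "rho (profile \<rho>) x = \<rho> x" by (simp add: rho_def has_bochner_integral_iff)
  qed
  show "Pfun k (profile \<rho>) = c3 * (\<integral>x. \<rho> x powr q \<partial>lborel)"
    using Pfun_nn[OF _ _ fin] B c3_pos r0 by (simp add: ennreal_inj)
qed

text \<open>\<open>A\<close> and \<open>B\<close> are the two sides of \<open>edens_min\<close> with
  f against the optimal profile g. Since f and g have the same spatial density, their multiplier
  terms both integrate to \<open>L\<close>, which is finite because \<open>lam r * r\<close> is a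
  multiple of r^q. The integrals of \<open>A\<close> and \<open>B\<close> then agree, whereas
  \<open>A\<close> exceeds \<open>B\<close> wherever f and g differ.\<close>

lemma FM_profile_unique:
  assumes f: "f \<in> FM k M" and eq: "Pfun k f = c3 * (\<integral>x. rho f x powr q \<partial>lborel)"
  shows "AE z in lborel. f z = profile (rho f) z"
proof -
  have fi: "integrable lborel f" and f0: "\<And>z. 0 \<le> f z" and fP: "P_finite k f"
    using f by (auto simp: FM_def)
  have [measurable]: "f \<in> borel_measurable borel" using fi by auto
  note r = rho_facts[OF fi f0]
  have [measurable]: "rho f \<in> borel_measurable borel" by (rule r)
  note D = FM_dens[OF f]
  note h = profile_FM[OF D(1,2)]
  define g where "g = profile (rho f)"
  have [measurable]: "g \<in> borel_measurable borel" unfolding g_def by measurable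
  define l where "l x = lam (rho f x)" for x
  have [measurable]: "l \<in> borel_measurable borel" unfolding l_def by measurable
  have l0: "l x \<ge> 0" for x by (simp add: l_def)
  have g0: "g z \<ge> 0" for z by (simp add: g_def)
  define A where "A z = edens (f z) (snd z) + l (fst z) * g z" for z
  define B where "B z = edens (g z) (snd z) + l (fst z) * f z" for z
  have [measurable]: "A \<in> borel_measurable borel" "B \<in> borel_measurable borel"
    unfolding A_def B_def by measurable
  have gP: "P_finite k g" using h(1) by (simp add: g_def FM_def)
  define L where "L = (\<integral>\<^sup>+x. ennreal (l x * rho f x) \<partial>lborel)"
  have "L < \<infinity>"
  proof -
    have i: "integrable lborel (\<lambda>x. c1 powr (- (1 / n)) * rho f x powr q)"
      using D(1) by (simp add: dens_def)
    show ?thesis unfolding L_def l_def using r(2) nn_integral_eq_integral[OF i] by (simp add: lam_mult)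
  qed
  have Lf: "(\<integral>\<^sup>+z. ennreal (l (fst z) * f z) \<partial>lborel) = L"
  proof -
    have "(\<integral>\<^sup>+z. ennreal (l (fst z) * f z) \<partial>lborel) = (\<integral>\<^sup>+x. (\<integral>\<^sup>+v. ennreal (l x) * ennreal (f (x, v)) \<partial>lborel) \<partial>lborel)"
      using f0 l0 by (subst nn_integral_phase) (auto simp: ennreal_mult)
    also have "\<dots> = (\<integral>\<^sup>+x. ennreal (l x) * (\<integral>\<^sup>+v. ennreal (f (x, v)) \<partial>lborel) \<partial>lborel)"
      by (intro nn_integral_cong nn_integral_cmult) measurable
    also have "\<dots> = L" unfolding L_def
    proof (rule nn_integral_cong_AE)
      show "AE x in lborel. ennreal (l x) * (\<integral>\<^sup>+v. ennreal (f (x, v)) \<partial>lborel) = ennreal (l x * rho f x)"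
        using r(5) by eventually_elim (use l0 r(2) in \<open>simp add: ennreal_mult\<close>)
    qed
    finally show ?thesis .
  qed
  have Lg: "(\<integral>\<^sup>+z. ennreal (l (fst z) * g z) \<partial>lborel) = L"
  proof -
    have "(\<integral>\<^sup>+z. ennreal (l (fst z) * g z) \<partial>lborel) = (\<integral>\<^sup>+x. (\<integral>\<^sup>+v. ennreal (l x) * ennreal (g (x, v)) \<partial>lborel) \<partial>lborel)"
      using g0 l0 by (subst nn_integral_phase) (auto simp: ennreal_mult)
    also have "\<dots> = (\<integral>\<^sup>+x. ennreal (l x) * (\<integral>\<^sup>+v. ennreal (g (x, v)) \<partial>lborel) \<partial>lborel)"
      by (intro nn_integral_cong nn_integral_cmult) measurable
    also have "\<dots> = L" unfolding L_def g_def using r(2) l0 by (simp add: profile_slice ennreal_mult)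
    finally show ?thesis .
  qed
  have IA: "(\<integral>\<^sup>+z. ennreal (A z) \<partial>lborel) = ennreal (Pfun k f) + L"
    unfolding A_def Lg[symmetric] using Pfun_nn(1)[OF _ f0 fP[unfolded P_finite_edens]] g0 f0 l0
    by (simp add: edens_nonneg nn_integral_add)
  have IB: "(\<integral>\<^sup>+z. ennreal (B z) \<partial>lborel) = ennreal (Pfun k g) + L"
    unfolding B_def Lf[symmetric] using Pfun_nn(1)[OF _ g0 gP[unfolded P_finite_edens]] g0 f0 l0
    by (simp add: edens_nonneg nn_integral_add)
  have gl: "g z = vprof (l (fst z)) (snd z)" for z by (simp add: g_def profile_def l_def)
  have "AE z in lborel. A z = B z"
  proof (rule AE_eq_of_nn_integral_eq)
    show "0 \<le> B z" for z unfolding B_def using g0 f0 l0 by (simp add: edens_nonneg)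
    show "B z \<le> A z" for z unfolding A_def B_def using edens_min[OF f0[of z]] by (simp add: gl)
    show "(\<integral>\<^sup>+z. ennreal (A z) \<partial>lborel) = (\<integral>\<^sup>+z. ennreal (B z) \<partial>lborel)"
      unfolding IA IB using eq h(3) by (simp add: g_def)
    show "(\<integral>\<^sup>+z. ennreal (A z) \<partial>lborel) < \<infinity>" unfolding IA using \<open>L < \<infinity>\<close> by simp
  qed measurable
  then show ?thesis
  proof eventually_elim
    case (elim z)
    then show ?case using edens_min_strict[OF f0[of z], of "l (fst z)" "snd z"]
      unfolding A_def B_def g_def[symmetric] gl by fastforce
  qed
qed

end

section \<open>The field energy as a Coulomb energy\<close>

lemma nn_integral_similarity:
  fixes F :: "real^3 \<Rightarrow> ennreal" and f :: "real^3 \<Rightarrow> real^3"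
  assumes [measurable]: "F \<in> borel_measurable borel" and f: "orthogonal_transformation f" and d: "d > 0"
  shows "(\<integral>\<^sup>+x. F x \<partial>lborel) = ennreal (d ^ 3) * (\<integral>\<^sup>+u. F (y + d *\<^sub>R f u) \<partial>lborel)"
proof -
  have "(\<integral>\<^sup>+u. F (y + d *\<^sub>R f u) \<partial>lborel) = (\<integral>\<^sup>+u. F (y + d *\<^sub>R u) \<partial>lborel)"
    by (rule leb_preserving_nn_integral[OF leb_preserving_orthogonal[OF f]]) measurable
  also have "\<dots> = ennreal (1 / d ^ 3) * (\<integral>\<^sup>+u. F (y + u) \<partial>lborel)"
    using nn_integral_lborel_scale[of "\<lambda>u. F (y + u)" d] d by simp
  also have "(\<integral>\<^sup>+u. F (y + u) \<partial>lborel) = (\<integral>\<^sup>+u. F u \<partial>lborel)"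
    by (rule leb_preserving_nn_integral[OF leb_preserving_plus]) measurable
  finally show ?thesis using d by (simp add: mult.assoc[symmetric] ennreal_mult[symmetric])
qed

lemma integral_similarity:
  fixes F :: "real^3 \<Rightarrow> real" and f :: "real^3 \<Rightarrow> real^3"
  assumes [measurable]: "F \<in> borel_measurable borel" and f: "orthogonal_transformation f" and d: "d > 0"
  shows "(\<integral>x. F x \<partial>lborel) = d ^ 3 * (\<integral>u. F (y + d *\<^sub>R f u) \<partial>lborel)"
proof -
  have "(\<integral>u. F (y + d *\<^sub>R f u) \<partial>lborel) = (\<integral>u. F (y + d *\<^sub>R u) \<partial>lborel)"
    by (rule leb_preserving_integral[OF leb_preserving_orthogonal[OF f]]) measurable
  also have "\<dots> = (\<integral>u. F (y + u) \<partial>lborel) / d ^ 3"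
    using integral_lborel_scale[of "\<lambda>u. F (y + u)" d] d by simp
  also have "(\<integral>u. F (y + u) \<partial>lborel) = (\<integral>u. F u \<partial>lborel)"
    by (rule leb_preserving_integral[OF leb_preserving_plus]) measurable
  finally show ?thesis using d by simp
qed

abbreviation e1 :: "real^3" where "e1 \<equiv> axis 1 1"

text \<open>Carries the pair 0, \<open>e1\<close> to the pair y, z, so that integrals over x with
  singularities at y and z depend on them only through powers of their distance.\<close>

lemma similarity_to_axis:
  fixes y z :: "real^3"
  assumes "y \<noteq> z"
  obtains f :: "real^3 \<Rightarrow> real^3" where "orthogonal_transformation f"
    "\<And>u. y + norm (y - z) *\<^sub>R f u - y = norm (y - z) *\<^sub>R f u"
    "\<And>u. y + norm (y - z) *\<^sub>R f u - z = norm (y - z) *\<^sub>R f (u - e1)"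
proof -
  obtain f :: "real^3 \<Rightarrow> real^3" where f: "orthogonal_transformation f" "f (norm (z - y) *\<^sub>R e1) = z - y"
    using orthogonal_transformation_exists[of "norm (z - y) *\<^sub>R e1" "z - y"] by auto
  have lin: "linear f" using f orthogonal_transformation_linear by blast
  have "norm (y - z) *\<^sub>R f e1 = z - y"
    using f(2) by (simp add: linear_scale[OF lin] norm_minus_commute)
  then have "y + norm (y - z) *\<^sub>R f u - z = norm (y - z) *\<^sub>R f (u - e1)" for u
    by (simp add: linear_diff[OF lin] scaleR_diff_right)
  then show ?thesis using that f(1) by simp
qed

text \<open>This radial function, placed at each of the two singular points, majorizes the kernel in
  \<open>Ckern\<close>. In v = r^2 its two branches become multiples of v^(-1/2) near 0 and of
  v^(-3/2) at infinity.\<close>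

lemma radial_integral_finite:
  "(\<integral>\<^sup>+y. ennreal (if norm y < 1/2 then 4 / (norm y)\<^sup>2 else 1 / (norm y)^4) \<partial>leb3) < \<infinity>"
proof -
  define \<sigma> :: "real \<Rightarrow> real" where "\<sigma> r = (if r < 1/2 then 4 / r\<^sup>2 else 1 / r^4)" for r
  have [measurable]: "\<sigma> \<in> borel_measurable borel" unfolding \<sigma>_def by measurable
  have "(\<integral>\<^sup>+y. ennreal (\<sigma> (norm y)) \<partial>leb3)
    = (\<integral>\<^sup>+v. ennreal (2 * pi * sqrt v) * ennreal (\<sigma> (sqrt v)) * indicator {0..} v \<partial>lborel)"
    by (rule nn_integral_radial) measurable
  also have "\<dots> \<le> (\<integral>\<^sup>+v. (ennreal (8 * pi * v powr (- (1/2))) * indicator {0..1/4} v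
      + ennreal (2 * pi * v powr (- (3/2))) * indicator {1/4..} v) \<partial>lborel)"
  proof (rule nn_integral_mono)
    fix v :: real
    have A: "2 * pi * sqrt v * (4 / (sqrt v)\<^sup>2) = 8 * pi * v powr (- (1/2))" if "v > 0"
    proof -
      have "v powr (- (1/2)) = 1 / sqrt v" using that by (simp only: powr_minus_divide powr_half_sqrt)
      moreover have "sqrt v * (4 / (sqrt v)\<^sup>2) = 4 * (1 / sqrt v)"
        using that by (simp add: power2_eq_square del: real_sqrt_mult_self)
      ultimately show ?thesis by (simp only: mult.assoc)
    qed
    have B: "2 * pi * sqrt v * (1 / (sqrt v)^4) = 2 * pi * v powr (- (3/2))" if "v > 0"
    proof -
      have "v powr (3/2) = v powr (1/2) * (v powr (1/2) * v powr (1/2))"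
      proof -
        have h: "(3/2::real) = 1/2 + (1/2 + 1/2)" by simp
        show ?thesis by (subst h) (simp only: powr_add)
      qed
      also have "\<dots> = (sqrt v) ^ 3" using that by (simp add: powr_half_sqrt power3_eq_cube)
      finally have "v powr (- (3/2)) = 1 / (sqrt v) ^ 3" by (simp only: powr_minus_divide)
      moreover have "sqrt v * (1 / (sqrt v)^4) = 1 / (sqrt v) ^ 3"
        using that by (simp add: power4_eq_xxxx power3_eq_cube del: real_sqrt_mult_self)
      ultimately show ?thesis by (simp only: mult.assoc)
    qed
    show "ennreal (2 * pi * sqrt v) * ennreal (\<sigma> (sqrt v)) * indicator {0..} v
      \<le> (ennreal (8 * pi * v powr (- (1/2))) * indicator {0..1/4} v
      + ennreal (2 * pi * v powr (- (3/2))) * indicator {1/4..} v)"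
    proof (cases "v > 0")
      case True
      have s: "sqrt v < 1/2 \<longleftrightarrow> v < 1/4"
      proof -
        have "sqrt (1/4) = 1/2" by (simp add: real_sqrt_divide)
        then show ?thesis by (metis real_sqrt_less_iff)
      qed
      show ?thesis
      proof (cases "v < 1/4")
        case True2: True
        then have "\<sigma> (sqrt v) = 4 / (sqrt v)\<^sup>2" using s by (simp add: \<sigma>_def)
        then show ?thesis using True True2 A[OF True] by (simp add: ennreal_mult[symmetric])
      next
        case False
        then have "\<sigma> (sqrt v) = 1 / (sqrt v)^4" using s by (simp add: \<sigma>_def)
        then show ?thesis using True False B[OF True] by (simp add: ennreal_mult[symmetric])
      qed
    next
      case False
      then show ?thesis by (cases "v = 0") auto
    qed
  qed
  also have "\<dots> = (\<integral>\<^sup>+v. ennreal (8 * pi * v powr (- (1/2))) * indicator {0..1/4} v \<partial>lborel)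
      + (\<integral>\<^sup>+v. ennreal (2 * pi * v powr (- (3/2))) * indicator {1/4..} v \<partial>lborel)"
    by (simp add: nn_integral_add)
  also have "\<dots> < \<infinity>"
  proof -
    have "((\<lambda>v. v powr (- (1/2))) has_integral ((1/4) powr (- (1/2) + 1) / (- (1/2) + 1))) {0..1/4::real}"
      by (rule has_integral_powr_from_0) auto
    then have "((\<lambda>v. 8 * pi * v powr (- (1/2))) has_integral (8 * pi * ((1/4) powr (- (1/2) + 1) / (- (1/2) + 1)))) {0..1/4::real}"
      by (rule has_integral_mult_right)
    from nn_integral_has_integral_lebesgue'[OF _ this]
    have a: "(\<integral>\<^sup>+v. ennreal (8 * pi * v powr (- (1/2))) * indicator {0..1/4} v \<partial>lborel) < \<infinity>"
      by simp
    have "((\<lambda>v. v powr (- (3/2))) has_integral (- ((1/4) powr (- (3/2) + 1)) / (- (3/2) + 1))) {1/4::real..}"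
      by (rule has_integral_powr_to_inf) auto
    then have "((\<lambda>v. 2 * pi * v powr (- (3/2))) has_integral (2 * pi * (- ((1/4) powr (- (3/2) + 1)) / (- (3/2) + 1)))) {1/4::real..}"
      by (rule has_integral_mult_right)
    from nn_integral_has_integral_lebesgue'[OF _ this] have
      "(\<integral>\<^sup>+v. ennreal (2 * pi * v powr (- (3/2))) * indicator {1/4..} v \<partial>lborel) < \<infinity>" by simp
    with a show ?thesis by simp
  qed
  finally show ?thesis unfolding \<sigma>_def by simp
qed

definition Ckern :: ennreal where
  "Ckern = (\<integral>\<^sup>+u. ennreal (1 / ((norm u)\<^sup>2 * (norm (u - e1))\<^sup>2)) \<partial>leb3)"

lemma Ckern_finite: "Ckern < \<infinity>"
proof -
  define \<sigma> :: "real^3 \<Rightarrow> real" where "\<sigma> y = (if norm y < 1/2 then 4 / (norm y)\<^sup>2 else 1 / (norm y)^4)" for y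
  have [measurable]: "\<sigma> \<in> borel_measurable borel" unfolding \<sigma>_def by measurable
  have s0: "\<sigma> y \<ge> 0" for y by (simp add: \<sigma>_def)
  have le: "1 / ((norm u)\<^sup>2 * (norm (u - e1))\<^sup>2) \<le> \<sigma> u + \<sigma> (u - e1)" for u :: "real^3"
  proof -
    define a b where "a = norm u" and "b = norm (u - e1)"
    have ab: "a \<ge> 0" "b \<ge> 0" by (auto simp: a_def b_def)
    \<comment> \<open>The singular points 0 and \<open>e1\<close> are at distance 1, so at most one
      of a and b is below 1/2. Near one point the other factor costs at most 4; away from both, 2 *
      X * Y <= X^2 + Y^2 separates the product.\<close>
    have tri: "a + b \<ge> 1"
      using norm_triangle_ineq4[of u "u - e1"] by (simp add: a_def b_def)
    have quarter: "1 / (c\<^sup>2 * d\<^sup>2) \<le> 4 / c\<^sup>2" if "c \<ge> 0" "d \<ge> 1/2" for c d :: real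
    proof -
      have "(1/2)\<^sup>2 \<le> d\<^sup>2" using that by (intro power_mono) auto
      then have "1 / d\<^sup>2 \<le> 4" using that by (simp add: field_simps power2_eq_square)
      then have "1 / c\<^sup>2 * (1 / d\<^sup>2) \<le> 1 / c\<^sup>2 * 4" by (intro mult_left_mono) auto
      then show ?thesis by simp
    qed
    have "1 / (a\<^sup>2 * b\<^sup>2) \<le> (if a < 1/2 then 4 / a\<^sup>2 else 1 / a^4) + (if b < 1/2 then 4 / b\<^sup>2 else 1 / b^4)"
    proof -
      consider "a < 1/2" | "b < 1/2" | "a \<ge> 1/2" "b \<ge> 1/2" by linarith
      then show ?thesis
      proof cases
        case 1
        then have "b \<ge> 1/2" using tri by linarith
        then show ?thesis using quarter[of a b] ab 1 by (simp add: add_increasing2)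
      next
        case 2
        then have "a \<ge> 1/2" using tri by linarith
        then show ?thesis using quarter[of b a] ab 2 by (simp add: add_increasing mult.commute)
      next
        case 3
        have "0 \<le> (1 / a\<^sup>2 - 1 / b\<^sup>2)\<^sup>2" by simp
        then have "2 * (1 / a\<^sup>2 * (1 / b\<^sup>2)) \<le> (1 / a\<^sup>2)\<^sup>2 + (1 / b\<^sup>2)\<^sup>2"
          by (simp add: power2_diff)
        moreover have "(1 / a\<^sup>2)\<^sup>2 = 1 / a^4" "(1 / b\<^sup>2)\<^sup>2 = 1 / b^4"
          by (simp_all add: power_divide flip: power_mult)
        moreover have "0 \<le> 1 / a^4" "0 \<le> 1 / b^4" by simp_all
        moreover have "1 / (a\<^sup>2 * b\<^sup>2) = 1 / a\<^sup>2 * (1 / b\<^sup>2)" by simp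
        ultimately have "1 / (a\<^sup>2 * b\<^sup>2) \<le> 1 / a^4 + 1 / b^4" by linarith
        then show ?thesis using 3 by simp
      qed
    qed
    then show ?thesis unfolding \<sigma>_def a_def b_def .
  qed
  have "Ckern \<le> (\<integral>\<^sup>+u. ennreal (\<sigma> u) + ennreal (\<sigma> (u - e1)) \<partial>lborel)"
    unfolding Ckern_def by (intro nn_integral_mono) (simp add: s0 ennreal_plus[symmetric] ennreal_leI le del: ennreal_plus)
  also have "\<dots> = (\<integral>\<^sup>+u. ennreal (\<sigma> u) \<partial>lborel) + (\<integral>\<^sup>+u. ennreal (\<sigma> (u - e1)) \<partial>lborel)"
    by (rule nn_integral_add) measurable
  also have "(\<integral>\<^sup>+u. ennreal (\<sigma> (u - e1)) \<partial>lborel) = (\<integral>\<^sup>+u. ennreal (\<sigma> u) \<partial>lborel)"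
    using leb_preserving_nn_integral[OF leb_preserving_plus[of "- e1"], of "\<lambda>u. ennreal (\<sigma> u)"] by simp
  also have "(\<integral>\<^sup>+u. ennreal (\<sigma> u) \<partial>lborel) + (\<integral>\<^sup>+u. ennreal (\<sigma> u) \<partial>lborel) < \<infinity>"
    using radial_integral_finite by (simp add: \<sigma>_def)
  finally show ?thesis .
qed

text \<open>The value of this constant is \<open>4 * pi\<close>; only its positivity is needed.\<close>

definition ckern :: real where
  "ckern = (\<integral>u. (u \<bullet> (u - e1)) / ((norm u) ^ 3 * (norm (u - e1)) ^ 3) \<partial>leb3)"

text \<open>With d the distance of y and z, the volume contributes d^3 and the kernel, homogeneous
  of degree -4, contributes d^(-4). The same count gives the signed version
  \<open>kernel_integral\<close>.\<close>

lemma kernel_abs_integral: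
  fixes y z :: "real^3"
  assumes "y \<noteq> z"
  shows "(\<integral>\<^sup>+x. ennreal (1 / ((norm (x - y))\<^sup>2 * (norm (x - z))\<^sup>2)) \<partial>lborel) = Ckern * ennreal (1 / norm (y - z))"
proof -
  define d where "d = norm (y - z)"
  have d: "d > 0" using assms by (simp add: d_def)
  obtain f where f: "orthogonal_transformation f"
    "\<And>u. y + d *\<^sub>R f u - y = d *\<^sub>R f u" "\<And>u. y + d *\<^sub>R f u - z = d *\<^sub>R f (u - e1)"
    using similarity_to_axis[OF assms] unfolding d_def by metis
  have "(\<integral>\<^sup>+x. ennreal (1 / ((norm (x - y))\<^sup>2 * (norm (x - z))\<^sup>2)) \<partial>lborel)
    = ennreal (d ^ 3) * (\<integral>\<^sup>+u. ennreal (1 / ((norm (y + d *\<^sub>R f u - y))\<^sup>2 * (norm (y + d *\<^sub>R f u - z))\<^sup>2)) \<partial>lborel)"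
    by (rule nn_integral_similarity[OF _ f(1) d]) measurable
  also have "\<dots> = ennreal (d ^ 3) * (\<integral>\<^sup>+u. ennreal (1 / d ^ 4) * ennreal (1 / ((norm u)\<^sup>2 * (norm (u - e1))\<^sup>2)) \<partial>lborel)"
  proof -
    have "1 / ((norm (y + d *\<^sub>R f u - y))\<^sup>2 * (norm (y + d *\<^sub>R f u - z))\<^sup>2)
      = 1 / d ^ 4 * (1 / ((norm u)\<^sup>2 * (norm (u - e1))\<^sup>2))" for u
      unfolding f(2,3) using d f(1)
      by (simp add: orthogonal_transformation_norm power_mult_distrib power4_eq_xxxx power2_eq_square mult_ac)
    then have "ennreal (1 / ((norm (y + d *\<^sub>R f u - y))\<^sup>2 * (norm (y + d *\<^sub>R f u - z))\<^sup>2))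
      = ennreal (1 / d ^ 4) * ennreal (1 / ((norm u)\<^sup>2 * (norm (u - e1))\<^sup>2))" for u
      by (simp only:) (rule ennreal_mult, auto)
    then show ?thesis by (simp only:)
  qed
  also have "\<dots> = ennreal (d ^ 3) * (ennreal (1 / d ^ 4) * Ckern)"
    unfolding Ckern_def by (subst nn_integral_cmult) auto
  also have "\<dots> = ennreal (d ^ 3 * (1 / d ^ 4)) * Ckern"
    using d by (subst ennreal_mult) (auto simp: mult.assoc)
  also have "d ^ 3 * (1 / d ^ 4) = 1 / d" using d by (simp add: power3_eq_cube power4_eq_xxxx)
  finally show ?thesis by (simp add: d_def mult.commute)
qed

lemma kernel_integral:
  fixes y z :: "real^3"
  assumes "y \<noteq> z"
  shows "(\<integral>x. ((x - y) \<bullet> (x - z)) / ((norm (x - y)) ^ 3 * (norm (x - z)) ^ 3) \<partial>lborel) = ckern / norm (y - z)"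
proof -
  define d where "d = norm (y - z)"
  have d: "d > 0" using assms by (simp add: d_def)
  obtain f where f: "orthogonal_transformation f"
    "\<And>u. y + d *\<^sub>R f u - y = d *\<^sub>R f u" "\<And>u. y + d *\<^sub>R f u - z = d *\<^sub>R f (u - e1)"
    using similarity_to_axis[OF assms] unfolding d_def by metis
  have "(\<integral>x. ((x - y) \<bullet> (x - z)) / ((norm (x - y)) ^ 3 * (norm (x - z)) ^ 3) \<partial>lborel)
    = d ^ 3 * (\<integral>u. ((y + d *\<^sub>R f u - y) \<bullet> (y + d *\<^sub>R f u - z)) / ((norm (y + d *\<^sub>R f u - y)) ^ 3 * (norm (y + d *\<^sub>R f u - z)) ^ 3) \<partial>lborel)"
    by (rule integral_similarity[OF _ f(1) d]) measurable
  also have "\<dots> = d ^ 3 * (\<integral>u. 1 / d ^ 4 * ((u \<bullet> (u - e1)) / ((norm u) ^ 3 * (norm (u - e1)) ^ 3)) \<partial>lborel)"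
  proof -
    have "((y + d *\<^sub>R f u - y) \<bullet> (y + d *\<^sub>R f u - z)) / ((norm (y + d *\<^sub>R f u - y)) ^ 3 * (norm (y + d *\<^sub>R f u - z)) ^ 3)
      = 1 / d ^ 4 * ((u \<bullet> (u - e1)) / ((norm u) ^ 3 * (norm (u - e1)) ^ 3))" for u
    proof -
      have "f u \<bullet> f (u - e1) = u \<bullet> (u - e1)" using f(1) by (simp add: orthogonal_transformation_def)
      then show ?thesis unfolding f(2,3) using d f(1)
        by (simp add: orthogonal_transformation_norm power_mult_distrib power4_eq_xxxx power3_eq_cube mult_ac)
    qed
    then show ?thesis by simp
  qed
  also have "\<dots> = d ^ 3 * (1 / d ^ 4 * ckern)" unfolding ckern_def by (simp only: integral_mult_right_zero)
  also have "\<dots> = ckern / d" using d by (simp add: power3_eq_cube power4_eq_xxxx)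
  finally show ?thesis by (simp add: d_def)
qed

section \<open>Coulomb pairing and field energy\<close>

lemma AE_fst_neq_snd: "AE z in (lborel :: ((real^3) \<times> (real^3)) measure). fst z \<noteq> snd z"
proof -
  have "AE z in leb3 \<Otimes>\<^sub>M leb3. fst z \<noteq> snd z"
  proof (rule lborel_pair.AE_pair_measure)
    have "{z \<in> space borel. fst z \<noteq> snd z} \<in> sets (borel :: ((real^3) \<times> (real^3)) measure)"
      by measurable
    then show "{z \<in> space (lborel \<Otimes>\<^sub>M lborel). fst z \<noteq> snd z} \<in> sets (leb3 \<Otimes>\<^sub>M leb3)"
      unfolding lborel_prod by simp
    show "AE x in lborel. AE y in lborel. fst (x :: real^3, y) \<noteq> snd (x, y)"
    proof (rule AE_I2)
      fix x :: "real^3"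
      have "AE y in lborel. y \<noteq> x" by (rule AE_lborel_singleton)
      then show "AE y in lborel. fst (x, y) \<noteq> snd (x, y)" by eventually_elim auto
    qed
  qed
  then show ?thesis unfolding lborel_prod .
qed

text \<open>On the diagonal division by zero makes this 0; the diagonal is a null set in
  R^6.\<close>

definition pairK :: "(real^3 \<Rightarrow> real) \<Rightarrow> (real^3 \<Rightarrow> real) \<Rightarrow> phase \<Rightarrow> real" where
  "pairK \<rho> \<sigma> z = \<rho> (fst z) * \<sigma> (snd z) / norm (fst z - snd z)"

definition Dpot :: "(real^3 \<Rightarrow> real) \<Rightarrow> (real^3 \<Rightarrow> real) \<Rightarrow> real" where
  "Dpot \<rho> \<sigma> = (\<integral>z. pairK \<rho> \<sigma> z \<partial>lborel)"

lemma pairK_measurable [measurable]: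
  assumes [measurable]: "\<rho> \<in> borel_measurable borel" "\<sigma> \<in> borel_measurable borel"
  shows "pairK \<rho> \<sigma> \<in> borel_measurable borel"
  unfolding pairK_def by measurable

definition gfield :: "(real^3 \<Rightarrow> real) \<Rightarrow> real^3 \<Rightarrow> real^3" where
  "gfield \<rho> x = (\<integral>y. (\<rho> y / norm (x - y) ^ 3) *\<^sub>R (x - y) \<partial>lborel)"

text \<open>Write the squared norm of the field as a double integral over y and z and integrate over
  x first; the inner integral is a multiple of the reciprocal distance of y and z. The exchange is
  justified by \<Psi>, the version with absolute kernel, whose total integral is
  \<open>Ckern\<close> times the Coulomb energy. This avoids integration by parts and the Poisson
  equation.\<close>

lemma gfield_energy:
  fixes \<rho> :: "real^3 \<Rightarrow> real"
  assumes [measurable]: "\<rho> \<in> borel_measurable borel" and r0: "\<And>x. 0 \<le> \<rho> x"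
    and iD: "integrable lborel (pairK \<rho> \<rho>)"
  shows "integrable lborel (\<lambda>x. (norm (gfield \<rho> x))\<^sup>2)"
    "(\<integral>x. (norm (gfield \<rho> x))\<^sup>2 \<partial>lborel) = ckern * Dpot \<rho> \<rho>"
proof -
  define k where "k x y z = ((x - y) \<bullet> (x - z)) / ((norm (x - y)) ^ 3 * (norm (x - z)) ^ 3)" for x y z :: "real^3"
  define b where "b x y z = 1 / ((norm (x - y))\<^sup>2 * (norm (x - z))\<^sup>2)" for x y z :: "real^3"
  have kb: "\<bar>k x y z\<bar> \<le> b x y z" for x y z
  proof (cases "x = y \<or> x = z")
    case True
    then show ?thesis by (auto simp: k_def b_def)
  next
    case False
    have "\<bar>(x - y) \<bullet> (x - z)\<bar> \<le> norm (x - y) * norm (x - z)" by (rule Cauchy_Schwarz_ineq2)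
    then have "\<bar>k x y z\<bar> \<le> (norm (x - y) * norm (x - z)) / ((norm (x - y)) ^ 3 * (norm (x - z)) ^ 3)"
      unfolding k_def abs_divide by (simp add: abs_mult divide_right_mono)
    also have "\<dots> = b x y z" unfolding b_def using False by (simp add: power3_eq_cube power2_eq_square)
    finally show ?thesis .
  qed
  have b0: "0 \<le> b x y z" for x y z by (simp add: b_def)
  define \<Phi> where "\<Phi> w = \<rho> (fst (snd w)) * \<rho> (snd (snd w)) * k (fst w) (fst (snd w)) (snd (snd w))"
    for w :: "(real^3) \<times> (real^3) \<times> (real^3)"
  define \<Psi> where "\<Psi> w = \<rho> (fst (snd w)) * \<rho> (snd (snd w)) * b (fst w) (fst (snd w)) (snd (snd w))"
    for w :: "(real^3) \<times> (real^3) \<times> (real^3)"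
  have [measurable]: "\<Phi> \<in> borel_measurable borel" "\<Psi> \<in> borel_measurable borel"
    unfolding \<Phi>_def \<Psi>_def k_def b_def by measurable
  have \<Phi>\<Psi>: "\<bar>\<Phi> w\<bar> \<le> \<Psi> w" for w
    unfolding \<Phi>_def \<Psi>_def abs_mult using kb r0 by (simp add: mult_left_mono)
  have \<Psi>0: "0 \<le> \<Psi> w" for w unfolding \<Psi>_def using r0 b0 by simp
  have fin: "(\<integral>\<^sup>+w. ennreal (\<Psi> w) \<partial>lborel) < \<infinity>"
  proof -
    have "(\<integral>\<^sup>+w. ennreal (\<Psi> w) \<partial>lborel) = (\<integral>\<^sup>+w. ennreal (\<Psi> w) \<partial>(lborel \<Otimes>\<^sub>M lborel))"
      by (simp add: lborel_prod)
    also have "\<dots> = (\<integral>\<^sup>+z. (\<integral>\<^sup>+x. ennreal (\<Psi> (x, z)) \<partial>lborel) \<partial>lborel)"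
      by (intro lborel_pair.nn_integral_snd[symmetric]) (simp add: lborel_prod)
    also have "\<dots> = (\<integral>\<^sup>+z. Ckern * ennreal (pairK \<rho> \<rho> z) \<partial>lborel)"
    proof (rule nn_integral_cong_AE)
      show "AE z in lborel. (\<integral>\<^sup>+x. ennreal (\<Psi> (x, z)) \<partial>lborel) = Ckern * ennreal (pairK \<rho> \<rho> z)"
        using AE_fst_neq_snd
      proof eventually_elim
        case (elim z)
        have "(\<integral>\<^sup>+x. ennreal (\<Psi> (x, z)) \<partial>lborel)
          = (\<integral>\<^sup>+x. ennreal (\<rho> (fst z) * \<rho> (snd z)) * ennreal (b x (fst z) (snd z)) \<partial>lborel)"
          unfolding \<Psi>_def using r0 b0 by (simp add: ennreal_mult)
        also have "\<dots> = ennreal (\<rho> (fst z) * \<rho> (snd z)) * (\<integral>\<^sup>+x. ennreal (b x (fst z) (snd z)) \<partial>lborel)"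
          by (rule nn_integral_cmult) (simp add: b_def)
        also have "\<dots> = ennreal (\<rho> (fst z) * \<rho> (snd z)) * (Ckern * ennreal (1 / norm (fst z - snd z)))"
          unfolding b_def kernel_abs_integral[OF elim] ..
        also have "\<dots> = Ckern * (ennreal (\<rho> (fst z) * \<rho> (snd z)) * ennreal (1 / norm (fst z - snd z)))"
          by (simp only: mult_ac)
        also have "ennreal (\<rho> (fst z) * \<rho> (snd z)) * ennreal (1 / norm (fst z - snd z)) = ennreal (pairK \<rho> \<rho> z)"
          unfolding pairK_def using r0 by (subst ennreal_mult[symmetric]) auto
        finally show ?case .
      qed
    qed
    also have "\<dots> = Ckern * (\<integral>\<^sup>+z. ennreal (pairK \<rho> \<rho> z) \<partial>lborel)" by (rule nn_integral_cmult) measurable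
    also have "\<dots> < \<infinity>"
    proof -
      have "(\<integral>\<^sup>+z. ennreal (pairK \<rho> \<rho> z) \<partial>lborel) < \<infinity>"
        using nn_integral_eq_integral[OF iD] r0 by (simp add: pairK_def)
      then show ?thesis using Ckern_finite by (simp add: ennreal_mult_less_top)
    qed
    finally show ?thesis .
  qed
  have i\<Psi>: "integrable lborel \<Psi>" using fin \<Psi>0 by (intro integrableI_nonneg) auto
  have i\<Phi>: "integrable lborel \<Phi>"
    by (rule Bochner_Integration.integrable_bound[OF i\<Psi>]) (use \<Phi>\<Psi> \<Psi>0 in auto)
  have i\<Phi>': "integrable (lborel \<Otimes>\<^sub>M lborel) \<Phi>" using i\<Phi> by (simp add: lborel_prod)
  have i\<Psi>': "integrable (lborel \<Otimes>\<^sub>M lborel) \<Psi>" using i\<Psi> by (simp add: lborel_prod)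
  define G where "G x = (\<integral>z. \<Phi> (x, z) \<partial>lborel)" for x
  have iG: "integrable lborel G" unfolding G_def by (rule lborel_pair.integrable_fst'[OF i\<Phi>'])
  have ae: "AE x in lborel. G x = (norm (gfield \<rho> x))\<^sup>2"
    using lborel_pair.AE_integrable_fst'[OF i\<Psi>']
  proof eventually_elim
    case (elim x)
    define h where "h y = (\<rho> y / norm (x - y) ^ 3) *\<^sub>R (x - y)" for y
    \<comment> \<open>a is the norm of h, and the integral of \<Psi> at fixed x is the square of the
      integral of a. Its finiteness for almost every x shows that the field integral converges
      absolutely there, so \<open>gfield\<close> is not a default value.\<close>
    define a where "a y = \<rho> y / (norm (x - y))\<^sup>2" for y
    have [measurable]: "h \<in> borel_measurable borel" "a \<in> borel_measurable borel"
      unfolding h_def a_def by measurable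
    have a0: "0 \<le> a y" for y using r0 by (simp add: a_def)
    have ha: "norm (h y) = a y" for y
      unfolding h_def a_def using r0[of y] by (simp add: power3_eq_cube power2_eq_square)
    have "(\<integral>\<^sup>+z. ennreal (\<Psi> (x, z)) \<partial>lborel) = (\<integral>\<^sup>+y. (\<integral>\<^sup>+z. ennreal (a y) * ennreal (a z) \<partial>lborel) \<partial>lborel)"
      using a0 by (subst nn_integral_phase) (auto simp: \<Psi>_def a_def b_def ennreal_mult[symmetric])
    also have "\<dots> = (\<integral>\<^sup>+y. ennreal (a y) \<partial>lborel) * (\<integral>\<^sup>+z. ennreal (a z) \<partial>lborel)"
      by (simp add: nn_integral_cmult nn_integral_multc)
    finally have sq: "(\<integral>\<^sup>+z. ennreal (\<Psi> (x, z)) \<partial>lborel) = (\<integral>\<^sup>+y. ennreal (a y) \<partial>lborel) * (\<integral>\<^sup>+z. ennreal (a z) \<partial>lborel)" .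
    have "(\<integral>\<^sup>+z. ennreal (\<Psi> (x, z)) \<partial>lborel) < \<infinity>"
      using nn_integral_eq_integral[OF elim] \<Psi>0 by simp
    then have af: "(\<integral>\<^sup>+y. ennreal (a y) \<partial>lborel) < \<infinity>"
      unfolding sq by (auto simp: ennreal_mult_less_top)
    have ih: "integrable lborel h" using af by (intro integrableI_bounded) (auto simp: ha)
    have ip: "integrable lborel (\<lambda>z. \<Phi> (x, z))"
      by (rule Bochner_Integration.integrable_bound[OF elim]) (use \<Phi>\<Psi> \<Psi>0 in auto)
    have "G x = (\<integral>z. h (fst z) \<bullet> h (snd z) \<partial>lborel)"
      unfolding G_def \<Phi>_def k_def h_def by (simp add: mult_ac)
    also have "\<dots> = (\<integral>y. (\<integral>z. h y \<bullet> h z \<partial>lborel) \<partial>lborel)"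
    proof -
      have "integrable (lborel \<Otimes>\<^sub>M lborel) (\<lambda>z. h (fst z) \<bullet> h (snd z))"
        using ip unfolding \<Phi>_def k_def h_def by (simp add: mult_ac lborel_prod)
      from lborel_pair.integral_fst'[OF this] show ?thesis by (simp add: lborel_prod)
    qed
    also have "\<dots> = (\<integral>y. h y \<bullet> gfield \<rho> x \<partial>lborel)"
      using ih by (simp add: gfield_def h_def[symmetric])
    also have "\<dots> = gfield \<rho> x \<bullet> gfield \<rho> x"
      using ih by (simp add: gfield_def h_def[symmetric])
    finally show ?case by (simp add: power2_norm_eq_inner)
  qed
  have gm: "gfield \<rho> \<in> borel_measurable borel"
    unfolding gfield_def by (rule lborel.borel_measurable_lebesgue_integral) (simp add: split_beta' lborel_prod)
  show i: "integrable lborel (\<lambda>x. (norm (gfield \<rho> x))\<^sup>2)"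
    using ae gm by (intro integrable_cong_AE_imp[OF iG]) auto
  have "(\<integral>x. (norm (gfield \<rho> x))\<^sup>2 \<partial>lborel) = (\<integral>x. G x \<partial>lborel)"
    using ae gm iG by (intro integral_cong_AE) auto
  also have "\<dots> = (\<integral>z. (\<integral>x. \<Phi> (x, z) \<partial>lborel) \<partial>lborel)"
    unfolding G_def using lborel_pair.Fubini_integral[of "\<lambda>x z. \<Phi> (x, z)"] i\<Phi>' by (simp add: split_beta')
  also have "\<dots> = (\<integral>z. ckern * pairK \<rho> \<rho> z \<partial>lborel)"
  proof (rule integral_cong_AE)
    show "(\<lambda>z. \<integral>x. \<Phi> (x, z) \<partial>lborel) \<in> borel_measurable lborel"
      using lborel_pair.integrable_snd[of "\<lambda>x z. \<Phi> (x, z)"] i\<Phi>' by (simp add: split_beta' borel_measurable_integrable)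
    show "AE z in lborel. (\<integral>x. \<Phi> (x, z) \<partial>lborel) = ckern * pairK \<rho> \<rho> z"
      using AE_fst_neq_snd
    proof eventually_elim
      case (elim z)
      have "(\<integral>x. \<Phi> (x, z) \<partial>lborel) = \<rho> (fst z) * \<rho> (snd z) * (\<integral>x. k x (fst z) (snd z) \<partial>lborel)"
        unfolding \<Phi>_def by simp
      also have "\<dots> = ckern * pairK \<rho> \<rho> z"
        unfolding k_def kernel_integral[OF elim] pairK_def by simp
      finally show ?case .
    qed
  qed measurable
  also have "\<dots> = ckern * Dpot \<rho> \<rho>" by (simp add: Dpot_def)
  finally show "(\<integral>x. (norm (gfield \<rho> x))\<^sup>2 \<partial>lborel) = ckern * Dpot \<rho> \<rho>" .
qed

section \<open>Bounds on the Coulomb energy\<close>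

lemma nn_integral_ball_inv_norm:
  fixes x :: "real^3"
  assumes "R \<ge> 0"
  shows "(\<integral>\<^sup>+y. ennreal (indicator (ball x R) y / norm (x - y)) \<partial>lborel) \<le> ennreal (2 * pi * R\<^sup>2)"
proof -
  have [measurable]: "(\<lambda>u::real^3. ennreal (indicator {..<R} (norm u) / norm u)) \<in> borel_measurable borel"
    by measurable
  have "(\<integral>\<^sup>+y. ennreal (indicator (ball x R) y / norm (x - y)) \<partial>lborel)
    = (\<integral>\<^sup>+y. ennreal (indicator {..<R} (norm (x - y)) / norm (x - y)) \<partial>lborel)"
    by (intro nn_integral_cong) (auto simp: dist_norm split: split_indicator)
  also have "\<dots> = (\<integral>\<^sup>+u. ennreal (indicator {..<R} (norm u) / norm u) \<partial>leb3)"
    by (rule leb_preserving_nn_integral[OF leb_preserving_minus]) measurable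
  also have "\<dots> = (\<integral>\<^sup>+v. ennreal (2 * pi * sqrt v) * ennreal (indicator {..<R} (sqrt v) / sqrt v) * indicator {0..} v \<partial>lborel)"
    by (rule nn_integral_radial[of "\<lambda>r. ennreal (indicator {..<R} r / r)"]) measurable
  also have "\<dots> \<le> (\<integral>\<^sup>+v. ennreal (2 * pi) * indicator {0..R\<^sup>2} v \<partial>lborel)"
  proof (rule nn_integral_mono)
    fix v :: real
    show "ennreal (2 * pi * sqrt v) * ennreal (indicator {..<R} (sqrt v) / sqrt v) * indicator {0..} v
       \<le> ennreal (2 * pi) * indicator {0..R\<^sup>2} v"
    proof (cases "v > 0 \<and> sqrt v < R")
      case True
      then have "v \<le> R\<^sup>2" using sqrt_le_D[of v R] by simp
      then show ?thesis using True by (simp add: ennreal_mult[symmetric])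
    next
      case False
      then show ?thesis by (auto split: split_indicator)
    qed
  qed
  also have "\<dots> = ennreal (2 * pi * R\<^sup>2)"
    by (subst nn_integral_cmult_indicator) (auto simp: ennreal_mult)
  finally show ?thesis .
qed

text \<open>An elementary substitute for the Hardy-Littlewood-Sobolev inequality, with a constant
  depending on the mass. By symmetry it suffices to integrate over pairs with rho(y) <= rho(x). Near
  x, rho(y) is replaced by rho(x); farther than R the kernel is at most 1 / R and rho(y) integrates
  to M. The exponent 4/3 results from the choice of R.\<close>

lemma nn_integral_pairK_bound:
  fixes \<rho> :: "real^3 \<Rightarrow> real"
  assumes i: "integrable lborel \<rho>" and r0: "\<And>x. 0 \<le> \<rho> x" and M: "(\<integral>x. \<rho> x \<partial>lborel) = M"
  shows "(\<integral>\<^sup>+z. ennreal (pairK \<rho> \<rho> z) \<partial>lborel) \<le> ennreal (2 * (2 * pi + M)) * (\<integral>\<^sup>+x. ennreal (\<rho> x powr (4/3)) \<partial>lborel)"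
proof -
  have [measurable]: "\<rho> \<in> borel_measurable borel" using i by auto
  have M0: "M \<ge> 0" using M r0 by (auto intro: Bochner_Integration.integral_nonneg)
  have nM: "(\<integral>\<^sup>+x. ennreal (\<rho> x) \<partial>lborel) = ennreal M"
    using nn_integral_eq_integral[OF i] r0 M by simp
  define A where "A z = (if \<rho> (snd z) \<le> \<rho> (fst z) then pairK \<rho> \<rho> z else 0)" for z
  define B where "B z = (if \<rho> (fst z) \<le> \<rho> (snd z) then pairK \<rho> \<rho> z else 0)" for z
  have [measurable]: "A \<in> borel_measurable borel" "B \<in> borel_measurable borel"
    unfolding A_def B_def by measurable
  have sym: "B (x, y) = A (y, x)" for x y
    unfolding A_def B_def pairK_def by (simp add: norm_minus_commute mult.commute)
  have K0: "0 \<le> pairK \<rho> \<rho> z" for z using r0 by (simp add: pairK_def)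
  have AB: "pairK \<rho> \<rho> z \<le> A z + B z" for z using K0[of z] by (auto simp: A_def B_def)
  have IB: "(\<integral>\<^sup>+z. ennreal (B z) \<partial>lborel) = (\<integral>\<^sup>+z. ennreal (A z) \<partial>lborel)"
  proof -
    have "(\<integral>\<^sup>+z. ennreal (A z) \<partial>lborel) = (\<integral>\<^sup>+z. ennreal (A z) \<partial>(lborel \<Otimes>\<^sub>M lborel))"
      by (simp add: lborel_prod)
    also have "\<dots> = (\<integral>\<^sup>+x. (\<integral>\<^sup>+y. ennreal (A (y, x)) \<partial>lborel) \<partial>lborel)"
      by (intro lborel_pair.nn_integral_snd[symmetric]) (simp add: lborel_prod)
    also have "\<dots> = (\<integral>\<^sup>+z. ennreal (B z) \<partial>lborel)"
      by (subst nn_integral_phase) (auto simp: sym)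
    finally show ?thesis by simp
  qed
  have inner: "(\<integral>\<^sup>+y. ennreal (A (x, y)) \<partial>lborel) \<le> ennreal ((2 * pi + M) * \<rho> x powr (4/3))" for x
  proof (cases "\<rho> x = 0")
    case True
    then have "A (x, y) = 0" for y unfolding A_def pairK_def by simp
    then show ?thesis by simp
  next
    case False
    define t where "t = \<rho> x"
    have t: "t > 0" using False r0[of x] by (simp add: t_def)
    \<comment> \<open>the radius balancing \<open>t * t * R\<^sup>2\<close> (near part) against \<open>t / R\<close> (far part)\<close>
    define R where "R = t powr (- (1/3))"
    have R: "R > 0" using t by (simp add: R_def)
    have [measurable]: "ball x R \<in> sets borel" by simp
    have [measurable]: "(\<lambda>y. ennreal (indicator (ball x R) y / norm (x - y))) \<in> borel_measurable borel"
      by measurable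
    have "(\<integral>\<^sup>+y. ennreal (A (x, y)) \<partial>lborel)
      \<le> (\<integral>\<^sup>+y. ennreal (t * t) * ennreal (indicator (ball x R) y / norm (x - y)) + ennreal (t / R) * ennreal (\<rho> y) \<partial>lborel)"
    proof (rule nn_integral_mono)
      fix y
      have "A (x, y) \<le> t * t * (indicator (ball x R) y / norm (x - y)) + t / R * \<rho> y"
      proof (cases "\<rho> y \<le> t")
        case True
        show ?thesis
        proof (cases "y \<in> ball x R")
          case inb: True
          have "t * \<rho> y / norm (x - y) \<le> t * t / norm (x - y)"
            using True t by (intro divide_right_mono mult_left_mono) auto
          moreover have "0 \<le> t / R * \<rho> y" using t R r0 by simp
          ultimately show ?thesis using inb True by (simp add: A_def pairK_def t_def)
        next
          case False
          then have "R \<le> norm (x - y)" by (simp add: dist_norm)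
          moreover from this have "0 < norm (x - y) * R" using R by (intro mult_pos_pos) linarith+
          ultimately have "t * \<rho> y / norm (x - y) \<le> t * \<rho> y / R"
            using t r0 by (intro divide_left_mono) auto
          then show ?thesis using False True by (simp add: A_def pairK_def t_def)
        qed
      next
        case False
        have "0 \<le> t * t * (indicator (ball x R) y / norm (x - y)) + t / R * \<rho> y"
          using t R r0 by (intro add_nonneg_nonneg mult_nonneg_nonneg) auto
        then show ?thesis using False by (simp add: A_def t_def)
      qed
      then have "ennreal (A (x, y)) \<le> ennreal (t * t * (indicator (ball x R) y / norm (x - y)) + t / R * \<rho> y)"
        by (rule ennreal_leI)
      also have "\<dots> = ennreal (t * t) * ennreal (indicator (ball x R) y / norm (x - y)) + ennreal (t / R) * ennreal (\<rho> y)"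
        using t R r0 by (subst ennreal_plus) (auto simp: ennreal_mult[symmetric])
      finally show "ennreal (A (x, y)) \<le> \<dots>" .
    qed
    also have "\<dots> = ennreal (t * t) * (\<integral>\<^sup>+y. ennreal (indicator (ball x R) y / norm (x - y)) \<partial>lborel) + ennreal (t / R) * ennreal M"
      by (subst nn_integral_add) (auto simp: nn_integral_cmult nM)
    also have "\<dots> \<le> ennreal (t * t) * ennreal (2 * pi * R\<^sup>2) + ennreal (t / R) * ennreal M"
      using R by (intro add_mono mult_left_mono nn_integral_ball_inv_norm) auto
    also have "\<dots> = ennreal (t * t * (2 * pi * R\<^sup>2) + t / R * M)"
      using t R M0 by (subst ennreal_plus) (auto simp: ennreal_mult[symmetric])
    also have "t * t * (2 * pi * R\<^sup>2) + t / R * M = (2 * pi + M) * t powr (4/3)"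
    proof -
      have "t * t * R\<^sup>2 = t powr 1 * t powr 1 * (t powr (- (1/3)) * t powr (- (1/3)))"
        using t by (simp add: R_def power2_eq_square)
      also have "\<dots> = t powr (4/3)" by (simp only: powr_add[symmetric]) simp
      finally have 1: "t * t * R\<^sup>2 = t powr (4/3)" .
      have "t / R = t powr 1 / t powr (- (1/3))" using t by (simp add: R_def)
      also have "\<dots> = t powr (4/3)" by (simp only: powr_diff[symmetric]) simp
      finally have 2: "t / R = t powr (4/3)" .
      have "t * t * (2 * pi * R\<^sup>2) = 2 * pi * (t * t * R\<^sup>2)" by simp
      then show ?thesis unfolding 1 2 by (simp add: algebra_simps)
    qed
    finally show ?thesis by (simp add: t_def)
  qed
  have IA: "(\<integral>\<^sup>+z. ennreal (A z) \<partial>lborel) \<le> ennreal (2 * pi + M) * (\<integral>\<^sup>+x. ennreal (\<rho> x powr (4/3)) \<partial>lborel)"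
  proof -
    have "(\<integral>\<^sup>+z. ennreal (A z) \<partial>lborel) = (\<integral>\<^sup>+x. (\<integral>\<^sup>+y. ennreal (A (x, y)) \<partial>lborel) \<partial>lborel)"
      by (rule nn_integral_phase) measurable
    also have "\<dots> \<le> (\<integral>\<^sup>+x. ennreal (2 * pi + M) * ennreal (\<rho> x powr (4/3)) \<partial>lborel)"
      using inner M0 by (intro nn_integral_mono) (simp add: ennreal_mult)
    also have "\<dots> = ennreal (2 * pi + M) * (\<integral>\<^sup>+x. ennreal (\<rho> x powr (4/3)) \<partial>lborel)"
      by (rule nn_integral_cmult) measurable
    finally show ?thesis .
  qed
  have "(\<integral>\<^sup>+z. ennreal (pairK \<rho> \<rho> z) \<partial>lborel) \<le> (\<integral>\<^sup>+z. ennreal (A z) + ennreal (B z) \<partial>lborel)"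
  proof (rule nn_integral_mono)
    fix z
    have "ennreal (pairK \<rho> \<rho> z) \<le> ennreal (A z + B z)" by (rule ennreal_leI[OF AB])
    also have "\<dots> = ennreal (A z) + ennreal (B z)" using K0[of z] by (intro ennreal_plus) (auto simp: A_def B_def)
    finally show "ennreal (pairK \<rho> \<rho> z) \<le> ennreal (A z) + ennreal (B z)" .
  qed
  also have "\<dots> = (\<integral>\<^sup>+z. ennreal (A z) \<partial>lborel) + (\<integral>\<^sup>+z. ennreal (A z) \<partial>lborel)"
    by (subst nn_integral_add) (auto simp: IB)
  also have "\<dots> \<le> ennreal (2 * pi + M) * (\<integral>\<^sup>+x. ennreal (\<rho> x powr (4/3)) \<partial>lborel)
       + ennreal (2 * pi + M) * (\<integral>\<^sup>+x. ennreal (\<rho> x powr (4/3)) \<partial>lborel)"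
    by (intro add_mono IA)
  also have "\<dots> = ennreal (2 * (2 * pi + M)) * (\<integral>\<^sup>+x. ennreal (\<rho> x powr (4/3)) \<partial>lborel)"
  proof -
    have "ennreal (2 * (2 * pi + M)) = ennreal ((2 * pi + M) + (2 * pi + M))" by (simp only: mult_2)
    also have "\<dots> = ennreal (2 * pi + M) + ennreal (2 * pi + M)" using M0 by (intro ennreal_plus) auto
    finally show ?thesis by (simp only: distrib_right)
  qed
  finally show ?thesis .
qed

context polytrope
begin

text \<open>Since 4/3 - q < 0, the coefficient of s^q becomes arbitrarily small for large S; this is
  how q > 4/3 controls the Coulomb energy.\<close>

lemma powr_interpolate:
  assumes "s \<ge> 0" "S > 0"
  shows "s powr (4/3) \<le> S powr (1/3) * s + S powr (4/3 - q) * s powr q"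
proof (cases "s \<le> S")
  case True
  have "s powr (4/3) = s powr (1/3) * s"
    using assms powr_mult_base[of s "1/3"] by (simp add: mult.commute)
  also have "\<dots> \<le> S powr (1/3) * s" using True assms by (intro mult_right_mono powr_mono2) auto
  finally show ?thesis by (simp add: add_increasing2)
next
  case False
  then have s: "s > 0" using assms by simp
  have "s powr (4/3) = s powr (4/3 - q) * s powr q" by (simp add: powr_add[symmetric])
  also have "\<dots> \<le> S powr (4/3 - q) * s powr q"
    using False assms q_gt by (intro mult_right_mono powr_mono2') auto
  finally show ?thesis using assms by (simp add: add_increasing)
qed

lemma dens_measurable: "dens \<rho> \<Longrightarrow> \<rho> \<in> borel_measurable borel"
  and dens_nonneg: "dens \<rho> \<Longrightarrow> 0 \<le> \<rho> x"
  and dens_integrable: "dens \<rho> \<Longrightarrow> integrable lborel \<rho>"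
  and dens_integrable_powr: "dens \<rho> \<Longrightarrow> integrable lborel (\<lambda>x. \<rho> x powr q)"
  by (auto simp: dens_def)

lemma dens_pairK_bound:
  assumes d: "dens \<rho>" and M: "(\<integral>x. \<rho> x \<partial>lborel) = M" and S: "S > 0"
  shows "integrable lborel (pairK \<rho> \<rho>)"
    "Dpot \<rho> \<rho> \<le> 2 * (2 * pi + M) * (S powr (1/3) * M + S powr (4/3 - q) * (\<integral>x. \<rho> x powr q \<partial>lborel))"
proof -
  have [measurable]: "\<rho> \<in> borel_measurable borel" by (rule dens_measurable[OF d])
  have r0: "0 \<le> \<rho> x" for x by (rule dens_nonneg[OF d])
  have M0: "M \<ge> 0" using M r0 by (auto intro: Bochner_Integration.integral_nonneg)
  define I where "I = (\<integral>x. \<rho> x powr q \<partial>lborel)"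
  have I0: "I \<ge> 0" unfolding I_def by (intro Bochner_Integration.integral_nonneg) auto
  have ii: "integrable lborel (\<lambda>x. S powr (1/3) * \<rho> x + S powr (4/3 - q) * \<rho> x powr q)"
    using dens_integrable[OF d] dens_integrable_powr[OF d] by auto
  have "(\<integral>\<^sup>+x. ennreal (\<rho> x powr (4/3)) \<partial>lborel) \<le> (\<integral>\<^sup>+x. ennreal (S powr (1/3) * \<rho> x + S powr (4/3 - q) * \<rho> x powr q) \<partial>lborel)"
    using r0 S by (intro nn_integral_mono ennreal_leI powr_interpolate) auto
  also have "\<dots> = ennreal (\<integral>x. S powr (1/3) * \<rho> x + S powr (4/3 - q) * \<rho> x powr q \<partial>lborel)"
    using r0 by (intro nn_integral_eq_integral ii) auto
  also have "(\<integral>x. S powr (1/3) * \<rho> x + S powr (4/3 - q) * \<rho> x powr q \<partial>lborel) = S powr (1/3) * M + S powr (4/3 - q) * I"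
    using dens_integrable[OF d] dens_integrable_powr[OF d] by (simp add: M I_def)
  finally have le43: "(\<integral>\<^sup>+x. ennreal (\<rho> x powr (4/3)) \<partial>lborel) \<le> ennreal (S powr (1/3) * M + S powr (4/3 - q) * I)" .
  have le: "(\<integral>\<^sup>+z. ennreal (pairK \<rho> \<rho> z) \<partial>lborel) \<le> ennreal (2 * (2 * pi + M) * (S powr (1/3) * M + S powr (4/3 - q) * I))"
  proof -
    have "(\<integral>\<^sup>+z. ennreal (pairK \<rho> \<rho> z) \<partial>lborel) \<le> ennreal (2 * (2 * pi + M)) * (\<integral>\<^sup>+x. ennreal (\<rho> x powr (4/3)) \<partial>lborel)"
      by (rule nn_integral_pairK_bound[OF dens_integrable[OF d] r0 M])
    also have "\<dots> \<le> ennreal (2 * (2 * pi + M)) * ennreal (S powr (1/3) * M + S powr (4/3 - q) * I)"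
      by (intro mult_left_mono le43) auto
    also have "\<dots> = ennreal (2 * (2 * pi + M) * (S powr (1/3) * M + S powr (4/3 - q) * I))"
      using M0 I0 by (intro ennreal_mult[symmetric]) auto
    finally show ?thesis .
  qed
  have K0: "0 \<le> pairK \<rho> \<rho> z" for z using r0 by (simp add: pairK_def)
  show i: "integrable lborel (pairK \<rho> \<rho>)"
    using le K0 by (intro integrableI_nonneg) (auto intro: le_less_trans)
  have "ennreal (Dpot \<rho> \<rho>) \<le> ennreal (2 * (2 * pi + M) * (S powr (1/3) * M + S powr (4/3 - q) * I))"
    using le nn_integral_eq_integral[OF i] K0 by (simp add: Dpot_def)
  then show "Dpot \<rho> \<rho> \<le> 2 * (2 * pi + M) * (S powr (1/3) * M + S powr (4/3 - q) * (\<integral>x. \<rho> x powr q \<partial>lborel))"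
    using M0 I0 by (subst (asm) ennreal_le_iff) (auto simp: I_def)
qed

lemma dens_indicator:
  assumes "B \<in> sets borel" "emeasure lborel B < \<infinity>"
  shows "dens (indicator B)"
proof -
  have "(\<lambda>x. indicator B x powr q :: real) = (indicator B :: real^3 \<Rightarrow> real)"
    using q_gt by (auto split: split_indicator)
  then show ?thesis using assms by (auto simp: dens_def)
qed

text \<open>Tested on the indicator of the unit ball: were the constant not positive, the field
  energy would vanish and the field would be zero almost everywhere, although it points outwards at
  every point far from the ball.\<close>

lemma ckern_pos: "ckern > 0"
proof (rule ccontr)
  assume neg: "\<not> ckern > 0"
  define \<rho> :: "real^3 \<Rightarrow> real" where "\<rho> = indicator (ball 0 1)"
  have d: "dens \<rho>" unfolding \<rho>_def by (rule dens_indicator) (auto simp: emeasure_ball)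
  have iD: "integrable lborel (pairK \<rho> \<rho>)" by (rule dens_pairK_bound(1)[OF d refl, of 1]) simp
  have [measurable]: "\<rho> \<in> borel_measurable borel" by (rule dens_measurable[OF d])
  have r0: "0 \<le> \<rho> x" for x by (rule dens_nonneg[OF d])
  note g = gfield_energy[OF _ r0 iD]
  have "Dpot \<rho> \<rho> \<ge> 0" unfolding Dpot_def pairK_def using r0 by (intro Bochner_Integration.integral_nonneg) auto
  then have "(\<integral>x. (norm (gfield \<rho> x))\<^sup>2 \<partial>lborel) \<le> 0" using g(2) neg by (simp add: mult_nonpos_nonneg)
  moreover have "(\<integral>x. (norm (gfield \<rho> x))\<^sup>2 \<partial>lborel) \<ge> 0" by (intro Bochner_Integration.integral_nonneg) auto
  ultimately have "(\<integral>x. (norm (gfield \<rho> x))\<^sup>2 \<partial>lborel) = 0" by simp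
  then have ae: "AE x in lborel. (norm (gfield \<rho> x))\<^sup>2 = 0"
    using g(1) by (subst (asm) integral_nonneg_eq_0_iff_AE) auto
  \<comment> \<open>For norm x > 2 every source point y of the unit ball satisfies x . (x - y) > 0,
    so a zero field would force a nonnegative integrand that is positive on the whole ball to vanish
    almost everywhere.\<close>
  have nz: "gfield \<rho> x \<noteq> 0" if x: "norm x > 2" for x
  proof
    assume 0: "gfield \<rho> x = 0"
    define h where "h y = (\<rho> y / norm (x - y) ^ 3) *\<^sub>R (x - y)" for y
    have [measurable]: "h \<in> borel_measurable borel" unfolding h_def by measurable
    have far: "norm (x - y) > 1" if "norm y < 1" for y
      using norm_triangle_ineq2[of x y] x that by linarith
    have ih: "integrable lborel h"
    proof (rule Bochner_Integration.integrable_bound[OF dens_integrable[OF d]])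
      show "AE y in lborel. norm (h y) \<le> norm (\<rho> y)"
      proof (rule AE_I2)
        fix y
        show "norm (h y) \<le> norm (\<rho> y)"
        proof (cases "norm y < 1")
          case True
          have "1 \<le> (norm (x - y))\<^sup>2" using far[OF True] by (simp add: one_le_power)
          moreover have "norm (h y) = \<rho> y / (norm (x - y))\<^sup>2"
            unfolding h_def using r0[of y] far[OF True] by (simp add: power3_eq_cube power2_eq_square)
          ultimately show ?thesis using r0[of y] by (simp add: divide_le_eq mult_left_le mult_le_cancel_left1)
        next
          case False
          then show ?thesis by (simp add: h_def \<rho>_def)
        qed
      qed
    qed measurable
    have pos: "x \<bullet> (x - y) > 0" if "norm y < 1" for y
    proof -
      have "x \<bullet> y \<le> norm x * norm y" by (rule norm_cauchy_schwarz)
      also have "\<dots> < norm x * norm x" using x that by (intro mult_strict_left_mono) auto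
      also have "\<dots> = x \<bullet> x" by (simp add: power2_norm_eq_inner[symmetric] power2_eq_square)
      finally show ?thesis by (simp add: inner_diff_right)
    qed
    have hx: "x \<bullet> h y \<ge> 0" for y
      unfolding h_def \<rho>_def using pos[of y] by (auto split: split_indicator)
    have "(\<integral>y. x \<bullet> h y \<partial>lborel) = x \<bullet> gfield \<rho> x"
      using ih by (simp add: gfield_def h_def[symmetric])
    then have "(\<integral>y. x \<bullet> h y \<partial>lborel) = 0" using 0 by simp
    then have "AE y in lborel. x \<bullet> h y = 0"
      using ih hx by (subst (asm) integral_nonneg_eq_0_iff_AE) auto
    then have "AE y in lborel. y \<notin> ball (0::real^3) 1"
    proof eventually_elim
      case (elim y)
      show ?case
      proof
        assume "y \<in> ball 0 1"
        then have "norm y < 1" by simp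
        moreover from this have "0 < norm (x - y) ^ 3" using far[of y] by (intro zero_less_power) linarith
        ultimately have "x \<bullet> h y > 0"
          using pos[of y] by (simp add: h_def \<rho>_def divide_pos_pos)
        then show False using elim by simp
      qed
    qed
    then have "emeasure lborel (ball (0::real^3) 1) = 0"
      by (subst (asm) AE_iff_measurable[of "ball 0 1"]) auto
    then show False by (simp add: emeasure_ball unit_ball_vol_3)
  qed
  have "AE x in lborel. x \<notin> ball (4 *\<^sub>R e1) 1"
    using ae
  proof eventually_elim
    case (elim x)
    show ?case
    proof
      assume "x \<in> ball (4 *\<^sub>R e1) 1"
      then have "norm (4 *\<^sub>R e1 - x) < 1" by (simp add: dist_norm)
      then have "norm x > 2" using norm_triangle_ineq2[of "4 *\<^sub>R e1" x] by simp
      then show False using nz elim by simp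
    qed
  qed
  then have "emeasure lborel (ball (4 *\<^sub>R e1) 1) = 0"
    by (subst (asm) AE_iff_measurable[of "ball (4 *\<^sub>R e1) 1"]) auto
  then show False by (simp add: emeasure_ball unit_ball_vol_3)
qed

section \<open>The reduced functional and its minimizers\<close>

definition kap :: real where "kap = ckern / (8 * pi)"

lemma kap_pos: "kap > 0" using ckern_pos by (simp add: kap_def)

definition J :: "(real^3 \<Rightarrow> real) \<Rightarrow> real" where
  "J \<rho> = c3 * (\<integral>x. \<rho> x powr q \<partial>lborel) - kap * Dpot \<rho> \<rho>"

lemma HC_eq:
  assumes f: "f \<in> FM k M"
  shows "HC k f = Pfun k f - kap * Dpot (rho f) (rho f)"
proof -
  note d = FM_dens(1)[OF f]
  have iD: "integrable lborel (pairK (rho f) (rho f))" by (rule dens_pairK_bound(1)[OF d refl, of 1]) simp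
  have g: "gradU f = gfield (rho f)" by (simp add: gradU_def gfield_def fun_eq_iff)
  show ?thesis unfolding HC_def Epot_def g
    using gfield_energy(2)[OF dens_measurable[OF d] dens_nonneg[OF d] iD] by (simp add: kap_def)
qed

text \<open>A real \<open>INF\<close> is a lower bound only for sets bounded below; without this the
  hypothesis on the infimum would say nothing.\<close>

lemma J_bounded_below:
  obtains L where "\<And>\<rho>. dens \<rho> \<Longrightarrow> (\<integral>x. \<rho> x \<partial>lborel) = M \<Longrightarrow> L \<le> J \<rho>"
proof -
  define C where "C = kap * (2 * (2 * pi + max 0 M))"
  have C: "C \<ge> 0" using kap_pos by (simp add: C_def)
  \<comment> \<open>Chosen so that S^(4/3 - q) = c3 / (C + 1): the Coulomb bound then costs at most
    C / (C + 1) of the rho^q term, which absorbs it. The added 1 covers C = 0.\<close>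
  define S where "S = (c3 / (C + 1)) powr (1 / (4/3 - q))"
  have S: "S > 0" using c3_pos C by (simp add: S_def)
  have Sq: "S powr (4/3 - q) = c3 / (C + 1)"
    using q_gt c3_pos C by (simp add: S_def powr_powr)
  show ?thesis
  proof (rule that)
    fix \<rho> assume d: "dens \<rho>" and M: "(\<integral>x. \<rho> x \<partial>lborel) = M"
    have M0: "M \<ge> 0" using M dens_nonneg[OF d] by (auto intro: Bochner_Integration.integral_nonneg)
    define I where "I = (\<integral>x. \<rho> x powr q \<partial>lborel)"
    have I0: "I \<ge> 0" unfolding I_def by (intro Bochner_Integration.integral_nonneg) auto
    have "kap * Dpot \<rho> \<rho> \<le> kap * (2 * (2 * pi + M) * (S powr (1/3) * M + S powr (4/3 - q) * I))"
      using kap_pos dens_pairK_bound(2)[OF d M S] by (simp add: I_def)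
    also have "\<dots> = C * (S powr (1/3) * M) + (C * (c3 / (C + 1))) * I"
      using M0 by (simp add: C_def Sq algebra_simps)
    also have "\<dots> \<le> C * (S powr (1/3) * M) + c3 * I"
    proof -
      have "C * (c3 / (C + 1)) \<le> c3" using C c3_pos by (simp add: field_simps)
      then show ?thesis using I0 by (intro add_left_mono mult_right_mono) auto
    qed
    finally show "- (C * (S powr (1/3) * M)) \<le> J \<rho>" unfolding J_def I_def by simp
  qed
qed

definition minimizer :: "real \<Rightarrow> (real^3 \<Rightarrow> real) \<Rightarrow> bool" where
  "minimizer M \<rho> \<longleftrightarrow> dens \<rho> \<and> (\<integral>x. \<rho> x \<partial>lborel) = M
     \<and> (\<forall>\<sigma>. dens \<sigma> \<longrightarrow> (\<integral>x. \<sigma> x \<partial>lborel) = M \<longrightarrow> J \<rho> \<le> J \<sigma>)"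

text \<open>\<open>J (rho g) <= HC k g\<close> for every competitor g, while \<open>profile\<close>
  turns any admissible density into a competitor with equality. Hence the two minimal values agree,
  and equality for f yields the profile by \<open>FM_profile_unique\<close>.\<close>

lemma minimizer_reduction:
  assumes f: "f \<in> FM k M" and inf: "HC k f = (INF g\<in>FM k M. HC k g)"
  shows "minimizer M (rho f)" "AE z in lborel. f z = profile (rho f) z"
proof -
  obtain L where L: "\<And>\<rho>. dens \<rho> \<Longrightarrow> (\<integral>x. \<rho> x \<partial>lborel) = M \<Longrightarrow> L \<le> J \<rho>"
    using J_bounded_below by blast
  have JH: "J (rho g) \<le> HC k g" if "g \<in> FM k M" for g
    using FM_dens(3)[OF that] HC_eq[OF that] by (simp add: J_def)
  have "L \<le> HC k g" if "g \<in> FM k M" for g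
    using L[OF FM_dens(1,2)[OF that]] JH[OF that] by linarith
  then have bdd: "bdd_below (HC k ` FM k M)" by (intro bdd_belowI2[of _ L]) auto
  have min: "HC k f \<le> HC k g" if "g \<in> FM k M" for g
    unfolding inf by (rule cINF_lower[OF bdd that])
  have HJ: "HC k f \<le> J \<sigma>" if "dens \<sigma>" "(\<integral>x. \<sigma> x \<partial>lborel) = M" for \<sigma>
    using min[OF profile_FM(1)[OF that]] HC_eq[OF profile_FM(1)[OF that]] profile_FM(2,3)[OF that]
    by (simp add: J_def)
  show "minimizer M (rho f)" unfolding minimizer_def
    using FM_dens[OF f] HJ JH[OF f] by (auto intro: order_trans)
  have "HC k f = J (rho f)" using HJ[OF FM_dens(1,2)[OF f]] JH[OF f] by simp
  then have "Pfun k f = c3 * (\<integral>x. rho f x powr q \<partial>lborel)" using HC_eq[OF f] by (simp add: J_def)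
  then show "AE z in lborel. f z = profile (rho f) z" by (rule FM_profile_unique[OF f])
qed

end

section \<open>Polarization\<close>

definition mirror :: "real^3 \<Rightarrow> real \<Rightarrow> real^3 \<Rightarrow> real^3" where
  "mirror e t x = x - (2 * (e \<bullet> x - t)) *\<^sub>R e"

definition side :: "real^3 \<Rightarrow> real \<Rightarrow> real^3 \<Rightarrow> real" where
  "side e t x = sgn (t - e \<bullet> x)"

lemma side_measurable [measurable]: "side e t \<in> borel_measurable borel"
  unfolding side_def by measurable

lemma side_cases: "side e t x = 1 \<or> side e t x = -1 \<or> side e t x = 0"
  by (auto simp: side_def sgn_real_def)

lemma mirror_inner: "norm e = 1 \<Longrightarrow> t - e \<bullet> mirror e t x = - (t - e \<bullet> x)"
  by (simp add: mirror_def inner_diff_right norm_eq_1)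

lemma side_mirror: "norm e = 1 \<Longrightarrow> side e t (mirror e t x) = - side e t x"
  unfolding side_def by (simp only: mirror_inner sgn_minus)

lemma mirror_mirror [simp]: "norm e = 1 \<Longrightarrow> mirror e t (mirror e t x) = x"
  using mirror_inner[of e t x] unfolding mirror_def by (simp add: algebra_simps flip: scaleR_add_left scaleR_diff_left)

lemma mirror_fix: "side e t x = 0 \<Longrightarrow> mirror e t x = x"
  by (simp add: side_def mirror_def sgn_eq_0_iff)

lemma leb_preserving_mirror:
  assumes e: "norm e = 1"
  shows "leb_preserving (mirror e t)"
proof -
  have "orthogonal_transformation (\<lambda>x. x - (2 * (e \<bullet> x)) *\<^sub>R e)"
    unfolding orthogonal_transformation
  proof (intro conjI allI)
    show "linear (\<lambda>x. x - (2 * (e \<bullet> x)) *\<^sub>R e)"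
      by (rule linearI) (auto simp: inner_add_right algebra_simps)
    fix v
    have "e \<bullet> e = 1" using e by (simp add: norm_eq_1)
    then have "(v - (2 * (e \<bullet> v)) *\<^sub>R e) \<bullet> (v - (2 * (e \<bullet> v)) *\<^sub>R e) = v \<bullet> v"
      by (simp add: inner_diff_left inner_diff_right inner_commute[of v e] algebra_simps)
    then show "norm (v - (2 * (e \<bullet> v)) *\<^sub>R e) = norm v" by (simp add: norm_eq_sqrt_inner)
  qed
  from leb_preserving_comp[OF leb_preserving_plus[of "(2 * t) *\<^sub>R e"] leb_preserving_orthogonal[OF this]]
  have "leb_preserving (\<lambda>x. (2 * t) *\<^sub>R e + (x - (2 * (e \<bullet> x)) *\<^sub>R e))" .
  moreover have "(\<lambda>x. (2 * t) *\<^sub>R e + (x - (2 * (e \<bullet> x)) *\<^sub>R e)) = mirror e t"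
    by (simp add: mirror_def fun_eq_iff algebra_simps)
  ultimately show ?thesis by simp
qed

text \<open>The mirror image of y is farther from x than y itself exactly when x and y lie strictly
  on the same side of the plane; this sign drives the polarization argument.\<close>

lemma norm_sub_mirror:
  assumes e: "norm e = 1"
  shows "(norm (x - mirror e t y))\<^sup>2 = (norm (x - y))\<^sup>2 + 4 * (t - e \<bullet> x) * (t - e \<bullet> y)"
proof -
  have ee: "e \<bullet> e = 1" using e by (simp add: norm_eq_1)
  have eq: "x - mirror e t y = (x - y) + (2 * (e \<bullet> y - t)) *\<^sub>R e" by (simp add: mirror_def)
  have "(norm (u + c *\<^sub>R e))\<^sup>2 = (norm u)\<^sup>2 + 2 * c * (e \<bullet> u) + c * c" for u c
    unfolding power2_norm_eq_inner
    by (simp add: inner_add_left inner_add_right inner_commute[of u e] ee algebra_simps)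
  note this[of "x - y" "2 * (e \<bullet> y - t)", folded eq]
  then show ?thesis by (simp only: inner_diff_right) (simp add: algebra_simps)
qed

lemma norm_mirror_sub:
  assumes e: "norm e = 1"
  shows "norm (mirror e t x - y) = norm (x - mirror e t y)"
proof -
  have "(norm (mirror e t x - y))\<^sup>2 = (norm (x - mirror e t y))\<^sup>2"
    unfolding norm_minus_commute[of "mirror e t x" y] norm_sub_mirror[OF e] norm_minus_commute[of y x]
    by (simp add: algebra_simps)
  then show ?thesis by (simp add: power2_eq_iff_nonneg)
qed

lemma norm_mirror_mirror:
  "norm e = 1 \<Longrightarrow> norm (mirror e t x - mirror e t y) = norm (x - y)"
  by (simp add: norm_mirror_sub)

lemma leb_preserving_map_prod:
  fixes S :: "'a::euclidean_space \<Rightarrow> 'a" and T :: "'b::euclidean_space \<Rightarrow> 'b"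
  assumes "leb_preserving S" "leb_preserving T"
  shows "leb_preserving (\<lambda>z. (S (fst z), T (snd z)))"
proof -
  have [measurable]: "S \<in> borel_measurable borel" "T \<in> borel_measurable borel"
    using assms by (auto simp: leb_preserving_def)
  have "distr lborel borel S \<Otimes>\<^sub>M distr lborel borel T = distr (lborel \<Otimes>\<^sub>M lborel) (borel \<Otimes>\<^sub>M borel) (\<lambda>(x, y). (S x, T y))"
    using assms by (intro pair_measure_distr) (auto simp: leb_preserving_def lborel.sigma_finite_measure_axioms)
  then have "lborel = distr lborel borel (\<lambda>z. (S (fst z), T (snd z)))"
    using assms by (simp add: leb_preserving_def lborel_prod borel_prod split_beta')
  then show ?thesis by (simp add: leb_preserving_def)
qed

text \<open>If W were positive and negative on sets of positive measure, their product would be a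
  set of positive measure where the product of the values is negative.\<close>

lemma AE_same_sign:
  fixes W :: "real^3 \<Rightarrow> real"
  assumes [measurable]: "W \<in> borel_measurable borel"
    and ae: "AE z in (lborel :: phase measure). 0 \<le> W (fst z) * W (snd z)"
  shows "(AE x in lborel. 0 \<le> W x) \<or> (AE x in lborel. W x \<le> 0)"
proof -
  define P N where "P = {x. W x > 0}" and "N = {x. W x < 0}"
  have [measurable]: "P \<in> sets borel" "N \<in> sets borel" unfolding P_def N_def by measurable
  have "AE z in (lborel :: phase measure). z \<notin> P \<times> N"
    using ae by eventually_elim (auto simp: P_def N_def mult_less_0_iff not_le[symmetric] zero_le_mult_iff)
  moreover have "P \<times> N \<in> sets (lborel :: phase measure)"
    by (simp add: borel_prod[symmetric])
  ultimately have "emeasure (lborel :: phase measure) (P \<times> N) = 0"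
    by (subst (asm) AE_iff_measurable[of "P \<times> N"]) auto
  then have "emeasure lborel P * emeasure lborel N = 0"
    by (simp add: lborel_prod[symmetric] lborel.emeasure_pair_measure_Times)
  then have "emeasure lborel P = 0 \<or> emeasure lborel N = 0" by simp
  then show ?thesis
  proof
    assume "emeasure lborel P = 0"
    then have "AE x in lborel. W x \<le> 0"
      by (intro AE_I[of _ _ P]) (auto simp: P_def)
    then show ?thesis ..
  next
    assume "emeasure lborel N = 0"
    then have "AE x in lborel. 0 \<le> W x"
      by (intro AE_I[of _ _ N]) (auto simp: N_def)
    then show ?thesis ..
  qed
qed

text \<open>Of the values at x and at its mirror image, the larger goes to the side e . x < t and
  the smaller to the other. Mean plus or minus half the distance expresses maximum and minimum in
  one formula, which also leaves points of the plane unchanged.\<close>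

definition polarize :: "real^3 \<Rightarrow> real \<Rightarrow> (real^3 \<Rightarrow> real) \<Rightarrow> real^3 \<Rightarrow> real" where
  "polarize e t \<rho> x = (\<rho> x + \<rho> (mirror e t x)) / 2 + side e t x * \<bar>\<rho> x - \<rho> (mirror e t x)\<bar> / 2"

lemma polarize_cases:
  assumes "norm e = 1"
  shows "polarize e t \<rho> x = \<rho> x \<and> polarize e t \<rho> (mirror e t x) = \<rho> (mirror e t x) \<or>
         polarize e t \<rho> x = \<rho> (mirror e t x) \<and> polarize e t \<rho> (mirror e t x) = \<rho> x"
  using side_cases[of e t x] side_mirror[OF assms, of t x] mirror_mirror[OF assms, of t x] mirror_fix[of e t x]
  unfolding polarize_def by (auto simp: abs_if field_simps)

text \<open>Compares the Coulomb interaction of two mirror pairs before and after polarization. a,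
  a' are the values at x and its image, b, b' those at y and its image; K1 is the kernel for x and y
  or for both images, K2 the kernel when one point is reflected.\<close>

lemma polarization_pointwise:
  fixes a a' b b' s s' K1 K2 :: real
  defines "A \<equiv> (a + a') / 2 + s * \<bar>a - a'\<bar> / 2" and "A' \<equiv> (a' + a) / 2 + (- s) * \<bar>a' - a\<bar> / 2"
    and "B \<equiv> (b + b') / 2 + s' * \<bar>b - b'\<bar> / 2" and "B' \<equiv> (b' + b) / 2 + (- s') * \<bar>b' - b\<bar> / 2"
  shows "(A * B * K1 + A' * B' * K1 + A * B' * K2 + A' * B * K2) - (a * b * K1 + a' * b' * K1 + a * b' * K2 + a' * b * K2)
    = (s * s' * (\<bar>a - a'\<bar> * \<bar>b - b'\<bar>) - (a - a') * (b - b')) * (K1 - K2) / 2"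
proof -
  define d d' where "d = \<bar>a - a'\<bar>" and "d' = \<bar>b - b'\<bar>"
  have e: "\<bar>a' - a\<bar> = d" "\<bar>b' - b\<bar> = d'" "\<bar>a - a'\<bar> = d" "\<bar>b - b'\<bar> = d'" by (auto simp: d_def d'_def)
  show ?thesis unfolding A_def A'_def B_def B'_def e by (simp add: field_simps)
qed

context polytrope
begin

lemma polarize_dens:
  assumes d: "dens \<rho>" and e: "norm e = 1"
  shows "dens (polarize e t \<rho>)" "(\<integral>x. polarize e t \<rho> x \<partial>lborel) = (\<integral>x. \<rho> x \<partial>lborel)"
    "(\<integral>x. polarize e t \<rho> x powr q \<partial>lborel) = (\<integral>x. \<rho> x powr q \<partial>lborel)"
proof -
  note [measurable] = dens_measurable[OF d]
  let ?T = "mirror e t"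
  have T: "leb_preserving ?T" by (rule leb_preserving_mirror[OF e])
  note [measurable] = leb_preserving_measurable[OF T]
  have pm[measurable]: "polarize e t \<rho> \<in> borel_measurable borel" unfolding polarize_def by measurable
  note c = polarize_cases[OF e, of t \<rho>]
  have p0: "0 \<le> polarize e t \<rho> x" for x using c[of x] dens_nonneg[OF d] by auto
  \<comment> \<open>At x and its mirror image, polarization only permutes the two values, so the sum
    of \<open>h\<close> over the pair is unchanged; reflection invariance of the measure yields the
    integral. As \<open>h\<close> is nonnegative on all reals here, the mass is obtained through the
    absolute value.\<close>
  have key: "integrable lborel (\<lambda>x. h (polarize e t \<rho> x))
     \<and> (\<integral>x. h (polarize e t \<rho> x) \<partial>lborel) = (\<integral>x. h (\<rho> x) \<partial>lborel)"
    if [measurable]: "h \<in> borel_measurable borel" and h0: "\<And>s. 0 \<le> h s" and i: "integrable lborel (\<lambda>x. h (\<rho> x))"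
    for h :: "real \<Rightarrow> real"
  proof -
    have iT: "integrable lborel (\<lambda>x. h (\<rho> (?T x)))"
      using leb_preserving_integrable[OF T, of "\<lambda>x. h (\<rho> x)"] i by simp
    have IT: "(\<integral>x. h (\<rho> (?T x)) \<partial>lborel) = (\<integral>x. h (\<rho> x) \<partial>lborel)"
      by (rule leb_preserving_integral[OF T]) measurable
    have ip: "integrable lborel (\<lambda>x. h (polarize e t \<rho> x))"
    proof (rule Bochner_Integration.integrable_bound)
      show "integrable lborel (\<lambda>x. h (\<rho> x) + h (\<rho> (?T x)))" using i iT by auto
      show "AE x in lborel. norm (h (polarize e t \<rho> x)) \<le> norm (h (\<rho> x) + h (\<rho> (?T x)))"
      proof (rule AE_I2)
        fix x show "norm (h (polarize e t \<rho> x)) \<le> norm (h (\<rho> x) + h (\<rho> (?T x)))"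
          using c[of x] h0[of "\<rho> x"] h0[of "\<rho> (?T x)"] by auto
      qed
    qed measurable
    have ipT: "integrable lborel (\<lambda>x. h (polarize e t \<rho> (?T x)))"
      using leb_preserving_integrable[OF T, of "\<lambda>x. h (polarize e t \<rho> x)"] ip by simp
    have IpT: "(\<integral>x. h (polarize e t \<rho> (?T x)) \<partial>lborel) = (\<integral>x. h (polarize e t \<rho> x) \<partial>lborel)"
      by (rule leb_preserving_integral[OF T, of "\<lambda>x. h (polarize e t \<rho> x)"]) measurable
    have pt: "h (polarize e t \<rho> x) + h (polarize e t \<rho> (?T x)) = h (\<rho> x) + h (\<rho> (?T x))" for x
      using c[of x] by auto
    have "(\<integral>x. h (polarize e t \<rho> x) \<partial>lborel) + (\<integral>x. h (polarize e t \<rho> (?T x)) \<partial>lborel)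
      = (\<integral>x. h (polarize e t \<rho> x) + h (polarize e t \<rho> (?T x)) \<partial>lborel)"
      using ip ipT by simp
    also have "\<dots> = (\<integral>x. h (\<rho> x) \<partial>lborel) + (\<integral>x. h (\<rho> (?T x)) \<partial>lborel)"
      unfolding pt using i iT by simp
    finally show ?thesis using ip IT IpT by simp
  qed
  have k1: "integrable lborel (\<lambda>x. \<bar>polarize e t \<rho> x\<bar>) \<and> (\<integral>x. \<bar>polarize e t \<rho> x\<bar> \<partial>lborel) = (\<integral>x. \<bar>\<rho> x\<bar> \<partial>lborel)"
    by (rule key) (use dens_integrable[OF d] in auto)
  have k2: "integrable lborel (\<lambda>x. polarize e t \<rho> x powr q) \<and> (\<integral>x. polarize e t \<rho> x powr q \<partial>lborel) = (\<integral>x. \<rho> x powr q \<partial>lborel)"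
    by (rule key) (use dens_integrable_powr[OF d] in auto)
  show "dens (polarize e t \<rho>)" unfolding dens_def using k1 k2 p0 pm by auto
  show "(\<integral>x. polarize e t \<rho> x \<partial>lborel) = (\<integral>x. \<rho> x \<partial>lborel)"
    using k1 p0 dens_nonneg[OF d] by simp
  show "(\<integral>x. polarize e t \<rho> x powr q \<partial>lborel) = (\<integral>x. \<rho> x powr q \<partial>lborel)" using k2 by simp
qed

text \<open>Polarization changes only the Coulomb term of \<open>J\<close>, so minimality forbids
  that it increases. Symmetrized over reflections, the gain is pointwise nonnegative and must
  therefore vanish almost everywhere; its equality case is the claim.\<close>

lemma minimizer_same_sign:
  fixes t :: real
  assumes m: "minimizer M \<rho>" and e: "norm e = 1"
  defines "W \<equiv> \<lambda>x. side e t x * (\<rho> x - \<rho> (mirror e t x))"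
  shows "AE z in (lborel :: phase measure). 0 \<le> W (fst z) * W (snd z)"
proof -
  have d: "dens \<rho>" using m by (simp add: minimizer_def)
  note [measurable] = dens_measurable[OF d]
  let ?T = "mirror e t"
  define P where "P = polarize e t \<rho>"
  have T: "leb_preserving ?T" by (rule leb_preserving_mirror[OF e])
  note [measurable] = leb_preserving_measurable[OF T]
  note pd = polarize_dens[OF d e, of t, folded P_def]
  note [measurable] = dens_measurable[OF pd(1)]
  have "J \<rho> \<le> J P" using m pd(1,2) by (auto simp: minimizer_def)
  then have "kap * Dpot P P \<le> kap * Dpot \<rho> \<rho>" by (simp add: J_def pd(3))
  then have le: "Dpot P P \<le> Dpot \<rho> \<rho>" using kap_pos by simp
  have iP: "integrable lborel (pairK P P)" by (rule dens_pairK_bound(1)[OF pd(1) refl, of 1]) simp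
  have i\<rho>: "integrable lborel (pairK \<rho> \<rho>)" by (rule dens_pairK_bound(1)[OF d refl, of 1]) simp
  define F where "F z = pairK P P z - pairK \<rho> \<rho> z" for z
  have iF: "integrable lborel F" unfolding F_def using iP i\<rho> by auto
  have [measurable]: "F \<in> borel_measurable borel" unfolding F_def by measurable
  have IF: "(\<integral>z. F z \<partial>lborel) \<le> 0" unfolding F_def using le iP i\<rho> by (simp add: Dpot_def)
  have id: "leb_preserving (\<lambda>x::real^3. x)" using leb_preserving_plus[of "0::real^3"] by simp
  have pr: "integrable lborel (\<lambda>z. F (S (fst z), S' (snd z))) \<and> (\<integral>z. F (S (fst z), S' (snd z)) \<partial>lborel) = (\<integral>z. F z \<partial>lborel)"
    if "leb_preserving S" "leb_preserving S'" for S S'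
    using leb_preserving_integral[OF leb_preserving_map_prod[OF that], of F]
      leb_preserving_integrable[OF leb_preserving_map_prod[OF that], of F] iF by simp
  \<comment> \<open>Sum over reflecting either variable independently. All four terms have the
    integral of F, but only the sum has a definite sign.\<close>
  define Sm where "Sm z = F (fst z, snd z) + F (?T (fst z), ?T (snd z)) + F (fst z, ?T (snd z)) + F (?T (fst z), snd z)" for z
  have iS: "integrable lborel Sm" unfolding Sm_def
    using pr[OF id id] pr[OF T T] pr[OF id T] pr[OF T id] by auto
  have "(\<integral>z. Sm z \<partial>lborel) = 4 * (\<integral>z. F z \<partial>lborel)" unfolding Sm_def
    using pr[OF id id] pr[OF T T] pr[OF id T] pr[OF T id] by simp
  then have IS: "(\<integral>z. Sm z \<partial>lborel) \<le> 0" using IF by simp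
  have PT: "P x = (\<rho> x + \<rho> (?T x)) / 2 + side e t x * \<bar>\<rho> x - \<rho> (?T x)\<bar> / 2"
    "P (?T x) = (\<rho> (?T x) + \<rho> x) / 2 + (- side e t x) * \<bar>\<rho> (?T x) - \<rho> x\<bar> / 2" for x
    unfolding P_def polarize_def by (simp_all add: e side_mirror)
  have Seq: "Sm z = (side e t (fst z) * side e t (snd z) * (\<bar>\<rho> (fst z) - \<rho> (?T (fst z))\<bar> * \<bar>\<rho> (snd z) - \<rho> (?T (snd z))\<bar>)
      - (\<rho> (fst z) - \<rho> (?T (fst z))) * (\<rho> (snd z) - \<rho> (?T (snd z)))) * (1 / norm (fst z - snd z) - 1 / norm (fst z - ?T (snd z))) / 2" for z
    unfolding polarization_pointwise[symmetric] PT[symmetric] Sm_def F_def pairK_def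
    by (simp add: norm_mirror_mirror[OF e] norm_mirror_sub[OF e] mirror_mirror[OF e] algebra_simps)
  have ae1: "AE z in (lborel :: phase measure). fst z \<noteq> ?T (snd z)"
    using leb_preserving_AE[OF leb_preserving_map_prod[OF id T] AE_fst_neq_snd] by simp
  have sgnK: "side e t x * side e t y = sgn (1 / norm (x - y) - 1 / norm (x - ?T y))"
    if "x \<noteq> y" "x \<noteq> ?T y" for x y
  proof -
    define u v where "u = norm (x - y)" and "v = norm (x - ?T y)"
    have uv: "u > 0" "v > 0" using that by (auto simp: u_def v_def)
    have "v\<^sup>2 - u\<^sup>2 = 4 * ((t - e \<bullet> x) * (t - e \<bullet> y))"
      using norm_sub_mirror[OF e, of x t y] by (simp add: u_def v_def)
    then have "sgn (v\<^sup>2 - u\<^sup>2) = side e t x * side e t y"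
      by (simp add: side_def sgn_mult)
    moreover have "v\<^sup>2 - u\<^sup>2 = (1 / u - 1 / v) * (u * v * (u + v))"
      using uv by (simp add: field_simps power2_eq_square)
    moreover have "sgn (u * v * (u + v)) = 1" using uv by (intro sgn_pos) auto
    ultimately show ?thesis by (simp add: sgn_mult u_def v_def)
  qed
  have pos: "0 \<le> (s * \<bar>w\<bar> - w) * K / 2" if "s = sgn K" for s w K :: real
  proof -
    have "(s * \<bar>w\<bar> - w) * K = \<bar>w\<bar> * \<bar>K\<bar> - w * K"
      unfolding that by (simp add: algebra_simps abs_sgn)
    moreover have "w * K \<le> \<bar>w\<bar> * \<bar>K\<bar>" by (metis abs_ge_self abs_mult)
    ultimately show ?thesis by simp
  qed
  have S0: "AE z in lborel. 0 \<le> Sm z"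
    using AE_fst_neq_snd ae1
  proof eventually_elim
    case (elim z)
    show ?case unfolding Seq
      using pos[OF sgnK[OF elim], of "(\<rho> (fst z) - \<rho> (?T (fst z))) * (\<rho> (snd z) - \<rho> (?T (snd z)))"]
      by (simp add: abs_mult)
  qed
  have "(\<integral>z. Sm z \<partial>lborel) \<ge> 0" using S0 by (rule integral_nonneg_AE)
  then have "(\<integral>z. Sm z \<partial>lborel) = 0" using IS by simp
  then have "AE z in lborel. Sm z = 0" using integral_nonneg_eq_0_iff_AE[OF iS S0] by simp
  then show ?thesis using AE_fst_neq_snd ae1
  proof eventually_elim
    case (elim z)
    define x y where "x = fst z" and "y = snd z"
    define s where "s = side e t x * side e t y"
    define w where "w = (\<rho> x - \<rho> (?T x)) * (\<rho> y - \<rho> (?T y))"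
    define K where "K = 1 / norm (x - y) - 1 / norm (x - ?T y)"
    have sK: "s = sgn K" unfolding s_def K_def using sgnK elim by (simp add: x_def y_def)
    have "(s * \<bar>w\<bar> - w) * K = 0" using elim(1) unfolding Seq
      by (simp add: s_def w_def K_def x_def y_def abs_mult)
    \<comment> \<open>If the kernel difference K is 0, then s = sgn K is 0; otherwise K
      cancels.\<close>
    then have "s * \<bar>w\<bar> = w \<or> s = 0" using sK by auto
    then have "s * w \<ge> 0"
      using side_cases[of e t x] side_cases[of e t y] by (auto simp: s_def)
    then show ?case by (simp add: W_def s_def w_def x_def y_def mult_ac)
  qed
qed

text \<open>W has one sign almost everywhere. Its integral is twice the difference of the masses on
  the two sides, which is 0 for a bisecting plane, so W vanishes; on the plane itself the reflection
  is the identity.\<close>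

lemma minimizer_mirror:
  assumes m: "minimizer M \<rho>" and e: "norm e = 1"
    and bis: "(\<integral>x. side e t x * \<rho> x \<partial>lborel) = 0"
  shows "AE x in lborel. \<rho> (mirror e t x) = \<rho> x"
proof -
  have d: "dens \<rho>" using m by (simp add: minimizer_def)
  note [measurable] = dens_measurable[OF d]
  let ?T = "mirror e t"
  have T: "leb_preserving ?T" by (rule leb_preserving_mirror[OF e])
  note [measurable] = leb_preserving_measurable[OF T]
  define W where "W = (\<lambda>x. side e t x * (\<rho> x - \<rho> (?T x)))"
  have [measurable]: "W \<in> borel_measurable borel" unfolding W_def by measurable
  have sg: "(AE x in lborel. 0 \<le> W x) \<or> (AE x in lborel. W x \<le> 0)"
    by (rule AE_same_sign) (use minimizer_same_sign[OF m e, of t] in \<open>auto simp: W_def\<close>)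
  have s1: "\<bar>side e t x\<bar> \<le> 1" for x using side_cases[of e t x] by auto
  have i1: "integrable lborel (\<lambda>x. side e t x * \<rho> x)"
  proof (rule Bochner_Integration.integrable_bound[OF dens_integrable[OF d]])
    show "AE x in lborel. norm (side e t x * \<rho> x) \<le> norm (\<rho> x)"
      using s1 by (intro AE_I2) (simp add: abs_mult mult_left_le_one_le)
  qed measurable
  have i2: "integrable lborel (\<lambda>x. side e t (?T x) * \<rho> (?T x))"
    using leb_preserving_integrable[OF T, of "\<lambda>x. side e t x * \<rho> x"] i1 by simp
  have I2: "(\<integral>x. side e t (?T x) * \<rho> (?T x) \<partial>lborel) = (\<integral>x. side e t x * \<rho> x \<partial>lborel)"
    by (rule leb_preserving_integral[OF T, of "\<lambda>x. side e t x * \<rho> x"]) measurable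
  have W2: "W x = side e t x * \<rho> x + side e t (?T x) * \<rho> (?T x)" for x
    unfolding W_def by (simp add: side_mirror[OF e] algebra_simps)
  have iW: "integrable lborel W" unfolding W2[abs_def] using i1 i2 by auto
  have IW: "(\<integral>x. W x \<partial>lborel) = 0" unfolding W2 using i1 i2 I2 bis by simp
  have "AE x in lborel. W x = 0"
    using sg
  proof
    assume "AE x in lborel. 0 \<le> W x"
    then show ?thesis using integral_nonneg_eq_0_iff_AE[OF iW] IW by simp
  next
    assume "AE x in lborel. W x \<le> 0"
    then have "AE x in lborel. 0 \<le> - W x" by simp
    moreover have "(\<integral>x. - W x \<partial>lborel) = 0" using IW by simp
    ultimately have "AE x in lborel. - W x = 0"
      using integral_nonneg_eq_0_iff_AE[of lborel "\<lambda>x. - W x"] iW by simp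
    then show ?thesis by simp
  qed
  then show ?thesis
  proof eventually_elim
    case (elim x)
    then show ?case using mirror_fix[of e t x] by (auto simp: W_def)
  qed
qed

end

section \<open>Bisecting planes and the centre of symmetry\<close>

lemma AE_not_hyperplane:
  fixes e :: "real^3"
  assumes "norm e = 1"
  shows "AE x in lborel. e \<bullet> x \<noteq> t"
proof -
  have "negligible {x. e \<bullet> x = t}" using assms by (intro negligible_hyperplane) auto
  then have "{x. e \<bullet> x = t} \<in> null_sets lebesgue" by (simp add: negligible_iff_null_sets)
  moreover have "{x. e \<bullet> x = t} \<in> sets lborel" using closed_hyperplane[of e t] by simp
  ultimately have "{x. e \<bullet> x = t} \<in> null_sets lborel" by (simp add: null_sets_completion_iff)
  then have "AE x in lborel. x \<notin> {x. e \<bullet> x = t}" by (rule AE_not_in)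
  then show ?thesis by simp
qed

text \<open>Intermediate value theorem in t: the mass difference of the two sides is continuous by
  dominated convergence, as planes are null sets, and tends to plus or minus the total mass.\<close>

lemma bisecting_plane:
  fixes \<rho> :: "real^3 \<Rightarrow> real"
  assumes i: "integrable lborel \<rho>" and M: "(\<integral>x. \<rho> x \<partial>lborel) > 0" and e: "norm e = 1"
  obtains t where "(\<integral>x. side e t x * \<rho> x \<partial>lborel) = 0"
proof -
  have [measurable]: "\<rho> \<in> borel_measurable borel" using i by auto
  define \<phi> where "\<phi> t = (\<integral>x. side e t x * \<rho> x \<partial>lborel)" for t
  have conv: "(\<lambda>j. \<phi> (X j)) \<longlonglongrightarrow> (\<integral>x. s x * \<rho> x \<partial>lborel)"
    if [measurable]: "s \<in> borel_measurable borel" and lim: "AE x in lborel. (\<lambda>j. side e (X j) x) \<longlonglongrightarrow> s x"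
    for X :: "nat \<Rightarrow> real" and s :: "real^3 \<Rightarrow> real"
    unfolding \<phi>_def
  proof (rule integral_dominated_convergence[where w = "\<lambda>x. \<bar>\<rho> x\<bar>"])
    show "AE x in lborel. (\<lambda>j. side e (X j) x * \<rho> x) \<longlonglongrightarrow> s x * \<rho> x"
      using lim by eventually_elim (intro tendsto_intros)
    show "AE x in lborel. norm (side e (X j) x * \<rho> x) \<le> \<bar>\<rho> x\<bar>" for j
    proof (rule AE_I2)
      fix x show "norm (side e (X j) x * \<rho> x) \<le> \<bar>\<rho> x\<bar>"
        using side_cases[of e "X j" x] by auto
    qed
    show "integrable lborel (\<lambda>x. \<bar>\<rho> x\<bar>)" using i by simp
  qed measurable
  have cont: "continuous_on UNIV \<phi>"
    unfolding continuous_on_sequentially comp_def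
  proof (intro allI ballI impI)
    fix X :: "nat \<Rightarrow> real" and t assume X: "(\<forall>n. X n \<in> UNIV) \<and> X \<longlonglongrightarrow> t"
    show "(\<lambda>n. \<phi> (X n)) \<longlonglongrightarrow> \<phi> t"
      unfolding \<phi>_def[of t]
    proof (rule conv)
      show "AE x in lborel. (\<lambda>j. side e (X j) x) \<longlonglongrightarrow> side e t x"
        using AE_not_hyperplane[OF e, of t]
      proof eventually_elim
        case (elim x)
        then show ?case unfolding side_def using X by (intro tendsto_sgn tendsto_diff tendsto_const) auto
      qed
    qed measurable
  qed
  have "(\<lambda>j. \<phi> (real j)) \<longlonglongrightarrow> (\<integral>x. 1 * \<rho> x \<partial>lborel)"
  proof (rule conv)
    show "AE x in lborel. (\<lambda>j. side e (real j) x) \<longlonglongrightarrow> 1"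
    proof (rule AE_I2)
      fix x
      have "eventually (\<lambda>j. real j > e \<bullet> x) sequentially"
        using filterlim_real_sequentially by (simp add: filterlim_at_top_dense)
      then have "eventually (\<lambda>j. side e (real j) x = 1) sequentially"
        by eventually_elim (simp add: side_def)
      then show "(\<lambda>j. side e (real j) x) \<longlonglongrightarrow> 1" by (rule tendsto_eventually)
    qed
  qed measurable
  then have "eventually (\<lambda>j. \<phi> (real j) > 0) sequentially" using M by (intro order_tendstoD(1)) auto
  then obtain t1 where t1: "\<phi> t1 > 0" by (auto simp: eventually_sequentially)
  have "(\<lambda>j. \<phi> (- real j)) \<longlonglongrightarrow> (\<integral>x. (-1) * \<rho> x \<partial>lborel)"
  proof (rule conv)
    show "AE x in lborel. (\<lambda>j. side e (- real j) x) \<longlonglongrightarrow> -1"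
    proof (rule AE_I2)
      fix x
      have "eventually (\<lambda>j. real j > - (e \<bullet> x)) sequentially"
        using filterlim_real_sequentially by (simp add: filterlim_at_top_dense)
      then have "eventually (\<lambda>j. side e (- real j) x = -1) sequentially"
        by eventually_elim (simp add: side_def sgn_if)
      then show "(\<lambda>j. side e (- real j) x) \<longlonglongrightarrow> -1" by (rule tendsto_eventually)
    qed
  qed measurable
  then have "eventually (\<lambda>j. \<phi> (- real j) < 0) sequentially" using M by (intro order_tendstoD(2)) auto
  then obtain t2 where t2: "\<phi> t2 < 0" by (auto simp: eventually_sequentially)
  have "connected (\<phi> ` UNIV)" by (intro connected_continuous_image cont) auto
  then have "0 \<in> \<phi> ` UNIV" using t1 t2 connectedD_interval[of "\<phi> ` UNIV" "\<phi> t2" "\<phi> t1" 0] by auto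
  then obtain t where "\<phi> t = 0" by auto
  then show ?thesis using that by (simp add: \<phi>_def)
qed

context polytrope
begin

text \<open>Point symmetry about a exchanges the two sides of any plane through a, so each such
  plane bisects the mass and \<open>minimizer_mirror\<close> applies in every direction.\<close>

theorem minimizer_center:
  assumes m: "minimizer M \<rho>" and M: "M > 0"
  obtains a where "\<And>e. norm e = 1 \<Longrightarrow> AE x in lborel. \<rho> (mirror e (e \<bullet> a) x) = \<rho> x"
proof -
  have d: "dens \<rho>" and IM: "(\<integral>x. \<rho> x \<partial>lborel) = M" using m by (auto simp: minimizer_def)
  note [measurable] = dens_measurable[OF d]
  have "\<exists>t. (\<integral>x. side (axis i 1) t x * \<rho> x \<partial>lborel) = 0" for i
    using bisecting_plane[OF dens_integrable[OF d], of "axis i 1"] IM M by auto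
  then obtain t where t: "\<And>i. (\<integral>x. side (axis i 1) (t i) x * \<rho> x \<partial>lborel) = 0" by metis
  define a :: "real^3" where "a = (\<chi> i. t i)"
  have A: "AE x in lborel. \<rho> (mirror (axis i 1) (t i) x) = \<rho> x" for i
    by (rule minimizer_mirror[OF m _ t]) simp
  have L: "leb_preserving (mirror (axis i 1) (t i))" for i by (rule leb_preserving_mirror) simp
  \<comment> \<open>Reflections in three mutually orthogonal planes each flip one coordinate about
    a; their composition is the point reflection at a.\<close>
  have comp: "mirror (axis 1 1) (t 1) (mirror (axis 2 1) (t 2) (mirror (axis 3 1) (t 3) x)) = 2 *\<^sub>R a - x" for x
  proof -
    have "mirror (axis i 1) s y $ j = (if j = i then 2 * s - y $ i else y $ j)" for i j s y
      by (simp add: mirror_def inner_axis') (simp add: axis_def)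
    then show ?thesis by (simp add: vec_eq_iff forall_3 a_def)
  qed
  have sym: "AE x in lborel. \<rho> (2 *\<^sub>R a - x) = \<rho> x"
    using leb_preserving_AE[OF leb_preserving_comp[OF L[of 2] L[of 3]] A[of 1]]
      leb_preserving_AE[OF L[of 3] A[of 2]] A[of 3]
    by eventually_elim (simp add: comp)
  have T: "leb_preserving (\<lambda>x. 2 *\<^sub>R a - x)" by (rule leb_preserving_minus)
  show ?thesis
  proof (rule that)
    fix e :: "real^3" assume e: "norm e = 1"
    have "(\<integral>x. side e (e \<bullet> a) x * \<rho> x \<partial>lborel) = (\<integral>x. side e (e \<bullet> a) (2 *\<^sub>R a - x) * \<rho> (2 *\<^sub>R a - x) \<partial>lborel)"
      by (rule leb_preserving_integral[OF T, of "\<lambda>x. side e (e \<bullet> a) x * \<rho> x", symmetric]) measurable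
    also have "\<dots> = (\<integral>x. - (side e (e \<bullet> a) x * \<rho> x) \<partial>lborel)"
    proof (rule integral_cong_AE)
      have "e \<bullet> a - e \<bullet> (2 *\<^sub>R a - x) = - (e \<bullet> a - e \<bullet> x)" for x by (simp add: inner_diff_right)
      then have "side e (e \<bullet> a) (2 *\<^sub>R a - x) = - side e (e \<bullet> a) x" for x
        unfolding side_def by (simp only: sgn_minus)
      then show "AE x in lborel. side e (e \<bullet> a) (2 *\<^sub>R a - x) * \<rho> (2 *\<^sub>R a - x) = - (side e (e \<bullet> a) x * \<rho> x)"
        using sym by (auto elim!: eventually_mono)
    qed measurable
    also have "\<dots> = - (\<integral>x. side e (e \<bullet> a) x * \<rho> x \<partial>lborel)" by simp
    finally have "(\<integral>x. side e (e \<bullet> a) x * \<rho> x \<partial>lborel) = 0" by simp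
    then show "AE x in lborel. \<rho> (mirror e (e \<bullet> a) x) = \<rho> x" by (rule minimizer_mirror[OF m e])
  qed
qed

end

section \<open>Scaling and the Euler-Lagrange equation\<close>

lemma powr_add_le:
  fixes x y r :: real
  assumes "x \<ge> 0" "y \<ge> 0" "0 < r" "r \<le> 1"
  shows "(x + y) powr r \<le> x powr r + y powr r"
proof (cases "x + y = 0")
  case True
  then show ?thesis using assms by simp
next
  case False
  then have s: "x + y > 0" using assms by simp
  have u: "u \<le> u powr r" if "0 \<le> u" "u \<le> 1" for u :: real
    using that assms powr_mono'[of r 1 u] by simp
  have "1 = x / (x + y) + y / (x + y)" using s by (simp add: add_divide_distrib[symmetric])
  also have "\<dots> \<le> (x / (x + y)) powr r + (y / (x + y)) powr r"
    using s assms by (intro add_mono u) auto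
  also have "\<dots> = (x powr r + y powr r) / (x + y) powr r"
    using assms s by (simp add: powr_divide add_divide_distrib)
  finally show ?thesis using s by (simp add: le_divide_eq)
qed

text \<open>Hoelder continuity of the (q - 1)-th power, where q - 1 < 1. It gives a remainder
  estimate in the first variation that also holds where the density is zero, where a Lipschitz bound
  fails.\<close>

lemma powr_diff_le:
  fixes a b r :: real
  assumes "a \<ge> 0" "b \<ge> 0" "0 < r" "r \<le> 1"
  shows "\<bar>a powr r - b powr r\<bar> \<le> \<bar>a - b\<bar> powr r"
proof -
  have *: "\<bar>a powr r - b powr r\<bar> \<le> \<bar>a - b\<bar> powr r" if "0 \<le> b" "b \<le> a" for a b :: real
  proof -
    have "b powr r \<le> a powr r" using that assms by (intro powr_mono2) auto
    moreover have "a powr r \<le> b powr r + (a - b) powr r"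
      using powr_add_le[of b "a - b" r] that assms by simp
    ultimately show ?thesis using that by simp
  qed
  show ?thesis using *[of b a] *[of a b] assms by (cases "b \<le> a") (auto simp: abs_minus_commute)
qed

text \<open>Divide by s and let s tend to 0 from above: q > 1 removes the remainder, and the scaling
  factor contributes its derivative z * b at s = 0.\<close>

lemma first_variation_limit:
  fixes X C q J0 b z \<epsilon> :: real
  assumes "q > 1" "\<epsilon> > 0"
    and ineq: "\<And>s. 0 < s \<Longrightarrow> s < \<epsilon> \<Longrightarrow> 0 \<le> s * X + C * s powr q - J0 * ((1 + s * b) powr z - 1)"
  shows "0 \<le> X - J0 * (z * b)"
proof (rule tendsto_lowerbound)
  have D: "((\<lambda>s. (1 + s * b) powr z) has_real_derivative z * b) (at 0)"
    by (auto intro!: derivative_eq_intros)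
  then have 1: "((\<lambda>s. ((1 + s * b) powr z - 1) / s) \<longlongrightarrow> z * b) (at_right 0)"
    unfolding has_field_derivative_iff by (auto intro: tendsto_mono[OF at_le])
  have 2: "((\<lambda>s. s powr (q - 1)) \<longlongrightarrow> 0 powr (q - 1)) (at_right (0::real))"
    using assms by (intro tendsto_powr2) (auto simp: eventually_at_right_less intro!: tendsto_ident_at eventually_at_rightI[of 0 1])
  have "((\<lambda>s. X + C * s powr (q - 1) - J0 * (((1 + s * b) powr z - 1) / s)) \<longlongrightarrow> X + C * 0 powr (q - 1) - J0 * (z * b)) (at_right 0)"
    by (intro tendsto_intros 1 2)
  then show "((\<lambda>s. X + C * s powr (q - 1) - J0 * (((1 + s * b) powr z - 1) / s)) \<longlongrightarrow> X - J0 * (z * b)) (at_right 0)"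
    by simp
  show "\<forall>\<^sub>F s in at_right 0. 0 \<le> X + C * s powr (q - 1) - J0 * (((1 + s * b) powr z - 1) / s)"
  proof (rule eventually_at_rightI[of 0 \<epsilon>])
    fix s assume "s \<in> {0<..<\<epsilon>}"
    then have s: "0 < s" "s < \<epsilon>" by auto
    have "s powr q = s * s powr (q - 1)" using s powr_mult_base[of s "q - 1"] by simp
    then have "s * X + C * s powr q - J0 * ((1 + s * b) powr z - 1)
       = s * (X + C * s powr (q - 1) - J0 * (((1 + s * b) powr z - 1) / s))"
      using s by (simp add: field_simps)
    with ineq[OF s] have "0 \<le> s * (X + C * s powr (q - 1) - J0 * (((1 + s * b) powr z - 1) / s))" by simp
    then show "0 \<le> X + C * s powr (q - 1) - J0 * (((1 + s * b) powr z - 1) / s)"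
      using s by (simp add: zero_le_mult_iff)
  qed (use assms in auto)
qed (simp add: trivial_limit_at_right_real)

section \<open>Potentials and sums of densities\<close>

definition pot :: "(real^3 \<Rightarrow> real) \<Rightarrow> real^3 \<Rightarrow> real" where
  "pot \<rho> x = (\<integral>y. \<rho> y / norm (x - y) \<partial>lborel)"

lemma pot_measurable:
  assumes [measurable]: "\<rho> \<in> borel_measurable borel"
  shows "pot \<rho> \<in> borel_measurable borel"
  unfolding pot_def by (rule lborel.borel_measurable_lebesgue_integral) (simp add: split_beta' lborel_prod)

lemma Dpot_pot:
  assumes i: "integrable lborel (pairK \<eta> \<rho>)"
  shows "integrable lborel (\<lambda>x. \<eta> x * pot \<rho> x)" "Dpot \<eta> \<rho> = (\<integral>x. \<eta> x * pot \<rho> x \<partial>lborel)"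
proof -
  have i': "integrable (lborel \<Otimes>\<^sub>M lborel) (pairK \<eta> \<rho>)" using i by (simp add: lborel_prod)
  have eq: "(\<integral>y. pairK \<eta> \<rho> (x, y) \<partial>lborel) = \<eta> x * pot \<rho> x" for x
    unfolding pairK_def pot_def by (simp flip: times_divide_eq_right)
  show "integrable lborel (\<lambda>x. \<eta> x * pot \<rho> x)"
    using lborel_pair.integrable_fst'[OF i'] by (simp add: eq)
  show "Dpot \<eta> \<rho> = (\<integral>x. \<eta> x * pot \<rho> x \<partial>lborel)"
    using lborel_pair.integral_fst'[OF i'] by (simp add: eq Dpot_def lborel_prod)
qed

lemma pairK_swap: "pairK \<rho> \<eta> (x, y) = pairK \<eta> \<rho> (y, x)"
  by (simp add: pairK_def norm_minus_commute mult.commute)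

lemma Dpot_commute:
  assumes [measurable]: "\<rho> \<in> borel_measurable borel" "\<eta> \<in> borel_measurable borel"
  shows "Dpot \<rho> \<eta> = Dpot \<eta> \<rho>"
proof -
  have "pairK \<rho> \<eta> \<in> borel_measurable (lborel \<Otimes>\<^sub>M lborel)" by (simp add: lborel_prod)
  from lborel_pair.integral_product_swap[OF this]
  have "(\<integral>z. pairK \<eta> \<rho> z \<partial>(lborel \<Otimes>\<^sub>M lborel)) = (\<integral>z. pairK \<rho> \<eta> z \<partial>(lborel \<Otimes>\<^sub>M lborel))"
    by (simp add: split_beta' pairK_swap)
  then show ?thesis by (simp add: Dpot_def lborel_prod)
qed

context polytrope
begin

lemma dens_bound:
  assumes d: "dens \<rho>" and [measurable]: "\<sigma> \<in> borel_measurable borel"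
    and "\<And>x. 0 \<le> \<sigma> x" "\<And>x. \<sigma> x \<le> C * \<rho> x"
  shows "dens \<sigma>"
proof -
  note [measurable] = dens_measurable[OF d]
  have i1: "integrable lborel (\<lambda>x. C * \<rho> x)" using dens_integrable[OF d] by simp
  have i2: "integrable lborel (\<lambda>x. \<bar>C\<bar> powr q * \<rho> x powr q)" using dens_integrable_powr[OF d] by simp
  have "integrable lborel \<sigma>"
    by (rule Bochner_Integration.integrable_bound[OF i1]) (use assms in \<open>auto intro!: AE_I2 order_trans[OF _ abs_ge_self]\<close>)
  moreover have "integrable lborel (\<lambda>x. \<sigma> x powr q)"
  proof (rule Bochner_Integration.integrable_bound[OF i2])
    show "AE x in lborel. norm (\<sigma> x powr q) \<le> norm (\<bar>C\<bar> powr q * \<rho> x powr q)"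
    proof (rule AE_I2)
      fix x
      have "\<sigma> x \<le> \<bar>C\<bar> * \<rho> x"
        using assms(4)[of x] dens_nonneg[OF d, of x] by (meson abs_ge_self mult_right_mono order_trans)
      then have "\<sigma> x powr q \<le> (\<bar>C\<bar> * \<rho> x) powr q" using assms(3) q_gt by (intro powr_mono2) auto
      also have "\<dots> = \<bar>C\<bar> powr q * \<rho> x powr q" using dens_nonneg[OF d] by (simp add: powr_mult)
      finally show "norm (\<sigma> x powr q) \<le> norm (\<bar>C\<bar> powr q * \<rho> x powr q)" by simp
    qed
  qed measurable
  ultimately show ?thesis using assms by (auto simp: dens_def)
qed

lemma dens_add:
  assumes d: "dens \<rho>" and d': "dens \<sigma>"
  shows "dens (\<lambda>x. \<rho> x + \<sigma> x)"
proof -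
  note [measurable] = dens_measurable[OF d] dens_measurable[OF d']
  have nn: "0 \<le> \<rho> x" "0 \<le> \<sigma> x" for x using dens_nonneg[OF d] dens_nonneg[OF d'] by auto
  have i: "integrable lborel (\<lambda>x. 2 powr q * (\<rho> x powr q + \<sigma> x powr q))"
    using dens_integrable_powr[OF d] dens_integrable_powr[OF d'] by auto
  have "integrable lborel (\<lambda>x. (\<rho> x + \<sigma> x) powr q)"
  proof (rule Bochner_Integration.integrable_bound[OF i])
    show "AE x in lborel. norm ((\<rho> x + \<sigma> x) powr q) \<le> norm (2 powr q * (\<rho> x powr q + \<sigma> x powr q))"
    proof (rule AE_I2)
      fix x
      have "(\<rho> x + \<sigma> x) powr q \<le> (2 * max (\<rho> x) (\<sigma> x)) powr q"
        using nn[of x] q_gt by (intro powr_mono2) auto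
      also have "\<dots> = 2 powr q * max (\<rho> x) (\<sigma> x) powr q"
        using nn[of x] by (simp add: powr_mult)
      also have "\<dots> \<le> 2 powr q * (\<rho> x powr q + \<sigma> x powr q)"
        by (intro mult_left_mono) (auto simp: max_def)
      finally show "norm ((\<rho> x + \<sigma> x) powr q) \<le> norm (2 powr q * (\<rho> x powr q + \<sigma> x powr q))" by simp
    qed
  qed measurable
  then show ?thesis using dens_integrable[OF d] dens_integrable[OF d'] nn by (auto simp: dens_def)
qed

lemma dens_pairK_integrable:
  assumes d: "dens \<rho>" and d': "dens \<sigma>"
  shows "integrable lborel (pairK \<rho> \<sigma>)"
proof -
  note [measurable] = dens_measurable[OF d] dens_measurable[OF d']
  have nn: "0 \<le> \<rho> x" "0 \<le> \<sigma> x" for x using dens_nonneg[OF d] dens_nonneg[OF d'] by auto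
  show ?thesis
  proof (rule Bochner_Integration.integrable_bound)
    show "integrable lborel (pairK (\<lambda>x. \<rho> x + \<sigma> x) (\<lambda>x. \<rho> x + \<sigma> x))"
      by (rule dens_pairK_bound(1)[OF dens_add[OF d d'] refl, of 1]) simp
    show "AE z in lborel. norm (pairK \<rho> \<sigma> z) \<le> norm (pairK (\<lambda>x. \<rho> x + \<sigma> x) (\<lambda>x. \<rho> x + \<sigma> x) z)"
    proof (rule AE_I2)
      fix z
      have "\<rho> (fst z) * \<sigma> (snd z) \<le> (\<rho> (fst z) + \<sigma> (fst z)) * (\<rho> (snd z) + \<sigma> (snd z))"
        using nn by (intro mult_mono) auto
      then show "norm (pairK \<rho> \<sigma> z) \<le> norm (pairK (\<lambda>x. \<rho> x + \<sigma> x) (\<lambda>x. \<rho> x + \<sigma> x) z)"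
        using nn by (simp add: pairK_def divide_right_mono abs_mult)
    qed
  qed measurable
qed

section \<open>Scaling in amplitude and length\<close>

lemma scaled_dens:
  assumes d: "dens \<rho>" and a: "a > 0" and b: "b > 0"
  defines "\<sigma> \<equiv> \<lambda>x. a * \<rho> (b *\<^sub>R x)"
  shows "dens \<sigma>" "(\<integral>x. \<sigma> x \<partial>lborel) = a / b ^ 3 * (\<integral>x. \<rho> x \<partial>lborel)"
    "J \<sigma> = c3 * (a powr q / b ^ 3 * (\<integral>x. \<rho> x powr q \<partial>lborel)) - kap * (a\<^sup>2 / b ^ 5 * Dpot \<rho> \<rho>)"
proof -
  note [measurable] = dens_measurable[OF d]
  have nn: "0 \<le> \<rho> x" for x by (rule dens_nonneg[OF d])
  have pw: "\<sigma> x powr q = a powr q * \<rho> (b *\<^sub>R x) powr q" for x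
    unfolding \<sigma>_def using nn a by (simp add: powr_mult)
  have i1: "integrable lborel (\<lambda>x. \<rho> (b *\<^sub>R x))"
    by (rule integrable_lborel_scale[OF dens_integrable[OF d] b])
  have i2: "integrable lborel (\<lambda>x. \<rho> (b *\<^sub>R x) powr q)"
    by (rule integrable_lborel_scale[OF dens_integrable_powr[OF d] b])
  show "dens \<sigma>" unfolding dens_def pw using i1 i2 nn a by (auto simp: \<sigma>_def)
  show "(\<integral>x. \<sigma> x \<partial>lborel) = a / b ^ 3 * (\<integral>x. \<rho> x \<partial>lborel)"
    unfolding \<sigma>_def using integral_lborel_scale[of \<rho> b] b by simp
  have q: "(\<integral>x. \<sigma> x powr q \<partial>lborel) = a powr q / b ^ 3 * (\<integral>x. \<rho> x powr q \<partial>lborel)"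
    unfolding pw using integral_lborel_scale[of "\<lambda>x. \<rho> x powr q" b] b by simp
  have "Dpot \<sigma> \<sigma> = a\<^sup>2 / b ^ 5 * Dpot \<rho> \<rho>"
  proof -
    have "pairK \<sigma> \<sigma> z = a\<^sup>2 * b * pairK \<rho> \<rho> (b *\<^sub>R z)" for z
    proof -
      have "norm (b *\<^sub>R fst z - b *\<^sub>R snd z) = b * norm (fst z - snd z)"
        using b by (simp add: scaleR_diff_right[symmetric])
      then show ?thesis unfolding pairK_def \<sigma>_def using b by (simp add: power2_eq_square field_simps)
    qed
    then have "Dpot \<sigma> \<sigma> = a\<^sup>2 * b * (\<integral>z. pairK \<rho> \<rho> (b *\<^sub>R z) \<partial>lborel)" by (simp add: Dpot_def)
    also have "\<dots> = a\<^sup>2 * b * (Dpot \<rho> \<rho> / b ^ 6)"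
      using integral_lborel_scale[of "pairK \<rho> \<rho>" b] b by (simp add: Dpot_def)
    also have "\<dots> = a\<^sup>2 / b ^ 5 * Dpot \<rho> \<rho>" using b by (simp add: field_simps eval_nat_numeral)
    finally show ?thesis .
  qed
  then show "J \<sigma> = c3 * (a powr q / b ^ 3 * (\<integral>x. \<rho> x powr q \<partial>lborel)) - kap * (a\<^sup>2 / b ^ 5 * Dpot \<rho> \<rho>)"
    unfolding J_def q by simp
qed

text \<open>For both terms of \<open>J\<close> to scale alike one needs a^q / b^3 = a^2 / b^5, hence
  a = b^(2 / (2 - q)). The mass is then multiplied by b^((3q - 4) / (2 - q)) and \<open>J\<close> by
  b^((5q - 6) / (2 - q)); \<open>zeta\<close> is the ratio of these exponents.\<close>

definition zeta :: real where "zeta = (5 * q - 6) / (3 * q - 4)"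

lemma zeta_pos: "zeta > 0" using q_gt by (simp add: zeta_def)

text \<open>Rescaled to mass M, \<sigma> becomes a competitor of the minimizer. The bound compares
  densities of arbitrary mass, so variations need not respect the mass constraint.\<close>

lemma J_scaling_bound:
  assumes m: "minimizer M \<rho>" and M: "M > 0" and d: "dens \<sigma>" and s: "(\<integral>x. \<sigma> x \<partial>lborel) = \<mu>" "\<mu> > 0"
  shows "J \<rho> * (\<mu> / M) powr zeta \<le> J \<sigma>"
proof -
  \<comment> \<open>The exponents make both terms of \<open>J\<close> scale by the same factor \<open>r\<close>.\<close>
  define b where "b = (M / \<mu>) powr ((2 - q) / (3 * q - 4))"
  define a where "a = b powr (2 / (2 - q))"
  have b: "b > 0" and a: "a > 0" using M s by (auto simp: a_def b_def)
  have nz: "2 - q \<noteq> 0" "3 * q - 4 \<noteq> 0" using q_gt q_less by auto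
  define r where "r = b powr ((5 * q - 6) / (2 - q))"
  have e1: "a / b ^ 3 = M / \<mu>"
  proof -
    have "a / b ^ 3 = b powr (2 / (2 - q) - 3)" using b by (simp add: a_def powr_diff powr_numeral)
    also have "2 / (2 - q) - 3 = (3 * q - 4) / (2 - q)" using nz by (simp add: field_simps)
    also have "b powr \<dots> = M / \<mu>" unfolding b_def powr_powr using nz M s by simp
    finally show ?thesis .
  qed
  have e2: "a powr q / b ^ 3 = r"
  proof -
    have "a powr q / b ^ 3 = b powr (2 / (2 - q) * q - 3)" using b by (simp add: a_def powr_powr powr_diff powr_numeral)
    also have "2 / (2 - q) * q - 3 = (5 * q - 6) / (2 - q)" using nz by (simp add: field_simps)
    finally show ?thesis by (simp add: r_def)
  qed
  have e3: "a\<^sup>2 / b ^ 5 = r"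
  proof -
    have "a\<^sup>2 = a powr 2" using a by (simp add: powr_numeral)
    then have "a\<^sup>2 = b powr (2 / (2 - q) * 2)" by (simp only: a_def powr_powr)
    then have "a\<^sup>2 / b ^ 5 = b powr (2 / (2 - q) * 2 - 5)" using b by (simp add: powr_diff powr_numeral)
    also have "2 / (2 - q) * 2 - 5 = (5 * q - 6) / (2 - q)" using nz by (simp add: field_simps)
    finally show ?thesis by (simp add: r_def)
  qed
  have r: "r = (M / \<mu>) powr zeta"
    unfolding r_def b_def powr_powr zeta_def using nz by simp
  have rp: "r > 0" using b by (simp add: r_def)
  note sc = scaled_dens[OF d a b]
  have "J \<rho> \<le> J (\<lambda>x. a * \<sigma> (b *\<^sub>R x))"
    using m sc(1,2) s by (auto simp: minimizer_def e1)
  also have "\<dots> = r * J \<sigma>" unfolding sc(3) e2 e3 by (simp add: J_def algebra_simps)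
  finally have "J \<rho> / r \<le> J \<sigma>" using rp by (simp add: divide_le_eq mult.commute)
  moreover have "1 / r = (\<mu> / M) powr zeta" unfolding r using M s by (simp add: powr_divide)
  ultimately show ?thesis by (metis divide_inverse inverse_eq_divide)
qed

lemma Dpot_pos:
  assumes d: "dens \<rho>" and M: "(\<integral>x. \<rho> x \<partial>lborel) > 0"
  shows "Dpot \<rho> \<rho> > 0"
proof (rule ccontr)
  note [measurable] = dens_measurable[OF d]
  have nn: "0 \<le> \<rho> x" for x by (rule dens_nonneg[OF d])
  assume "\<not> Dpot \<rho> \<rho> > 0"
  moreover have "Dpot \<rho> \<rho> \<ge> 0" unfolding Dpot_def pairK_def using nn by (intro Bochner_Integration.integral_nonneg) auto
  ultimately have "(\<integral>z. pairK \<rho> \<rho> z \<partial>lborel) = 0" by (simp add: Dpot_def)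
  moreover have "AE z in lborel. 0 \<le> pairK \<rho> \<rho> z" using nn by (simp add: pairK_def)
  ultimately have "AE z in lborel. pairK \<rho> \<rho> z = 0"
    using integral_nonneg_eq_0_iff_AE[OF dens_pairK_integrable[OF d d]] by simp
  then have ae: "AE z in (lborel :: phase measure). \<rho> (fst z) * \<rho> (snd z) = 0"
    using AE_fst_neq_snd by eventually_elim (auto simp: pairK_def)
  have "(\<integral>\<^sup>+z. ennreal (\<rho> (fst z) * \<rho> (snd z)) \<partial>(lborel :: phase measure)) = (\<integral>\<^sup>+x. ennreal (\<rho> x) \<partial>lborel) * (\<integral>\<^sup>+x. ennreal (\<rho> x) \<partial>lborel)"
    using nn by (subst nn_integral_phase) (auto simp: ennreal_mult nn_integral_cmult nn_integral_multc)
  moreover have "(\<integral>\<^sup>+z. ennreal (\<rho> (fst z) * \<rho> (snd z)) \<partial>(lborel :: phase measure)) = (\<integral>\<^sup>+z. 0 \<partial>(lborel :: phase measure))"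
    by (rule nn_integral_cong_AE) (use ae in \<open>auto elim!: eventually_mono\<close>)
  ultimately have "(\<integral>\<^sup>+x. ennreal (\<rho> x) \<partial>lborel) = 0" by simp
  then show False using nn_integral_eq_integral[OF dens_integrable[OF d]] nn M by simp
qed

text \<open>Mass-preserving dilations: the rho^q term scales like b^(3q - 3), the Coulomb term like
  b. As 3q - 3 > 1, the negative term wins for small b.\<close>

lemma J_minimizer_neg:
  assumes m: "minimizer M \<rho>" and M: "M > 0"
  shows "J \<rho> < 0"
proof -
  have d: "dens \<rho>" and IM: "(\<integral>x. \<rho> x \<partial>lborel) = M" using m by (auto simp: minimizer_def)
  define A where "A = c3 * (\<integral>x. \<rho> x powr q \<partial>lborel)"
  define D where "D = kap * Dpot \<rho> \<rho>"
  have A: "A \<ge> 0" unfolding A_def using c3_pos by (intro mult_nonneg_nonneg Bochner_Integration.integral_nonneg) auto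
  have D: "D > 0" unfolding D_def using kap_pos Dpot_pos[OF d] IM M by simp
  \<comment> \<open>Makes b^(3q - 4) = D / (A + 1), so the dilated energy is b * (D * A / (A + 1) -
    D) < 0; the added 1 covers A = 0.\<close>
  define b where "b = (D / (A + 1)) powr (1 / (3 * q - 4))"
  have b: "b > 0" using A D by (simp add: b_def)
  have bq: "b powr (3 * q - 4) = D / (A + 1)" using q_gt A D by (simp add: b_def powr_powr)
  have b3: "b ^ 3 > 0" using b by simp
  note sc = scaled_dens[OF d b3 b]
  have "J \<rho> \<le> J (\<lambda>x. b ^ 3 * \<rho> (b *\<^sub>R x))"
    using m sc(1,2) b IM by (auto simp: minimizer_def)
  also have "\<dots> = (b ^ 3) powr q / b ^ 3 * A - (b ^ 3)\<^sup>2 / b ^ 5 * D" unfolding sc(3) A_def D_def by (simp only: mult_ac)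
  also have "(b ^ 3)\<^sup>2 / b ^ 5 = b" using b by (simp add: eval_nat_numeral)
  also have "(b ^ 3) powr q / b ^ 3 = b * b powr (3 * q - 4)"
  proof -
    have "(b ^ 3) powr q / b ^ 3 = b powr (3 * q) / b powr 3"
      using b by (simp add: powr_powr[symmetric] powr_numeral)
    also have "\<dots> = b powr (1 + (3 * q - 4))" by (simp add: powr_diff[symmetric])
    also have "\<dots> = b * b powr (3 * q - 4)" using b by (simp only: powr_add) simp
    finally show ?thesis .
  qed
  also have "b * b powr (3 * q - 4) * A - b * D = b * (D / (A + 1) * A - D)"
    unfolding bq by (simp add: algebra_simps)
  also have "\<dots> < 0"
  proof -
    have "D / (A + 1) * A < D" using A D by (simp add: field_simps)
    then show ?thesis using b by (simp add: mult_pos_neg)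
  qed
  finally show ?thesis .
qed

text \<open>Minus the derivative at mass M of the lower bound in \<open>J_scaling_bound\<close>. It
  involves the minimizer only through its energy, which all minimizers share.\<close>

definition elev :: "real \<Rightarrow> (real^3 \<Rightarrow> real) \<Rightarrow> real" where
  "elev M \<rho> = - (zeta * J \<rho> / M)"

text \<open>Adds (\<eta> = 1) or removes (\<eta> = -1) a small multiple of the indicator of B;
  removal requires \<rho> to be at least \<epsilon> on B. The change of mass is paid for by
  \<open>J_scaling_bound\<close>, whose derivative supplies the multiplier term.\<close>

lemma first_variation:
  fixes B :: "(real^3) set"
  assumes m: "minimizer M \<rho>" and M: "M > 0"
    and B[measurable]: "B \<in> sets borel" and fB: "emeasure lborel B < \<infinity>"
    and N: "\<And>x. x \<in> B \<Longrightarrow> \<rho> x \<le> N" and \<eta>: "\<bar>\<eta>\<bar> = 1" and \<epsilon>: "\<epsilon> > 0"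
    and ad: "\<And>x. x \<in> B \<Longrightarrow> \<eta> = 1 \<or> \<rho> x \<ge> \<epsilon>"
  shows "integrable lborel (\<lambda>x. indicator B x * \<rho> x powr (q - 1))"
    "integrable lborel (\<lambda>x. indicator B x * pot \<rho> x)"
    "0 \<le> \<eta> * (c3 * q * (\<integral>x. indicator B x * \<rho> x powr (q - 1) \<partial>lborel)
       - 2 * kap * (\<integral>x. indicator B x * pot \<rho> x \<partial>lborel) + elev M \<rho> * measure lborel B)"
proof -
  have d: "dens \<rho>" and IM: "(\<integral>x. \<rho> x \<partial>lborel) = M" using m by (auto simp: minimizer_def)
  note [measurable] = dens_measurable[OF d]
  have nn: "0 \<le> \<rho> x" for x by (rule dens_nonneg[OF d])
  define h where "h = (indicator B :: real^3 \<Rightarrow> real)"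
  have [measurable]: "h \<in> borel_measurable borel" by (simp add: h_def)
  have dh: "dens h" unfolding h_def by (rule dens_indicator[OF B fB])
  have h0: "0 \<le> h x" for x by (simp add: h_def)
  define b where "b = measure lborel B"
  have b0: "b \<ge> 0" by (simp add: b_def)
  have Ih: "(\<integral>x. h x \<partial>lborel) = b" by (simp add: h_def b_def)
  have ih: "integrable lborel h" by (rule dens_integrable[OF dh])
  have i1: "integrable lborel (\<lambda>x. h x * \<rho> x powr (q - 1))"
  proof (rule Bochner_Integration.integrable_bound)
    show "integrable lborel (\<lambda>x. \<bar>N\<bar> powr (q - 1) * h x)" using ih by simp
    show "AE x in lborel. norm (h x * \<rho> x powr (q - 1)) \<le> norm (\<bar>N\<bar> powr (q - 1) * h x)"
    proof (rule AE_I2)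
      fix x
      have "\<rho> x powr (q - 1) \<le> \<bar>N\<bar> powr (q - 1)" if "x \<in> B"
        using N[OF that] nn[of x] q_gt by (intro powr_mono2) auto
      then show "norm (h x * \<rho> x powr (q - 1)) \<le> norm (\<bar>N\<bar> powr (q - 1) * h x)"
        by (auto simp: h_def split: split_indicator)
    qed
  qed measurable
  have ip: "integrable lborel (pairK h \<rho>)" by (rule dens_pairK_integrable[OF dh d])
  have ip': "integrable lborel (pairK \<rho> h)" by (rule dens_pairK_integrable[OF d dh])
  have i\<rho>: "integrable lborel (pairK \<rho> \<rho>)" by (rule dens_pairK_integrable[OF d d])
  have ihh: "integrable lborel (pairK h h)" by (rule dens_pairK_integrable[OF dh dh])
  show "integrable lborel (\<lambda>x. indicator B x * \<rho> x powr (q - 1))" using i1 by (simp add: h_def)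
  show "integrable lborel (\<lambda>x. indicator B x * pot \<rho> x)" using Dpot_pot(1)[OF ip] by (simp add: h_def)
  define A1 where "A1 = (\<integral>x. h x * \<rho> x powr (q - 1) \<partial>lborel)"
  define A2 where "A2 = (\<integral>x. h x * pot \<rho> x \<partial>lborel)"
  have D2: "Dpot h \<rho> = A2" using Dpot_pot(2)[OF ip] by (simp add: A2_def)
  have D2': "Dpot \<rho> h = A2" using Dpot_commute[of \<rho> h] D2 by simp
  have Dh: "Dpot h h \<ge> 0" unfolding Dpot_def pairK_def using h0 by (intro Bochner_Integration.integral_nonneg) auto
  have "0 \<le> \<eta> * (c3 * q * A1 - 2 * kap * A2) - J \<rho> * (zeta * (\<eta> * b / M))"
  \<comment> \<open>s < \<epsilon> keeps the varied density nonnegative and s < M / (b + 1) keeps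
    its mass positive; the added 1 covers b = 0.\<close>
  proof (rule first_variation_limit[of q "min \<epsilon> (M / (b + 1))" _ "c3 * q * b"])
    show "q > 1" using q_gt by simp
    show "min \<epsilon> (M / (b + 1)) > 0" using \<epsilon> M b0 by simp
    fix s assume s: "0 < s" "s < min \<epsilon> (M / (b + 1))"
    define \<sigma> where "\<sigma> x = \<rho> x + \<eta> * s * h x" for x
    have \<eta>c: "\<eta> = 1 \<or> \<eta> = -1" using \<eta> by linarith
    have [measurable]: "\<sigma> \<in> borel_measurable borel" unfolding \<sigma>_def by measurable
    have \<sigma>0: "0 \<le> \<sigma> x" for x
    proof (cases "x \<in> B")
      case True
      then show ?thesis using ad[OF True] nn[of x] s \<eta>c by (auto simp: \<sigma>_def h_def)
    qed (use nn in \<open>simp add: \<sigma>_def h_def\<close>)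
    have ds: "dens \<sigma>"
    proof (rule dens_bound[OF dens_add[OF d dh], of _ "1 + s"])
      fix x
      have "\<eta> * s * h x \<le> s * h x" using \<eta>c s h0[of x] by auto
      moreover have "0 \<le> h x + s * \<rho> x" using s h0 nn by simp
      ultimately show "\<sigma> x \<le> (1 + s) * (\<rho> x + h x)" unfolding \<sigma>_def by (simp add: algebra_simps)
    qed (use \<sigma>0 in auto)
    have mass: "(\<integral>x. \<sigma> x \<partial>lborel) = M + \<eta> * s * b"
      unfolding \<sigma>_def using dens_integrable[OF d] ih IM Ih by simp
    have mpos: "M + \<eta> * s * b > 0"
    proof -
      have "s * b \<le> s * (b + 1)" using s by simp
      also have "\<dots> < M" using s b0 by (simp add: less_divide_eq)
      finally show ?thesis using \<eta>c M s b0 by (auto simp: add_pos_nonneg)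
    qed
    have Ds: "Dpot \<sigma> \<sigma> = Dpot \<rho> \<rho> + 2 * \<eta> * s * A2 + s * s * Dpot h h"
    proof -
      have ee: "\<eta> * \<eta> = 1" using \<eta>c by auto
      have "pairK \<sigma> \<sigma> z = pairK \<rho> \<rho> z + \<eta> * s * pairK \<rho> h z + \<eta> * s * pairK h \<rho> z + (\<eta> * \<eta>) * (s * s) * pairK h h z" for z
        unfolding pairK_def \<sigma>_def by (simp add: algebra_simps add_divide_distrib)
      then have "Dpot \<sigma> \<sigma> = (\<integral>z. pairK \<rho> \<rho> z + \<eta> * s * pairK \<rho> h z + \<eta> * s * pairK h \<rho> z + s * s * pairK h h z \<partial>lborel)"
        unfolding Dpot_def by (intro Bochner_Integration.integral_cong) (simp_all add: ee)
      also have "\<dots> = Dpot \<rho> \<rho> + \<eta> * s * Dpot \<rho> h + \<eta> * s * Dpot h \<rho> + s * s * Dpot h h"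
        unfolding Dpot_def using ip ip' i\<rho> ihh by simp
      finally show ?thesis using D2 D2' by simp
    qed
    \<comment> \<open>Convexity with the tangent at the varied density bounds the increment from
      above; replacing \<sigma> by \<rho> in the slope costs at most s^(q - 1), by
      \<open>powr_diff_le\<close>.\<close>
    have pq: "\<sigma> x powr q \<le> \<rho> x powr q + (\<eta> * s * q * (h x * \<rho> x powr (q - 1)) + q * s powr q * h x)" for x
    proof (cases "x \<in> B")
      case True
      then have sx: "\<sigma> x = \<rho> x + \<eta> * s" by (simp add: \<sigma>_def h_def)
      have q1: "q > 1" using q_gt by simp
      have "\<sigma> x powr q \<le> \<rho> x powr q + q * \<sigma> x powr (q - 1) * (\<eta> * s)"
        using powr_ge_tangent[OF q1 \<sigma>0[of x] nn[of x]] by (simp add: sx algebra_simps)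
      moreover have "q * \<sigma> x powr (q - 1) * (\<eta> * s) \<le> q * (\<eta> * s * \<rho> x powr (q - 1)) + q * s powr q"
      proof -
        have "\<bar>\<sigma> x powr (q - 1) - \<rho> x powr (q - 1)\<bar> \<le> \<bar>\<sigma> x - \<rho> x\<bar> powr (q - 1)"
          using \<sigma>0 nn q_gt q_less by (intro powr_diff_le) auto
        also have "\<bar>\<sigma> x - \<rho> x\<bar> = s" using \<eta> s by (simp add: sx abs_mult)
        finally have "s * \<bar>\<sigma> x powr (q - 1) - \<rho> x powr (q - 1)\<bar> \<le> s * s powr (q - 1)"
          using s by (intro mult_left_mono) auto
        moreover have "s * s powr (q - 1) = s powr q" using s powr_mult_base[of s "q - 1"] by simp
        moreover have "\<eta> * s * (\<sigma> x powr (q - 1) - \<rho> x powr (q - 1)) \<le> s * \<bar>\<sigma> x powr (q - 1) - \<rho> x powr (q - 1)\<bar>"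
        proof -
          have "\<eta> * s * y \<le> s * \<bar>y\<bar>" for y using \<eta>c s
            by (auto intro: mult_left_mono)
          then show ?thesis .
        qed
        ultimately have "\<eta> * s * (\<sigma> x powr (q - 1) - \<rho> x powr (q - 1)) \<le> s powr q" by linarith
        then have "q * (\<eta> * s * (\<sigma> x powr (q - 1) - \<rho> x powr (q - 1))) \<le> q * s powr q"
          using q_gt by (intro mult_left_mono) auto
        then show ?thesis by (simp add: algebra_simps)
      qed
      ultimately show ?thesis using True by (simp add: h_def algebra_simps)
    next
      case False
      then show ?thesis by (simp add: \<sigma>_def h_def)
    qed
    have Iq: "(\<integral>x. \<sigma> x powr q \<partial>lborel) \<le> (\<integral>x. \<rho> x powr q \<partial>lborel) + (\<eta> * s * q * A1 + q * s powr q * b)"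
    proof -
      have "(\<integral>x. \<sigma> x powr q \<partial>lborel) \<le> (\<integral>x. \<rho> x powr q + (\<eta> * s * q * (h x * \<rho> x powr (q - 1)) + q * s powr q * h x) \<partial>lborel)"
        using dens_integrable_powr[OF ds] dens_integrable_powr[OF d] i1 ih pq
        by (intro integral_mono) auto
      also have "\<dots> = (\<integral>x. \<rho> x powr q \<partial>lborel) + (\<eta> * s * q * A1 + q * s powr q * b)"
        using dens_integrable_powr[OF d] i1 ih by (simp add: A1_def Ih)
      finally show ?thesis .
    qed
    have "J \<rho> * ((M + \<eta> * s * b) / M) powr zeta \<le> J \<sigma>"
      by (rule J_scaling_bound[OF m M ds mass mpos])
    also have "(M + \<eta> * s * b) / M = 1 + s * (\<eta> * b / M)" using M by (simp add: field_simps)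
    also have "J \<sigma> \<le> J \<rho> + c3 * (\<eta> * s * q * A1 + q * s powr q * b) - kap * (2 * \<eta> * s * A2)"
    proof -
      have "c3 * (\<integral>x. \<sigma> x powr q \<partial>lborel) \<le> c3 * ((\<integral>x. \<rho> x powr q \<partial>lborel) + (\<eta> * s * q * A1 + q * s powr q * b))"
        using Iq c3_pos by (intro mult_left_mono) auto
      \<comment> \<open>The quadratic Coulomb term enters \<open>J\<close> with a negative sign, so
        dropping it preserves the upper bound.\<close>
      moreover have "0 \<le> kap * (s * s * Dpot h h)" using kap_pos s Dh by simp
      ultimately show ?thesis unfolding J_def Ds by (simp add: algebra_simps)
    qed
    finally show "0 \<le> s * (\<eta> * (c3 * q * A1 - 2 * kap * A2)) + c3 * q * b * s powr q - J \<rho> * ((1 + s * (\<eta> * b / M)) powr zeta - 1)"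
      by (simp add: algebra_simps)
  qed
  then show "0 \<le> \<eta> * (c3 * q * (\<integral>x. indicator B x * \<rho> x powr (q - 1) \<partial>lborel)
       - 2 * kap * (\<integral>x. indicator B x * pot \<rho> x \<partial>lborel) + elev M \<rho> * measure lborel B)"
    unfolding A1_def A2_def h_def b_def elev_def by (simp add: algebra_simps)
qed

text \<open>G is the pointwise first variation. Testing with sets where \<eta> * G is negative shows
  that they are null: adding mass gives G >= 0 everywhere, removing it gives G <= 0 where \<rho> is
  positive. Solving for \<rho> uses (q - 1) * n = 1; countably many bounded sets exhaust the
  exceptional sets.\<close>

lemma euler_lagrange:
  assumes m: "minimizer M \<rho>" and M: "M > 0"
  shows "AE x in lborel. \<rho> x = (max 0 (2 * kap * pot \<rho> x - elev M \<rho>) / (c3 * q)) powr n"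
proof -
  have d: "dens \<rho>" using m by (simp add: minimizer_def)
  note [measurable] = dens_measurable[OF d]
  have [measurable]: "pot \<rho> \<in> borel_measurable borel" by (rule pot_measurable) measurable
  have nn: "0 \<le> \<rho> x" for x by (rule dens_nonneg[OF d])
  define G where "G x = c3 * q * \<rho> x powr (q - 1) - 2 * kap * pot \<rho> x + elev M \<rho>" for x
  have [measurable]: "G \<in> borel_measurable borel" unfolding G_def by measurable
  have key: "emeasure lborel B = 0"
    if [measurable]: "B \<in> sets borel" and bd: "bounded B" and N: "\<And>x. x \<in> B \<Longrightarrow> \<rho> x \<le> N"
      and \<eta>: "\<bar>\<eta>\<bar> = 1" and \<epsilon>: "\<epsilon> > 0" and ad: "\<And>x. x \<in> B \<Longrightarrow> \<eta> = 1 \<or> \<rho> x \<ge> \<epsilon>"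
      and neg: "\<And>x. x \<in> B \<Longrightarrow> \<eta> * G x < 0"
    for B N \<eta> \<epsilon>
  proof -
    have fB: "emeasure lborel B < \<infinity>" by (rule emeasure_bounded_finite[OF bd])
    note fv = first_variation[OF m M that(1) fB N \<eta> \<epsilon> ad]
    have iB: "integrable lborel (indicator B :: real^3 \<Rightarrow> real)" using fB by simp
    have eq: "indicator B x * (\<eta> * G x) = \<eta> * (c3 * q * (indicator B x * \<rho> x powr (q - 1)) - 2 * kap * (indicator B x * pot \<rho> x)
        + elev M \<rho> * indicator B x)" for x
      by (simp add: G_def algebra_simps)
    have iG: "integrable lborel (\<lambda>x. indicator B x * (\<eta> * G x))"
      unfolding eq using fv(1,2) iB by (intro integrable_mult_right integrable_add integrable_diff) auto
    have "(\<integral>x. indicator B x * (\<eta> * G x) \<partial>lborel) \<ge> 0"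
      unfolding eq using fv(3) fv(1,2) iB by simp
    then have "(\<integral>x. - (indicator B x * (\<eta> * G x)) \<partial>lborel) \<le> 0" by simp
    moreover have nnG: "AE x in lborel. 0 \<le> - (indicator B x * (\<eta> * G x))"
      using neg by (intro AE_I2) (auto split: split_indicator intro: less_imp_le)
    moreover from nnG have "(\<integral>x. - (indicator B x * (\<eta> * G x)) \<partial>lborel) \<ge> 0" by (rule integral_nonneg_AE)
    ultimately have "(\<integral>x. - (indicator B x * (\<eta> * G x)) \<partial>lborel) = 0" by linarith
    then have "AE x in lborel. - (indicator B x * (\<eta> * G x)) = 0"
      using integral_nonneg_eq_0_iff_AE[of lborel "\<lambda>x. - (indicator B x * (\<eta> * G x))"] iG nnG by simp
    then have "AE x in lborel. x \<notin> B"
    proof eventually_elim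
      case (elim x)
      then show ?case using neg[of x] by (auto split: split_indicator)
    qed
    then show ?thesis by (subst (asm) AE_iff_measurable[of B]) auto
  qed
  have "AE x in lborel. 0 \<le> G x"
  proof -
    define B where "B j = {x. norm x \<le> real j \<and> \<rho> x \<le> real j \<and> G x < 0}" for j :: nat
    have [measurable]: "B j \<in> sets borel" for j unfolding B_def by measurable
    have "emeasure lborel (B j) = 0" for j
    proof (rule key[where \<eta> = 1 and \<epsilon> = 1 and N = "real j"])
      show "bounded (B j)" by (rule bounded_subset[of "cball 0 (real j)"]) (auto simp: B_def)
    qed (auto simp: B_def)
    then have "AE x in lborel. x \<notin> B j" for j by (intro AE_I[of _ _ "B j"]) auto
    then have "AE x in lborel. \<forall>j. x \<notin> B j" by (simp add: AE_all_countable)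
    then show ?thesis
    proof eventually_elim
      case (elim x)
      obtain j where "max (norm x) (\<rho> x) \<le> real j" using real_arch_simple by blast
      then show ?case using elim[rule_format, of j] by (auto simp: B_def)
    qed
  qed
  moreover have "AE x in lborel. \<rho> x > 0 \<longrightarrow> G x \<le> 0"
  proof -
    \<comment> \<open>The lower bound on \<rho> is the room that removing mass requires; letting j
      grow recovers all points with positive density.\<close>
    define B where "B j = {x. norm x \<le> real j \<and> \<rho> x \<le> real j \<and> 1 / (real j + 1) \<le> \<rho> x \<and> G x > 0}" for j :: nat
    have [measurable]: "B j \<in> sets borel" for j unfolding B_def by measurable
    have "emeasure lborel (B j) = 0" for j
    proof (rule key[where \<eta> = "-1" and \<epsilon> = "1 / (real j + 1)" and N = "real j"])
      show "bounded (B j)" by (rule bounded_subset[of "cball 0 (real j)"]) (auto simp: B_def)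
    qed (auto simp: B_def)
    then have "AE x in lborel. x \<notin> B j" for j by (intro AE_I[of _ _ "B j"]) auto
    then have "AE x in lborel. \<forall>j. x \<notin> B j" by (simp add: AE_all_countable)
    then show ?thesis
    proof eventually_elim
      case (elim x)
      show ?case
      proof
        assume pos: "\<rho> x > 0"
        obtain j where j: "max (max (norm x) (\<rho> x)) (1 / \<rho> x) \<le> real j" using real_arch_simple by blast
        have "1 / (real j + 1) \<le> \<rho> x"
        proof -
          have "1 / \<rho> x \<le> real j + 1" using j by simp
          then show ?thesis using pos by (simp add: field_simps)
        qed
        then show "G x \<le> 0" using elim[rule_format, of j] j by (auto simp: B_def)
      qed
    qed
  qed
  ultimately show ?thesis
  proof eventually_elim
    case (elim x)
    have c: "c3 * q > 0" using c3_pos q_gt by simp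
    have qn: "(q - 1) * n = 1" using n_gt by (simp add: q_def)
    show ?case
    proof (cases "\<rho> x > 0")
      case True
      then have "G x = 0" using elim by simp
      then have "2 * kap * pot \<rho> x - elev M \<rho> = c3 * q * \<rho> x powr (q - 1)" by (simp add: G_def)
      moreover have "c3 * q * \<rho> x powr (q - 1) \<ge> 0" using c by simp
      ultimately have "max 0 (2 * kap * pot \<rho> x - elev M \<rho>) / (c3 * q) = \<rho> x powr (q - 1)"
        using c c3_pos q_gt by (simp add: max_def)
      then show ?thesis using True qn by (simp add: powr_powr)
    next
      case False
      then have 0: "\<rho> x = 0" using nn[of x] by simp
      then have "2 * kap * pot \<rho> x - elev M \<rho> \<le> 0" using elim q_gt by (simp add: G_def)
      then show ?thesis using 0 n_gt by (simp add: max_def)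
    qed
  qed
qed

end

section \<open>Radial states\<close>

text \<open>The density is symmetric only almost everywhere, but its potential, being an integral,
  is symmetric at every point. This allows radial functions defined pointwise.\<close>

lemma pot_mirror:
  assumes [measurable]: "\<rho> \<in> borel_measurable borel" and e: "norm e = 1"
    and ae: "AE x in lborel. \<rho> (mirror e t x) = \<rho> x"
  shows "pot \<rho> (mirror e t x) = pot \<rho> x"
proof -
  have T: "leb_preserving (mirror e t)" by (rule leb_preserving_mirror[OF e])
  note [measurable] = leb_preserving_measurable[OF T]
  have "pot \<rho> (mirror e t x) = (\<integral>y. \<rho> (mirror e t y) / norm (mirror e t x - mirror e t y) \<partial>lborel)"
    unfolding pot_def
    by (rule leb_preserving_integral[OF T, of "\<lambda>y. \<rho> y / norm (mirror e t x - y)", symmetric]) measurable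
  also have "\<dots> = (\<integral>y. \<rho> y / norm (x - y) \<partial>lborel)"
    unfolding norm_mirror_mirror[OF e]
    by (rule integral_cong_AE) (measurable, use ae in \<open>auto elim!: eventually_mono\<close>)
  finally show ?thesis by (simp add: pot_def)
qed

text \<open>The perpendicular bisector plane of x and y passes through every point equidistant from
  them, in particular through a.\<close>

lemma mirror_to:
  fixes x y a :: "real^3"
  assumes "norm (x - a) = norm (y - a)" "x \<noteq> y"
  obtains e where "norm e = 1" "mirror e (e \<bullet> a) x = y"
proof -
  define d where "d = norm (x - y)"
  have d: "d > 0" using assms by (simp add: d_def)
  define e where "e = (1 / d) *\<^sub>R (x - y)"
  have e1: "norm e = 1" using d by (simp add: e_def d_def)
  define u v where "u = x - a" and "v = y - a"
  have uv: "u \<bullet> u = v \<bullet> v" using assms(1) by (simp add: u_def v_def norm_eq)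
  have xy: "x - y = u - v" by (simp add: u_def v_def)
  have dd: "d * d = 2 * ((u - v) \<bullet> u)"
  proof -
    have "d * d = (u - v) \<bullet> (u - v)" by (simp add: d_def xy power2_norm_eq_inner flip: power2_eq_square)
    then show ?thesis using uv by (simp add: inner_diff_left inner_diff_right inner_commute)
  qed
  have "mirror e (e \<bullet> a) x = x - (2 * (e \<bullet> u)) *\<^sub>R e" by (simp add: mirror_def u_def inner_diff_right)
  also have "\<dots> = x - (2 * ((u - v) \<bullet> u) / (d * d)) *\<^sub>R (u - v)" by (simp add: e_def xy)
  also have "\<dots> = x - (u - v)" using d by (simp add: dd[symmetric])
  also have "\<dots> = y" by (simp add: u_def v_def)
  finally show ?thesis using that e1 by blast
qed

lemma AE_phase_fst:
  assumes "AE x in (lborel :: 'a::euclidean_space measure). P x"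
  shows "AE z in (lborel :: ('a \<times> 'b::euclidean_space) measure). P (fst z)"
proof -
  obtain N where N: "{x \<in> space lborel. \<not> P x} \<subseteq> N" "emeasure lborel N = 0" "N \<in> sets (lborel :: 'a measure)"
    using assms by (auto elim: AE_E)
  show ?thesis
  proof (rule AE_I[of _ _ "N \<times> UNIV"])
    show "{z \<in> space lborel. \<not> P (fst z)} \<subseteq> N \<times> (UNIV :: 'b set)" using N(1) by auto
    show "N \<times> (UNIV :: 'b set) \<in> sets lborel" using N(3) by (simp add: borel_prod[symmetric])
    show "emeasure lborel (N \<times> (UNIV :: 'b set)) = 0"
      using N by (simp add: lborel_prod[symmetric] lborel.emeasure_pair_measure_Times)
  qed
qed

context polytrope
begin

definition response :: "real \<Rightarrow> real \<Rightarrow> real" where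
  "response E s = (max 0 (2 * kap * s - E) / (c3 * q)) powr n"

lemma response_measurable [measurable]: "response E \<in> borel_measurable borel"
  unfolding response_def by measurable

lemma response_nonneg: "0 \<le> response E s" by (simp add: response_def)

lemma response_zero: "2 * kap * s \<le> E \<Longrightarrow> response E s = 0"
  using n_gt by (simp add: response_def max_def)

text \<open>Since n > 1, the derivative of the n-th power stays bounded up to the cutoff at 0. The
  constant depends only on an upper bound U for the potential, which is M / r outside radius
  r.\<close>

lemma response_lipschitz:
  assumes E: "E \<ge> 0" and U: "U \<ge> 0"
  obtains L where "L \<ge> 0" "\<And>u v. u \<le> U \<Longrightarrow> v \<le> U \<Longrightarrow> \<bar>response E u - response E v\<bar> \<le> L * \<bar>u - v\<bar>"
proof -
  have c: "c3 * q > 0" using c3_pos q_gt by simp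
  define X where "X = 2 * kap * U / (c3 * q)"
  define L where "L = n * X powr (n - 1) * (2 * kap / (c3 * q))"
  have n1: "n > 1" using n_gt by simp
  have powr: "b powr n - a powr n \<le> n * X powr (n - 1) * (b - a)" if "0 \<le> a" "a \<le> b" "b \<le> X" for a b
  proof -
    have "b powr n + n * b powr (n - 1) * (a - b) \<le> a powr n"
      using that n1 by (intro powr_ge_tangent) auto
    then have "b powr n - a powr n \<le> n * b powr (n - 1) * (b - a)" by (simp add: algebra_simps)
    also have "\<dots> \<le> n * X powr (n - 1) * (b - a)"
      using that n1 by (intro mult_right_mono mult_left_mono powr_mono2) auto
    finally show ?thesis .
  qed
  define g where "g s = max 0 (2 * kap * s - E) / (c3 * q)" for s
  have gle: "\<bar>response E u - response E v\<bar> \<le> L * \<bar>u - v\<bar>" if "u \<le> v" "v \<le> U" for u v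
  proof -
    have g0: "0 \<le> g u" using c by (simp add: g_def)
    have kuv: "2 * kap * u \<le> 2 * kap * v" using that kap_pos by simp
    then have guv: "g u \<le> g v" unfolding g_def using c by (intro divide_right_mono) auto
    have "2 * kap * v \<le> 2 * kap * U" using that kap_pos by simp
    moreover have "0 \<le> 2 * kap * U" using kap_pos U by simp
    ultimately have "max 0 (2 * kap * v - E) \<le> 2 * kap * U" using E by simp
    then have gX: "g v \<le> X" unfolding g_def X_def using c by (intro divide_right_mono) auto
    have "g v - g u \<le> 2 * kap / (c3 * q) * (v - u)"
    proof -
      have "max 0 (2 * kap * v - E) - max 0 (2 * kap * u - E) \<le> 2 * kap * (v - u)"
        using kuv by (simp add: algebra_simps max_def)
      then have "(max 0 (2 * kap * v - E) - max 0 (2 * kap * u - E)) / (c3 * q) \<le> 2 * kap * (v - u) / (c3 * q)"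
        using c by (intro divide_right_mono) auto
      then show ?thesis by (simp add: g_def diff_divide_distrib)
    qed
    then have "n * X powr (n - 1) * (g v - g u) \<le> n * X powr (n - 1) * (2 * kap / (c3 * q) * (v - u))"
      using n1 by (intro mult_left_mono) auto
    then have "g v powr n - g u powr n \<le> L * (v - u)"
      using powr[OF g0 guv gX] by (simp add: L_def mult.assoc)
    moreover have "g u powr n \<le> g v powr n" using g0 guv n1 by (intro powr_mono2) auto
    ultimately show ?thesis using that by (simp add: response_def g_def)
  qed
  show ?thesis
  proof (rule that)
    show "L \<ge> 0" unfolding L_def using n1 kap_pos c by simp
    show "\<bar>response E u - response E v\<bar> \<le> L * \<bar>u - v\<bar>" if "u \<le> U" "v \<le> U" for u v
      using gle[of u v] gle[of v u] that by (cases "u \<le> v") (auto simp: abs_minus_commute)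
  qed
qed

text \<open>The Euler-Lagrange equation coupled with Newton's formula for the radial potential. Both
  hold at every relevant radius, not merely almost everywhere, and the formula for w is imposed only
  at positive radii.\<close>

definition radial_state :: "real \<Rightarrow> real \<Rightarrow> (real \<Rightarrow> real) \<Rightarrow> (real \<Rightarrow> real) \<Rightarrow> bool" where
  "radial_state M E \<sigma> w \<longleftrightarrow> \<sigma> \<in> borel_measurable borel
     \<and> integrable lborel (\<lambda>y::real^3. \<sigma> (norm y)) \<and> (\<integral>y. \<sigma> (norm y) \<partial>leb3) = M
     \<and> (\<forall>r>0. w r = (\<integral>y. \<sigma> (norm y) * min (1 / r) (1 / norm y) \<partial>leb3))
     \<and> (\<forall>r. \<sigma> r = response E (w r))"

lemma minimizer_radial_state:
  assumes m: "minimizer M \<rho>" and M: "M > 0"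
  obtains a \<sigma> w where "radial_state M (elev M \<rho>) \<sigma> w" "AE x in lborel. \<rho> x = \<sigma> (norm (x - a))"
proof -
  have d: "dens \<rho>" and IM: "(\<integral>x. \<rho> x \<partial>lborel) = M" using m by (auto simp: minimizer_def)
  note [measurable] = dens_measurable[OF d]
  obtain a where a: "\<And>e. norm e = 1 \<Longrightarrow> AE x in lborel. \<rho> (mirror e (e \<bullet> a) x) = \<rho> x"
    using minimizer_center[OF m M] by blast
  have rad: "pot \<rho> x = pot \<rho> y" if eq: "norm (x - a) = norm (y - a)" for x y
  proof (cases "x = y")
    case False
    obtain e where e: "norm e = 1" "mirror e (e \<bullet> a) x = y" using mirror_to[OF eq False] by blast
    show ?thesis using pot_mirror[OF _ e(1) a[OF e(1)], of x] e(2) by simp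
  qed simp
  have [measurable]: "pot \<rho> \<in> borel_measurable borel" by (rule pot_measurable) measurable
  \<comment> \<open>The potential is constant on spheres about a, so one ray determines it. Defining
    \<sigma> from w then makes the Euler-Lagrange equation an identity, while \<rho> agrees with
    \<sigma> almost everywhere.\<close>
  define w where "w r = pot \<rho> (a + r *\<^sub>R e1)" for r
  have [measurable]: "w \<in> borel_measurable borel" unfolding w_def by measurable
  have pw: "pot \<rho> x = w (norm (x - a))" for x unfolding w_def by (rule rad) simp
  define \<sigma> where "\<sigma> r = response (elev M \<rho>) (w r)" for r
  have [measurable]: "\<sigma> \<in> borel_measurable borel" unfolding \<sigma>_def by measurable
  have \<sigma>0: "0 \<le> \<sigma> r" for r by (simp add: \<sigma>_def response_nonneg)
  have ae: "AE x in lborel. \<rho> x = \<sigma> (norm (x - a))"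
    using euler_lagrange[OF m M] by (simp add: \<sigma>_def response_def pw)
  have T: "leb_preserving (\<lambda>x. a + x)" by (rule leb_preserving_plus)
  have ae': "AE y in lborel. \<rho> (a + y) = \<sigma> (norm y)"
    using leb_preserving_AE[OF T ae] by simp
  have i: "integrable lborel (\<lambda>y::real^3. \<sigma> (norm y))"
  proof (rule integrable_cong_AE_imp)
    show "integrable lborel (\<lambda>y. \<rho> (a + y))"
      using leb_preserving_integrable[OF T, of \<rho>] dens_integrable[OF d] by simp
    show "AE y in lborel. \<rho> (a + y) = \<sigma> (norm y)" by (rule ae')
  qed measurable
  have I: "(\<integral>y. \<sigma> (norm y) \<partial>leb3) = M"
  proof -
    have "(\<integral>y. \<sigma> (norm y) \<partial>leb3) = (\<integral>y. \<rho> (a + y) \<partial>lborel)"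
      by (rule integral_cong_AE) (measurable, use ae' in \<open>auto elim: eventually_mono\<close>)
    also have "\<dots> = M" using leb_preserving_integral[OF T, of \<rho>] IM by simp
    finally show ?thesis .
  qed
  have newton: "w r = (\<integral>y. \<sigma> (norm y) * min (1 / r) (1 / norm y) \<partial>leb3)" if r: "r > 0" for r
  proof -
    define x where "x = r *\<^sub>R e1"
    have nx: "norm x = r" "x \<noteq> 0" using r by (auto simp: x_def)
    have "w r = (\<integral>y. \<rho> y / norm ((a + x) - y) \<partial>lborel)" by (simp add: w_def pot_def x_def)
    also have "\<dots> = (\<integral>y. \<rho> (a + y) / norm ((a + x) - (a + y)) \<partial>lborel)"
      by (rule leb_preserving_integral[OF T, of "\<lambda>y. \<rho> y / norm ((a + x) - y)", symmetric]) measurable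
    also have "\<dots> = (\<integral>y. \<sigma> (norm y) * (1 / norm (x - y)) \<partial>lborel)"
      by (rule integral_cong_AE) (measurable, use ae' in \<open>auto elim!: eventually_mono\<close>)
    \<comment> \<open>For nonnegative functions this holds even if the integral is infinite, both
      sides then being 0; so Newton's theorem transfers without a prior proof that the potential is
      finite.\<close>
    also have "\<dots> = enn2real (\<integral>\<^sup>+y. ennreal (\<sigma> (norm y) * (1 / norm (x - y))) \<partial>lborel)"
      using \<sigma>0 by (intro integral_eq_nn_integral) auto
    also have "\<dots> = enn2real (\<integral>\<^sup>+y. ennreal (\<sigma> (norm y)) * ennreal (1 / norm (x - y)) \<partial>lborel)"
      using \<sigma>0 by (subst ennreal_mult) auto
    also have "\<dots> = enn2real (\<integral>\<^sup>+y. ennreal (\<sigma> (norm y)) * ennreal (min (1 / norm x) (1 / norm y)) \<partial>leb3)"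
      by (subst newton_shell[of "\<lambda>s. ennreal (\<sigma> s)"]) (use nx in auto)
    also have "\<dots> = enn2real (\<integral>\<^sup>+y. ennreal (\<sigma> (norm y) * min (1 / norm x) (1 / norm y)) \<partial>leb3)"
      using \<sigma>0 by (subst ennreal_mult) auto
    also have "\<dots> = (\<integral>y. \<sigma> (norm y) * min (1 / norm x) (1 / norm y) \<partial>leb3)"
      using \<sigma>0 by (intro integral_eq_nn_integral[symmetric]) auto
    finally show ?thesis by (simp add: nx)
  qed
  have "radial_state M (elev M \<rho>) \<sigma> w"
    unfolding radial_state_def using i I newton by (auto simp: \<sigma>_def)
  then show ?thesis using that ae by blast
qed

text \<open>Splitting min(1/r, 1/|y|) as 1/r minus the positive part of 1/r - 1/|y| makes the
  correction to M / r depend, up to the null set y = 0, only on the density outside radius r. This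
  allows the solution to be continued inwards.\<close>

lemma radial_state_facts:
  assumes st: "radial_state M E \<sigma> w" and r: "r > 0"
  shows "integrable lborel (\<lambda>y::real^3. \<sigma> (norm y) * max 0 (1 / r - 1 / norm y))"
    "w r = M / r - (\<integral>y. \<sigma> (norm y) * max 0 (1 / r - 1 / norm y) \<partial>leb3)"
    "0 \<le> w r" "w r \<le> M / r"
proof -
  have [measurable]: "\<sigma> \<in> borel_measurable borel" and i: "integrable lborel (\<lambda>y::real^3. \<sigma> (norm y))"
    and I: "(\<integral>y. \<sigma> (norm y) \<partial>leb3) = M"
    and w: "w r = (\<integral>y. \<sigma> (norm y) * min (1 / r) (1 / norm y) \<partial>leb3)"
    and \<sigma>: "\<And>s. \<sigma> s = response E (w s)"
    using st r by (auto simp: radial_state_def)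
  have \<sigma>0: "0 \<le> \<sigma> s" for s unfolding \<sigma> by (rule response_nonneg)
  show i2: "integrable lborel (\<lambda>y::real^3. \<sigma> (norm y) * max 0 (1 / r - 1 / norm y))"
  proof (rule Bochner_Integration.integrable_bound)
    show "integrable lborel (\<lambda>y::real^3. \<sigma> (norm y) * (1 / r))" using i by simp
    show "AE y in leb3. norm (\<sigma> (norm y) * max 0 (1 / r - 1 / norm y)) \<le> norm (\<sigma> (norm y) * (1 / r))"
    proof (rule AE_I2)
      fix y :: "real^3"
      have "0 \<le> 1 / norm y" "0 \<le> 1 / r" using r by simp_all
      then have "max 0 (1 / r - 1 / norm y) \<le> 1 / r" by linarith
      then have "\<sigma> (norm y) * max 0 (1 / r - 1 / norm y) \<le> \<sigma> (norm y) * (1 / r)"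
        using \<sigma>0 by (intro mult_left_mono) auto
      then show "norm (\<sigma> (norm y) * max 0 (1 / r - 1 / norm y)) \<le> norm (\<sigma> (norm y) * (1 / r))"
        using \<sigma>0[of "norm y"] r by (simp add: abs_mult)
    qed
  qed measurable
  have eq: "\<sigma> (norm y) * min (1 / r) (1 / norm y) = \<sigma> (norm y) * (1 / r) - \<sigma> (norm y) * max 0 (1 / r - 1 / norm y)" for y :: "real^3"
    by (simp add: min_def max_def algebra_simps)
  show wr: "w r = M / r - (\<integral>y. \<sigma> (norm y) * max 0 (1 / r - 1 / norm y) \<partial>leb3)"
  proof -
    have "w r = (\<integral>y. \<sigma> (norm y) * (1 / r) \<partial>leb3) - (\<integral>y. \<sigma> (norm y) * max 0 (1 / r - 1 / norm y) \<partial>leb3)"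
      unfolding w eq using i i2 by (intro Bochner_Integration.integral_diff) auto
    then show ?thesis using I by simp
  qed
  show "0 \<le> w r" unfolding w using \<sigma>0 r by (intro Bochner_Integration.integral_nonneg) (auto intro!: mult_nonneg_nonneg)
  have "0 \<le> (\<integral>y. \<sigma> (norm y) * max 0 (1 / r - 1 / norm y) \<partial>leb3)"
    using \<sigma>0 by (intro Bochner_Integration.integral_nonneg) auto
  then show "w r \<le> M / r" unfolding wr by simp
qed

text \<open>A Volterra contraction run inwards: if the densities agree beyond u, the difference of
  the potentials on a thin shell inside u is at most half its own supremum. The target radius r > 0
  is fixed in advance, so the potentials stay below M / r and one shell thickness serves for all
  steps.\<close>

lemma radial_state_unique:
  assumes st0: "radial_state M E \<sigma>0 w0" and st1: "radial_state M E \<sigma>1 w1" and M: "M > 0" and E: "E > 0" and r: "r > 0"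
  shows "\<sigma>0 r = \<sigma>1 r"
proof -
  have s0: "\<sigma>0 s = response E (w0 s)" and s1: "\<sigma>1 s = response E (w1 s)" for s
    using st0 st1 by (auto simp: radial_state_def)
  have [measurable]: "\<sigma>0 \<in> borel_measurable borel" "\<sigma>1 \<in> borel_measurable borel"
    using st0 st1 by (auto simp: radial_state_def)
  \<comment> \<open>Beyond this radius w <= M / s <= E / (2 * kap), so the response and both
    densities vanish.\<close>
  define R where "R = 2 * kap * M / E"
  have R: "R > 0" using kap_pos M E by (simp add: R_def)
  have out: "\<sigma>0 s = \<sigma>1 s" if "s \<ge> R" for s
  proof -
    have s: "s > 0" using that R by simp
    have "2 * kap * (M / s) \<le> E" using that s E by (simp add: R_def field_simps)
    moreover have "2 * kap * w0 s \<le> 2 * kap * (M / s)" "2 * kap * w1 s \<le> 2 * kap * (M / s)"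
      using radial_state_facts(4)[OF st0 s] radial_state_facts(4)[OF st1 s] kap_pos
      by (auto intro!: mult_left_mono simp del: times_divide_eq_right)
    ultimately show ?thesis unfolding s0 s1 by (simp add: response_zero)
  qed
  show ?thesis
  proof (cases "r \<ge> R")
    case True
    then show ?thesis by (rule out)
  next
    case False
    obtain L where L: "L \<ge> 0" "\<And>u v. u \<le> M / r \<Longrightarrow> v \<le> M / r \<Longrightarrow> \<bar>response E u - response E v\<bar> \<le> L * \<bar>u - v\<bar>"
      using response_lipschitz[of E "M / r"] E M r by auto
    \<comment> \<open>The contraction factor is at most Lipschitz constant times weight times shell
      volume, L * (1 / r) * (4 * pi * R^2 * h) = L / (2 * (L + 1)), which is at most 1/2; the added
      1 covers L = 0.\<close>
    define h where "h = r / (8 * pi * R\<^sup>2 * (L + 1))"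
    have h: "h > 0" using r R L by (simp add: h_def add_nonneg_pos)
    have step: "\<sigma>0 s = \<sigma>1 s" if hyp: "\<And>s. s \<ge> u \<Longrightarrow> \<sigma>0 s = \<sigma>1 s" and u: "r \<le> u" "u \<le> R"
      and s: "s \<ge> max r (u - h)" for u s
    proof (cases "s \<ge> u")
      case True
      then show ?thesis by (rule hyp)
    next
      case False
      define u' where "u' = max r (u - h)"
      have u': "u' \<le> u" "r \<le> u'" "u - u' \<le> h" using u h by (auto simp: u'_def)
      define D where "D = (SUP s\<in>{u'..u}. \<bar>w0 s - w1 s\<bar>)"
      have wb: "0 \<le> w0 s \<and> w0 s \<le> M / r \<and> 0 \<le> w1 s \<and> w1 s \<le> M / r" if "s \<ge> u'" for s
      proof -
        have sp: "s > 0" "r \<le> s" using that u' r by auto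
        have "M / s \<le> M / r" using sp r M by (intro divide_left_mono) auto
        then show ?thesis using radial_state_facts(3,4)[OF st0 sp(1)] radial_state_facts(3,4)[OF st1 sp(1)] by auto
      qed
      have bdd: "bdd_above ((\<lambda>s. \<bar>w0 s - w1 s\<bar>) ` {u'..u})"
      proof (rule bdd_aboveI2[of _ _ "M / r"])
        fix s assume "s \<in> {u'..u}"
        then show "\<bar>w0 s - w1 s\<bar> \<le> M / r" using wb[of s] by (auto simp: abs_le_iff)
      qed
      have Dup: "\<bar>w0 s - w1 s\<bar> \<le> D" if "s \<in> {u'..u}" for s
        unfolding D_def by (rule cSUP_upper[OF that bdd])
      have D0: "D \<ge> 0" using Dup[of u'] u' by auto
      define A where "A = ball (0::real^3) u - ball 0 u'"
      have [measurable]: "A \<in> sets borel" by (simp add: A_def)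
      have mA: "measure lborel A \<le> 4 * pi * R\<^sup>2 * h"
      proof -
        have "measure lborel A = measure lborel (ball (0::real^3) u) - measure lborel (ball (0::real^3) u')"
          unfolding A_def using u' r by (intro measure_Diff) (auto simp: emeasure_ball)
        also have "\<dots> = 4 / 3 * pi * (u ^ 3 - u' ^ 3)"
          using u' r u by (simp add: content_ball unit_ball_vol_3 algebra_simps power3_eq_cube)
        also have "u ^ 3 - u' ^ 3 \<le> 3 * R\<^sup>2 * h"
        proof -
          have "u ^ 3 - u' ^ 3 = (u - u') * (u * u + u * u' + u' * u')" by (simp add: algebra_simps power3_eq_cube)
          also have "\<dots> \<le> h * (R * R + R * R + R * R)"
            using u u' r h by (intro mult_mono add_mono) auto
          finally show ?thesis by (simp add: power2_eq_square algebra_simps)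
        qed
        finally show ?thesis by (simp add: mult_ac)
      qed
      have iA: "integrable lborel (indicator A :: real^3 \<Rightarrow> real)"
      proof -
        have "emeasure lborel A \<le> emeasure lborel (ball (0::real^3) u)" by (intro emeasure_mono) (auto simp: A_def)
        also have "\<dots> < \<infinity>" using u r by (simp add: emeasure_ball)
        finally show ?thesis by simp
      qed
      have est: "\<bar>w0 s - w1 s\<bar> \<le> D / 2" if s: "s \<in> {u'..u}" for s
      proof -
        have sp: "s > 0" "r \<le> s" using s u' r by auto
        note f0 = radial_state_facts[OF st0 sp(1)] and f1 = radial_state_facts[OF st1 sp(1)]
        define g where "g y = (\<sigma>1 (norm y) - \<sigma>0 (norm y)) * max 0 (1 / s - 1 / norm y)" for y :: "real^3"
        have [measurable]: "g \<in> borel_measurable borel" unfolding g_def by measurable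
        have ig: "integrable lborel g" unfolding g_def left_diff_distrib using f0(1) f1(1) by auto
        have "w0 s - w1 s = (\<integral>y. g y \<partial>lborel)"
          unfolding f0(2) f1(2) g_def left_diff_distrib using f0(1) f1(1) by simp
        then have "\<bar>w0 s - w1 s\<bar> \<le> (\<integral>y. \<bar>g y\<bar> \<partial>lborel)" using integral_abs_bound[of lborel g] by simp
        also have "\<dots> \<le> (\<integral>y. L * D / r * indicator A y \<partial>lborel)"
        proof (rule integral_mono_AE)
          show "integrable lborel (\<lambda>y. \<bar>g y\<bar>)" using ig by simp
          show "integrable lborel (\<lambda>y. L * D / r * indicator A y)" using iA by simp
          \<comment> \<open>At y = 0 the convention 1 / 0 = 0 would make the weight 1 / s instead of
            0.\<close>
          have "AE y in lborel. y \<noteq> (0::real^3)" by (rule AE_lborel_singleton)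
          then show "AE y in lborel. \<bar>g y\<bar> \<le> L * D / r * indicator A y"
          proof eventually_elim
            case (elim y)
            consider "norm y \<le> s" | "norm y \<ge> u" | "s < norm y" "norm y < u" by linarith
            then show ?case
            proof cases
              case 1
              then have "1 / s \<le> 1 / norm y" using elim by (intro divide_left_mono) (auto simp: sp)
              then show ?thesis using L D0 r by (simp add: g_def)
            next
              case 2
              then show ?thesis using hyp[OF 2] L D0 r by (simp add: g_def)
            next
              case 3
              then have yA: "y \<in> A" using s by (auto simp: A_def)
              have ny: "norm y \<in> {u'..u}" using 3 s by auto
              have "\<bar>\<sigma>1 (norm y) - \<sigma>0 (norm y)\<bar> \<le> L * \<bar>w1 (norm y) - w0 (norm y)\<bar>"
                unfolding s0 s1 using wb[of "norm y"] ny by (intro L(2)) auto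
              also have "\<dots> \<le> L * D" using Dup[OF ny] L by (intro mult_left_mono) (auto simp: abs_minus_commute)
              finally have a1: "\<bar>\<sigma>1 (norm y) - \<sigma>0 (norm y)\<bar> \<le> L * D" .
              have a2: "max 0 (1 / s - 1 / norm y) \<le> 1 / r"
              proof -
                have "1 / s \<le> 1 / r" using sp r by (intro divide_left_mono) auto
                moreover have "0 \<le> 1 / norm y" by simp
                moreover have "0 \<le> 1 / r" using r by simp
                ultimately show ?thesis by linarith
              qed
              have "\<bar>g y\<bar> \<le> (L * D) * (1 / r)"
                unfolding g_def abs_mult using a1 a2 L D0 by (intro mult_mono) auto
              then show ?thesis using yA by simp
            qed
          qed
        qed
        also have "\<dots> = L * D / r * measure lborel A" by simp
        also have "\<dots> \<le> L * D / r * (4 * pi * R\<^sup>2 * h)" using mA L D0 r by (intro mult_left_mono) auto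
        also have "\<dots> = D / 2 * (L / (L + 1))"
        proof -
          have "4 * P * (r / (8 * P * L1)) = r / (2 * L1)" if "P > 0" "L1 > 0" for P L1 :: real
            using that by (simp add: field_simps)
          from this[of "pi * R\<^sup>2" "L + 1"] have "4 * pi * R\<^sup>2 * h = r / (2 * (L + 1))"
            using R L(1) by (simp add: h_def mult.assoc)
          moreover have "L * D / r * (r / (2 * L1)) = D / 2 * (L / L1)" for L1
            using r by simp
          ultimately show ?thesis by (simp only:)
        qed
        also have "\<dots> \<le> D / 2 * 1" using D0 L by (intro mult_left_mono) auto
        finally show ?thesis by simp
      qed
      have "D \<le> D / 2" unfolding D_def by (rule cSUP_least) (use u' est in \<open>auto simp: D_def\<close>)
      then have "D = 0" using D0 by simp
      then have "w0 s = w1 s" using Dup[of s] s False by (simp add: u'_def)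
      then show ?thesis by (simp add: s0 s1)
    qed
    have ind: "\<forall>s. s \<ge> max r (R - real j * h) \<longrightarrow> \<sigma>0 s = \<sigma>1 s" for j
    proof (induction j)
      case 0
      then show ?case using out by simp
    next
      case (Suc j)
      define u where "u = max r (R - real j * h)"
      have uR: "r \<le> u" "u \<le> R" using False h by (auto simp: u_def)
      show ?case
      proof (intro allI impI)
        fix s assume "s \<ge> max r (R - real (Suc j) * h)"
        then have "s \<ge> max r (u - h)" using h by (auto simp: u_def algebra_simps max_def split: if_splits)
        then show "\<sigma>0 s = \<sigma>1 s" using Suc.IH by (intro step[of u s]) (use uR in \<open>auto simp: u_def\<close>)
      qed
    qed
    obtain j where "R / h \<le> real j" using real_arch_simple by blast
    then have "R - real j * h \<le> r" using h r by (simp add: field_simps)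
    then show ?thesis using ind[of j] by simp
  qed
qed

section \<open>Conclusion: minimizers differ by a translation\<close>

theorem minimizers_translate:
  assumes m0: "minimizer M \<rho>0" and m1: "minimizer M \<rho>1" and M: "M > 0"
  obtains a where "AE x in lborel. \<rho>1 x = \<rho>0 (x + a)"
proof -
  have "J \<rho>0 = J \<rho>1" using m0 m1 by (auto simp: minimizer_def intro!: antisym)
  then have eE: "elev M \<rho>1 = elev M \<rho>0" by (simp add: elev_def)
  have E: "elev M \<rho>0 > 0"
    using J_minimizer_neg[OF m0 M] M zeta_pos by (simp add: elev_def divide_neg_pos mult_pos_neg)
  obtain a0 \<sigma>0 w0 where s0: "radial_state M (elev M \<rho>0) \<sigma>0 w0" and r0: "AE x in lborel. \<rho>0 x = \<sigma>0 (norm (x - a0))"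
    using minimizer_radial_state[OF m0 M] by blast
  obtain a1 \<sigma>1 w1 where s1: "radial_state M (elev M \<rho>0) \<sigma>1 w1" and r1: "AE x in lborel. \<rho>1 x = \<sigma>1 (norm (x - a1))"
    using minimizer_radial_state[OF m1 M] unfolding eE by blast
  have "AE x in lborel. \<rho>0 ((a0 - a1) + x) = \<sigma>0 (norm ((a0 - a1) + x - a0))"
    using leb_preserving_AE[OF leb_preserving_plus r0] .
  \<comment> \<open>The radial densities are known to agree only at positive radii.\<close>
  moreover have "AE x in lborel. x \<noteq> a1" by (rule AE_lborel_singleton)
  ultimately have "AE x in lborel. \<rho>1 x = \<rho>0 (x + (a0 - a1))"
    using r1
  proof eventually_elim
    case (elim x)
    have "(a0 - a1) + x - a0 = x - a1" "(a0 - a1) + x = x + (a0 - a1)" by simp_all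
    moreover have "\<sigma>0 (norm (x - a1)) = \<sigma>1 (norm (x - a1))"
      using elim by (intro radial_state_unique[OF s0 s1 M E]) simp
    ultimately show ?case using elim by metis
  qed
  then show ?thesis by (rule that)
qed

end

theorem theorem3:
  fixes k M :: real and f0 f1 :: "phase \<Rightarrow> real"
  assumes "0 < k" and "k < 3/2" and "0 < M"
    and "f0 \<in> FM k M" and "f1 \<in> FM k M"
    and "HC k f0 = (INF g\<in>FM k M. HC k g)"
    and "HC k f1 = (INF g\<in>FM k M. HC k g)"
  shows "\<exists>a :: real^3. AE z in lborel. f1 z = f0 (fst z + a, snd z)"
proof -
  interpret polytrope k by unfold_locales (use assms in auto)
  note r0 = minimizer_reduction[OF assms(4,6)] and r1 = minimizer_reduction[OF assms(5,7)]
  obtain a where a: "AE x in lborel. rho f1 x = rho f0 (x + a)"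
    using minimizers_translate[OF r0(1) r1(1) assms(3)] by blast
  have id: "leb_preserving (\<lambda>x::real^3. x)" using leb_preserving_plus[of "0::real^3"] by simp
  have T: "leb_preserving (\<lambda>z::phase. (a + fst z, snd z))"
    by (rule leb_preserving_map_prod[OF leb_preserving_plus id])
  \<comment> \<open>Both states are almost everywhere the \<open>profile\<close> of their spatial
    densities, and \<open>profile\<close> uses the position only through the density there, so the
    spatial shift carries over to phase space.\<close>
  have "AE z in lborel. f1 z = f0 (fst z + a, snd z)"
    using r1(2) leb_preserving_AE[OF T r0(2)] AE_phase_fst[OF a]
    by eventually_elim (simp add: profile_def add.commute)
  then show ?thesis ..
qed

end
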